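(* Let $K$ be a field, $S=K[x_1,\ldots,x_n]$, and let $J\subsetneq I$ be monomial ideals of $S$, not necessarily squarefree. Let $t=t_{I/J}$ be the index of $I/J$. Assume that $\operatorname{sdepth}_S I/J=t$. Then $\operatorname{depth}_S I/J=t$.
   Context: For a monomial ideal $L\subset S$, $G(L)$ denotes its minimal set of monomial generators ($G(0)=\emptyset$); $[n]=\{1,\ldots,n\}$; $\deg_{x_i}u$ is the exponent of $x_i$ in the monomial $u$. Numerical invariants of a pair of monomial ideals $J\subsetneq I$: $d_{I/J}$ is the smallest degree of an element of $G(I)$, i.e. $I$ is generated by some monomials of degree $d_{I/J}$ and a set of monomials of degree $\geq d_{I/J}+1$. For $i\in[n]$ put $e_i=\max_{u\in G(I)\cup G(J)}\deg_{x_i}u$, and set $e_{I/J}=\sum_{i\in[n],\,e_i>0}(e_i-1)$. Canonical form: for a variable $x_i$, let $1\le k_1<\cdots<k_s$ be all the positive exponents with which $x_i$ occurs in the monomials of $G(I)\cup G(J)$ (that is, $k$ is among them iff $x_i^{k}\mid u$ and $x_i^{k+1}\nmid u$ for some $u\in G(I)\cup G(J)$, $k\geq 1$). The canonical form of $I/J$ with respect to $x_i$ is obtained by replacing $x_i^{k_j}$ by $x_i^{j}$ in every generator in $G(I)\cup G(J)$ in which $x_i$ occurs with exponent exactly $k_j$. Doing this successively for all variables $x_1,\ldots,x_n$ gives the canonical form $I'/J'$ of $I/J$. Index: $t_{I/J}=\max\{d_{I'/J'}-e_{I'/J'},0\}$, where $I'/J'$ is the canonical form of $I/J$. Stanley depth: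 a Stanley decomposition $\mathcal D$ of the $\mathbb{Z}^n$-graded $S$-module $M=I/J$ is a finite family $(K[Z_l],u_l)_{l\in L}$, where each $u_l\in M$ is multihomogeneous and $Z_l\subset\{x_1,\ldots,x_n\}$, with $K[Z_l]\cap \operatorname{Ann}_S u_l=0$ and $M=\bigoplus_{l\in L}K[Z_l]u_l$ as a multigraded $K$-vector space. Its Stanley depth is $\operatorname{sdepth}(\mathcal D)=\min_{l\in L}|Z_l|$ (the depth of $\bigoplus_l K[Z_l]u_l$), and $\operatorname{sdepth}_S M$ is the maximum of $\operatorname{sdepth}(\mathcal D)$ over all Stanley decompositions $\mathcal D$ of $M$. The depth $\operatorname{depth}_S M$ is taken with respect to the maximal ideal $(x_1,\ldots,x_n)$. *)

theory Defs
  imports Complex_Main "HOL-Library.Poly_Mapping"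
begin

text \<open>
  The polynomial ring \<open>S = K[x\<^sub>1, \<dots>, x\<^sub>n]\<close> is the type \<open>('n, 'k) poly_ring\<close>, where the finite
  linearly ordered type \<open>'n\<close> indexes the variables; a monomial \<open>x\<^sup>a\<close> is identified with its exponent
  vector \<open>a\<close>. Ideals of \<open>S\<close> are the submodules of \<open>S\<close> over itself, so \<open>ideal.span B\<close> is the ideal
  generated by \<open>B\<close>.
\<close>

type_synonym 'n exps = "'n \<Rightarrow>\<^sub>0 nat"
type_synonym ('n, 'k) poly_ring = "'n exps \<Rightarrow>\<^sub>0 'k"

interpretation ideal: module "(*) :: 'a::comm_ring_1 \<Rightarrow> 'a \<Rightarrow> 'a"
  by unfold_locales (simp_all add: algebra_simps)

definition monom :: "'n exps \<Rightarrow> ('n, 'k::comm_ring_1) poly_ring" where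
  "monom a = Poly_Mapping.single a 1"

definition monomial_ideal :: "('n, 'k::comm_ring_1) poly_ring set \<Rightarrow> bool" where
  "monomial_ideal I \<longleftrightarrow> (\<exists>A. I = ideal.span (monom ` A))"

text \<open>
  The lemmas \<open>span_min_gens\<close> and \<open>min_gens_least\<close> below show that, for a monomial ideal \<open>I\<close>, the set
  \<open>min_gens I\<close> is the least set of monomials generating \<open>I\<close>.
\<close>

definition min_gens :: "('n, 'k::comm_ring_1) poly_ring set \<Rightarrow> 'n exps set" where
  "min_gens I = {a. monom a \<in> I \<and>
     (\<forall>b. monom b \<in> I \<longrightarrow> (monom b :: ('n, 'k) poly_ring) dvd monom a \<longrightarrow> b = a)}"

definition mdeg :: "'n::finite exps \<Rightarrow> nat" where
  "mdeg a = (\<Sum>i\<in>UNIV. Poly_Mapping.lookup a i)"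


subsection \<open>Numerical invariants, canonical form and index of \<open>I/J\<close>\<close>

definition d_inv :: "('n::finite, 'k::comm_ring_1) poly_ring set \<Rightarrow> ('n, 'k) poly_ring set \<Rightarrow> nat" where
  "d_inv I J = Min (mdeg ` min_gens I)"

definition e_var :: "('n, 'k::comm_ring_1) poly_ring set \<Rightarrow> ('n, 'k) poly_ring set \<Rightarrow> 'n \<Rightarrow> nat" where
  "e_var I J i = Max ((\<lambda>a. Poly_Mapping.lookup a i) ` (min_gens I \<union> min_gens J))"

definition e_inv :: "('n::finite, 'k::comm_ring_1) poly_ring set \<Rightarrow> ('n, 'k) poly_ring set \<Rightarrow> nat" where
  "e_inv I J = (\<Sum>i | e_var I J i > 0. e_var I J i - 1)"

definition pos_exps :: "('n, 'k::comm_ring_1) poly_ring set \<Rightarrow> ('n, 'k) poly_ring set \<Rightarrow> 'n \<Rightarrow> nat set" where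
  "pos_exps I J i =
     {k. k \<ge> 1 \<and> (\<exists>a \<in> min_gens I \<union> min_gens J. Poly_Mapping.lookup a i = k)}"

text \<open>
  If \<open>k\<^sub>1 < \<dots> < k\<^sub>s\<close> are the elements of \<open>E\<close>, then \<open>card {k \<in> E. k \<le> k\<^sub>j} = j\<close>. Hence \<open>relabel E i\<close>
  replaces the exponent \<open>k\<^sub>j\<close> of \<open>x\<^sub>i\<close> by \<open>j\<close>; the exponent \<open>0\<close> is kept, since \<open>0 \<notin> E\<close>.
\<close>

definition relabel :: "nat set \<Rightarrow> 'n \<Rightarrow> 'n exps \<Rightarrow> 'n exps" where
  "relabel E i a = Poly_Mapping.update i (card {k \<in> E. k \<le> Poly_Mapping.lookup a i}) a"

definition canonical_var ::
  "'n \<Rightarrow> ('n, 'k::comm_ring_1) poly_ring set \<times> ('n, 'k) poly_ring set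
      \<Rightarrow> ('n, 'k) poly_ring set \<times> ('n, 'k) poly_ring set" where
  "canonical_var i = (\<lambda>(I, J).
     (ideal.span (monom ` relabel (pos_exps I J i) i ` min_gens I),
      ideal.span (monom ` relabel (pos_exps I J i) i ` min_gens J)))"

definition canonical_form ::
  "('n::{finite,linorder}, 'k::comm_ring_1) poly_ring set \<Rightarrow> ('n, 'k) poly_ring set
      \<Rightarrow> ('n, 'k) poly_ring set \<times> ('n, 'k) poly_ring set" where
  "canonical_form I J = fold canonical_var (sorted_list_of_set UNIV) (I, J)"

definition index ::
  "('n::{finite,linorder}, 'k::comm_ring_1) poly_ring set \<Rightarrow> ('n, 'k) poly_ring set \<Rightarrow> nat" where
  "index I J = (case canonical_form I J of
     (I', J') \<Rightarrow> nat (max (int (d_inv I' J') - int (e_inv I' J')) 0))"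


subsection \<open>Depth\<close>

text \<open>
  A quotient module \<open>N/P\<close>, with \<open>P \<subseteq> N\<close> ideals of \<open>S\<close>, is represented by the pair \<open>(N, P)\<close>, and its
  elements are represented by the elements of \<open>N\<close>, up to congruence modulo \<open>P\<close>. For \<open>M = N/P\<close> the
  quotient \<open>M/fM\<close> is \<open>N/(P + fN)\<close>. The sequence \<open>f\<^sub>1, \<dots>, f\<^sub>r\<close> is \<open>M\<close>-regular iff \<open>f\<^sub>1\<close> is a
  nonzerodivisor on \<open>M\<close> and \<open>f\<^sub>2, \<dots>, f\<^sub>r\<close> is \<open>M/f\<^sub>1M\<close>-regular, where the empty sequence is
  \<open>M\<close>-regular iff \<open>M \<noteq> 0\<close>. Unfolding the recursion, this base case is the condition
  \<open>M \<noteq> (f\<^sub>1, \<dots>, f\<^sub>r)M\<close>. The depth is the maximal length of a regular sequence in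
  \<open>(x\<^sub>1, \<dots>, x\<^sub>n)\<close>.
\<close>

definition max_ideal :: "('n, 'k::comm_ring_1) poly_ring set" where
  "max_ideal = ideal.span (range (\<lambda>i. monom (Poly_Mapping.single i 1)))"

fun regular_seq ::
  "'a::comm_ring_1 set \<Rightarrow> 'a set \<Rightarrow> 'a list \<Rightarrow> bool" where
  "regular_seq N P [] \<longleftrightarrow> N \<noteq> P"
| "regular_seq N P (f # fs) \<longleftrightarrow>
     (\<forall>u\<in>N. f * u \<in> P \<longrightarrow> u \<in> P) \<and> regular_seq N {p + f * u | p u. p \<in> P \<and> u \<in> N} fs"

definition depth :: "('n, 'k::comm_ring_1) poly_ring set \<Rightarrow> ('n, 'k) poly_ring set \<Rightarrow> nat" where
  "depth I J = Max {length fs | fs. set fs \<subseteq> max_ideal \<and> regular_seq I J fs}"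


subsection \<open>Stanley depth\<close>

text \<open>\<open>poly_sub Z\<close> is the subring \<open>K[Z]\<close> of \<open>S\<close>.\<close>

definition poly_sub :: "'n set \<Rightarrow> ('n, 'k::comm_ring_1) poly_ring set" where
  "poly_sub Z = {p. \<forall>a\<in>Poly_Mapping.keys p. Poly_Mapping.keys a \<subseteq> Z}"

definition multihom :: "('n, 'k::comm_ring_1) poly_ring \<Rightarrow> bool" where
  "multihom u \<longleftrightarrow> (\<exists>a c. u = Poly_Mapping.single a c)"

text \<open>
  A finite family \<open>(K[Z\<^sub>l], u\<^sub>l)\<close> is a list of pairs, where \<open>u\<^sub>l \<in> I/J\<close> is given by a multihomogeneous
  representative in \<open>I\<close>. The last three conjuncts say that \<open>K[Z\<^sub>l] \<inter> Ann u\<^sub>l = 0\<close>, that the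
  \<open>K[Z\<^sub>l]u\<^sub>l\<close> span \<open>I/J\<close>, and that their sum is direct.
\<close>

definition stanley_decomp ::
  "('n, 'k::comm_ring_1) poly_ring set \<Rightarrow> ('n, 'k) poly_ring set
      \<Rightarrow> ('n set \<times> ('n, 'k) poly_ring) list \<Rightarrow> bool" where
  "stanley_decomp I J D \<longleftrightarrow>
     (\<forall>(Z, u)\<in>set D. u \<in> I \<and> multihom u) \<and>
     (\<forall>(Z, u)\<in>set D. \<forall>p\<in>poly_sub Z. p * u \<in> J \<longrightarrow> p = 0) \<and>
     (\<forall>v\<in>I. \<exists>p. (\<forall>l<length D. p l \<in> poly_sub (fst (D ! l))) \<and>
        v - (\<Sum>l<length D. p l * snd (D ! l)) \<in> J) \<and>
     (\<forall>p. (\<forall>l<length D. p l \<in> poly_sub (fst (D ! l))) \<longrightarrow>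
        (\<Sum>l<length D. p l * snd (D ! l)) \<in> J \<longrightarrow>
        (\<forall>l<length D. p l * snd (D ! l) \<in> J))"

definition sdepth_decomp :: "('n set \<times> ('n, 'k::zero) poly_ring) list \<Rightarrow> nat" where
  "sdepth_decomp D = Min ((\<lambda>(Z, u). card Z) ` set D)"

definition sdepth :: "('n, 'k::comm_ring_1) poly_ring set \<Rightarrow> ('n, 'k) poly_ring set \<Rightarrow> nat" where
  "sdepth I J = Max {sdepth_decomp D | D. stanley_decomp I J D}"


subsection \<open>Minimal monomial generators\<close>

lemma monom_add: "monom (a + b) = monom a * (monom b :: ('n, 'k::comm_ring_1) poly_ring)"
  by (simp add: monom_def Poly_Mapping.mult_single)

lemma in_span_monom_keys:
  assumes "p \<in> ideal.span (monom ` A :: ('n, 'k::comm_ring_1) poly_ring set)"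
    and "k \<in> Poly_Mapping.keys p"
  shows "\<exists>b\<in>A. \<exists>c. k = b + c"
proof -
  let ?T = "{p :: ('n, 'k) poly_ring. \<forall>k\<in>Poly_Mapping.keys p. \<exists>b\<in>A. \<exists>c. k = b + c}"
  have "ideal.subspace ?T"
  proof (rule ideal.subspaceI)
    show "0 \<in> ?T" by simp
  next
    fix x y assume "x \<in> ?T" "y \<in> ?T"
    then show "x + y \<in> ?T" using Poly_Mapping.keys_add[of x y] by blast
  next
    fix c x assume x: "x \<in> ?T"
    show "c * x \<in> ?T"
    proof (clarify)
      fix k assume "k \<in> Poly_Mapping.keys (c * x)"
      then obtain s t where st: "k = s + t" "t \<in> Poly_Mapping.keys x"
        using Poly_Mapping.keys_mult[of c x] by blast
      with x obtain b d where "b \<in> A" "t = b + d" by blast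
      then show "\<exists>b\<in>A. \<exists>c. k = b + c"
        using st by (intro bexI[of _ b] exI[of _ "s + d"]) (simp_all add: ac_simps)
    qed
  qed
  moreover have "monom ` A \<subseteq> ?T"
    by (auto simp: monom_def split: if_splits) (metis add.right_neutral)
  ultimately have "ideal.span (monom ` A) \<subseteq> ?T" by (rule ideal.span_minimal[rotated])
  then show ?thesis using assms by blast
qed

lemma monom_dvd_iff:
  "(monom b :: ('n, 'k::comm_ring_1) poly_ring) dvd monom a \<longleftrightarrow> (\<exists>c. a = b + c)"
proof
  assume "(monom b :: ('n, 'k) poly_ring) dvd monom a"
  then obtain q :: "('n, 'k) poly_ring" where "monom a = q * monom b"
    unfolding dvd_def by (auto simp: mult.commute)
  then have "(monom a :: ('n, 'k) poly_ring) \<in> ideal.span (monom ` {b})"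
    by (simp add: ideal.span_base ideal.span_scale)
  then show "\<exists>c. a = b + c"
    using in_span_monom_keys[of "monom a :: ('n, 'k) poly_ring" "{b}" a] by (simp add: monom_def)
next
  assume "\<exists>c. a = b + c"
  then show "(monom b :: ('n, 'k) poly_ring) dvd monom a" by (auto simp: monom_add)
qed

lemma min_gensI:
  assumes "(monom a :: ('n, 'k::comm_ring_1) poly_ring) \<in> I"
    and "\<And>b. monom b \<in> I \<Longrightarrow> (monom b :: ('n, 'k) poly_ring) dvd monom a \<Longrightarrow> b = a"
  shows "a \<in> min_gens I"
  unfolding min_gens_def using assms by (intro CollectI conjI allI impI)

lemma min_gensD:
  assumes "a \<in> min_gens (I :: ('n, 'k::comm_ring_1) poly_ring set)"
  shows "monom a \<in> I"
    and "monom b \<in> I \<Longrightarrow> (monom b :: ('n, 'k) poly_ring) dvd monom a \<Longrightarrow> b = a"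
proof -
  from assms have *: "monom a \<in> I \<and>
      (\<forall>b. monom b \<in> I \<longrightarrow> (monom b :: ('n, 'k) poly_ring) dvd monom a \<longrightarrow> b = a)"
    unfolding min_gens_def by (rule CollectD)
  show "monom a \<in> I" using * by (rule conjunct1)
  show "monom b \<in> I \<Longrightarrow> (monom b :: ('n, 'k) poly_ring) dvd monom a \<Longrightarrow> b = a"
    using conjunct2[OF *] by (elim allE impE)
qed

lemma min_gens_least:
  assumes "ideal.span (monom ` A) = (I :: ('n, 'k::comm_ring_1) poly_ring set)"
  shows "min_gens I \<subseteq> A"
proof
  fix a assume a: "a \<in> min_gens I"
  have "(monom a :: ('n, 'k) poly_ring) \<in> ideal.span (monom ` A)"
    unfolding assms using a by (rule min_gensD)
  moreover have "a \<in> Poly_Mapping.keys (monom a :: ('n, 'k) poly_ring)" by (simp add: monom_def)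
  ultimately have "\<exists>b\<in>A. \<exists>c. a = b + c" by (rule in_span_monom_keys)
  then obtain b c where b: "b \<in> A" "a = b + c" by (elim bexE exE)
  have "(monom b :: ('n, 'k) poly_ring) \<in> I"
    unfolding assms[symmetric] using b(1) by (intro ideal.span_base imageI)
  moreover have "(monom b :: ('n, 'k) poly_ring) dvd monom a"
    unfolding b(2) monom_add by (rule dvd_triv_left)
  ultimately have "b = a" using a by (rule min_gensD(2)[rotated 1])
  with b(1) show "a \<in> A" by (simp only:)
qed

lemma ex_min_gen_dvd:
  fixes I :: "('n::finite, 'k::comm_ring_1) poly_ring set"
  assumes "monom a \<in> I"
  shows "\<exists>b\<in>min_gens I. (monom b :: ('n, 'k) poly_ring) dvd monom a"
  using assms
proof (induction "mdeg a" arbitrary: a rule: less_induct)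
  case less
  show ?case
  proof (cases "a \<in> min_gens I")
    case False
    with less.prems obtain b where b: "monom b \<in> I"
      "(monom b :: ('n, 'k) poly_ring) dvd monom a" "b \<noteq> a"
      using min_gensI by metis
    then obtain c where c: "a = b + c" using monom_dvd_iff by blast
    with b(3) obtain i where "Poly_Mapping.lookup c i \<noteq> 0"
      by (metis add.right_neutral poly_mapping_eqI Poly_Mapping.lookup_zero)
    then have "mdeg c > 0" by (auto simp: mdeg_def intro!: sum_pos2[of _ i])
    then have "mdeg b < mdeg a" by (simp add: c mdeg_def lookup_add sum.distrib)
    with less.hyps[of b] b show ?thesis using dvd_trans by blast
  next
    case True
    then show ?thesis by (intro bexI[of _ a]) simp_all
  qed
qed

lemma span_min_gens:
  fixes I :: "('n::finite, 'k::comm_ring_1) poly_ring set"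
  assumes "monomial_ideal I"
  shows "ideal.span (monom ` min_gens I) = I"
proof -
  obtain A where A: "I = ideal.span (monom ` A)" using assms by (auto simp: monomial_ideal_def)
  have "monom ` A \<subseteq> ideal.span (monom ` min_gens I :: ('n, 'k) poly_ring set)"
  proof clarify
    fix a assume "a \<in> A"
    then have "monom a \<in> I" by (auto simp: A intro: ideal.span_base)
    then obtain b q where "b \<in> min_gens I" "(monom a :: ('n, 'k) poly_ring) = q * monom b"
      using ex_min_gen_dvd[of a I] by (metis dvd_def mult.commute)
    then show "(monom a :: ('n, 'k) poly_ring) \<in> ideal.span (monom ` min_gens I)"
      by (simp add: ideal.span_scale ideal.span_base)
  qed
  then have "I \<subseteq> ideal.span (monom ` min_gens I)"
    unfolding A by (intro ideal.span_minimal ideal.subspace_span)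
  moreover have "ideal.span (monom ` min_gens I) \<subseteq> I"
    using min_gensD(1)[of _ I] unfolding A
    by (intro ideal.span_minimal ideal.subspace_span) auto
  ultimately show ?thesis by blast
qed

end

theory Submission
  imports Defs "HOL-Library.FuncSet"
begin

text \<open>
  Identify a monomial with its exponent vector, and let \<open>U\<close> and \<open>V\<close> be the sets of exponent vectors
  of \<open>I\<close> and \<open>J\<close>. Let \<open>E i\<close> be the set of positive exponents of \<open>x\<^sub>i\<close> in the minimal generators of
  \<open>I\<close> and \<open>J\<close>, and \<open>g i\<close> its maximum, or \<open>0\<close> if \<open>E i\<close> is empty. Call the coordinate \<open>i\<close> of a vector \<open>b\<close> saturated if
  \<open>b i \<ge> g i\<close>. Passing to the canonical form replaces an exponent by its rank in \<open>E i\<close>, so the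
  inequality between \<open>d\<close> and \<open>e\<close> that defines the index \<open>t\<close> becomes a statement about ranks
  (\<open>index_le_ranks\<close>). It says that each vector of \<open>U - V\<close> has at least \<open>t\<close> saturated coordinates
  and, for \<open>t > 0\<close>, that a vector with exactly \<open>t\<close> of them has all its other coordinates on the
  last level below \<open>g\<close> (\<open>card_sat_ge\<close>).

  Depth at least \<open>t\<close>. The module \<open>I/J\<close> has a filtration whose factors are shifted copies of
  \<open>K[Z]\<close>, where \<open>Z\<close> is the set of saturated coordinates of a vector of \<open>U - V\<close>; so \<open>Z\<close> has at
  least \<open>t\<close> elements. The elementary symmetric polynomials of degrees \<open>t, \<dots>, 1\<close> form a regular
  sequence on each such \<open>K[Z]\<close>, hence on \<open>I/J\<close> (\<open>regular_seq_elem_syms\<close>). They are used because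
  one sequence has to serve all factors, over every field.

  Depth at most \<open>t\<close>, for \<open>t > 0\<close>. The vectors with exactly \<open>t\<close> saturated coordinates fall into
  classes, one for each \<open>t\<close>-set \<open>S\<close> such that the vector \<open>g - 1 + 1\<^sub>S\<close> lies in \<open>U - V\<close>. If these sets
  \<open>S\<close> can be matched injectively with sets \<open>S \<union> {i}\<close> of the same kind, then merging the matched
  classes gives a Stanley decomposition of Stanley depth at least \<open>t + 1\<close>
  (\<open>partitionable_of_matching\<close>), contrary to the hypothesis. If there is no such matching, then the
  rows of the signed incidence matrix are linearly dependent (\<open>independent_rows_matching\<close>). A
  relation between them is a Koszul cycle of multidegree \<open>g\<close> and homological degree \<open>n - t\<close>. It is
  not a boundary, since \<open>I/J\<close> has no vectors with \<open>t - 1\<close> saturated coordinates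
  (\<open>koszul_homology_nonzero_of_relation\<close>). Nonzero Koszul homology in degree \<open>n - t\<close> bounds the
  length of all regular sequences by \<open>t\<close> (\<open>koszul_homology_bound\<close>).

  For \<open>t = 0\<close> the upper bound is that Stanley depth \<open>0\<close> forces a socle element: otherwise
  \<open>U - V\<close> can be cut into cells of dimension at least one (\<open>partitionable_positive\<close>).
\<close>

(* This simplification rule moves brackets to the left and so works against mult.assoc. *)
declare ideal.scale_scale [simp del]

section \<open>Partitions of sets of exponent vectors into cells\<close>

definition cell :: "('n \<Rightarrow> nat) \<Rightarrow> 'n set \<Rightarrow> ('n \<Rightarrow> nat) set" where
  "cell a Z = {b. \<forall>i. if i \<in> Z then a i \<le> b i else b i = a i}"

text \<open>
  The combinatorial shadow of a Stanley decomposition: the cell with corner \<open>a\<close> and directions \<open>Z\<close>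
  is the set of exponents of the monomials in \<open>x\<^sup>a K[Z]\<close>.
\<close>

definition partitionable :: "nat \<Rightarrow> ('n \<Rightarrow> nat) set \<Rightarrow> bool" where
  "partitionable r A \<longleftrightarrow> (\<exists>D. finite D \<and> (\<forall>(a, Z)\<in>D. r \<le> card Z) \<and>
     (\<forall>p\<in>D. \<forall>q\<in>D. p \<noteq> q \<longrightarrow> case_prod cell p \<inter> case_prod cell q = {}) \<and>
     (\<Union>p\<in>D. case_prod cell p) = A)"

lemma partitionable_empty: "partitionable r {}"
  unfolding partitionable_def by (intro exI[of _ "{}"]) simp

lemma partitionable_Un:
  assumes "partitionable r A" "partitionable r B" "A \<inter> B = {}"
  shows "partitionable r (A \<union> B)"
proof -
  obtain D where D: "finite D" "\<forall>(a, Z)\<in>D. r \<le> card Z"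
    "\<forall>p\<in>D. \<forall>q\<in>D. p \<noteq> q \<longrightarrow> case_prod cell p \<inter> case_prod cell q = {}"
    "(\<Union>p\<in>D. case_prod cell p) = A"
    using assms(1) unfolding partitionable_def by blast
  obtain D' where D': "finite D'" "\<forall>(a, Z)\<in>D'. r \<le> card Z"
    "\<forall>p\<in>D'. \<forall>q\<in>D'. p \<noteq> q \<longrightarrow> case_prod cell p \<inter> case_prod cell q = {}"
    "(\<Union>p\<in>D'. case_prod cell p) = B"
    using assms(2) unfolding partitionable_def by blast
  have mixed: "case_prod cell p \<inter> case_prod cell q = {}" if "p \<in> D" "q \<in> D'" for p q
    using that D(4) D'(4) assms(3) by blast
  show ?thesis
    unfolding partitionable_def
  proof (intro exI[of _ "D \<union> D'"] conjI ballI impI)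
    fix p q assume "p \<in> D \<union> D'" "q \<in> D \<union> D'" "p \<noteq> q"
    then show "case_prod cell p \<inter> case_prod cell q = {}"
      using D(3) D'(3) mixed[of p q] mixed[of q p] by blast
  qed (use D D' in auto)
qed

lemma partitionable_UN:
  assumes "finite X" "\<And>x. x \<in> X \<Longrightarrow> partitionable r (A x)"
    "\<And>x y. x \<in> X \<Longrightarrow> y \<in> X \<Longrightarrow> x \<noteq> y \<Longrightarrow> A x \<inter> A y = {}"
  shows "partitionable r (\<Union>x\<in>X. A x)"
  using assms
proof (induction X)
  case (insert x X)
  then have "partitionable r (A x \<union> (\<Union>x\<in>X. A x))"
    by (intro partitionable_Un) (blast, blast, fastforce)
  then show ?case by simp
qed (simp add: partitionable_empty)

text \<open>
  For the exponents of a monomial ideal this holds as soon as \<open>g\<close> bounds all exponents in the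
  generators. It makes a set of vectors a finite object.
\<close>

definition determined :: "('n \<Rightarrow> nat) \<Rightarrow> ('n \<Rightarrow> nat) set \<Rightarrow> bool" where
  "determined g A \<longleftrightarrow> (\<forall>b. b \<in> A \<longleftrightarrow> (\<lambda>i. min (b i) (g i)) \<in> A)"

lemma determinedI:
  assumes "\<And>b. b \<in> A \<longleftrightarrow> (\<lambda>i. min (b i) (g i)) \<in> A"
  shows "determined g A"
  using assms by (simp add: determined_def)

lemma determinedD: "determined g A \<Longrightarrow> b \<in> A \<longleftrightarrow> (\<lambda>i. min (b i) (g i)) \<in> A"
  unfolding determined_def by blast

lemma determined_cong:
  assumes "determined g A" "\<And>i. min (b i) (g i) = min (c i) (g i)"
  shows "b \<in> A \<longleftrightarrow> c \<in> A"
proof -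
  have "(\<lambda>i. min (b i) (g i)) = (\<lambda>i. min (c i) (g i))" using assms(2) by blast
  then show ?thesis using determinedD[OF assms(1), of b] determinedD[OF assms(1), of c] by simp
qed

lemma finite_below: "finite {a :: 'n::finite \<Rightarrow> nat. \<forall>i. a i \<le> g i}"
proof -
  have "{a. \<forall>i. a i \<le> g i} = PiE UNIV (\<lambda>i. {..g i})" by (auto simp: PiE_def Pi_def)
  then show ?thesis by (simp add: finite_PiE)
qed

text \<open>
  Cut the set into the fibres of the truncation at \<open>g\<close>. The fibre of \<open>a\<close> is a cell that is free in
  the coordinates where \<open>a\<close> reaches \<open>g\<close>.
\<close>

lemma partitionable_determined:
  fixes A :: "('n::finite \<Rightarrow> nat) set"
  assumes "determined g A" "\<And>b. b \<in> A \<Longrightarrow> r \<le> card {i. g i \<le> b i}"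
  shows "partitionable r A"
proof -
  let ?B = "{a \<in> A. \<forall>i. a i \<le> g i}"
  let ?c = "\<lambda>a. (a, {i. g i \<le> a i})"
  have cell: "b \<in> cell a {i. g i \<le> a i} \<longleftrightarrow> (\<lambda>i. min (b i) (g i)) = a"
    if "\<forall>i. a i \<le> g i" for a b
  proof
    assume b: "b \<in> cell a {i. g i \<le> a i}"
    show "(\<lambda>i. min (b i) (g i)) = a"
    proof
      fix i show "min (b i) (g i) = a i"
        using b that[rule_format, of i] by (auto simp: cell_def min_def dest!: spec[of _ i] split: if_splits)
    qed
  next
    assume "(\<lambda>i. min (b i) (g i)) = a"
    then show "b \<in> cell a {i. g i \<le> a i}"
      by (auto simp: cell_def min_def dest: leD split: if_splits)
  qed
  have "finite ?B" by (rule finite_subset[OF _ finite_below[of g]]) blast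
  moreover have "(\<Union>p\<in>?c ` ?B. case_prod cell p) = A"
  proof (intro set_eqI iffI)
    fix b assume "b \<in> (\<Union>p\<in>?c ` ?B. case_prod cell p)"
    then show "b \<in> A" using cell determinedD[OF assms(1), of b] by auto
  next
    fix b assume "b \<in> A"
    then have "(\<lambda>i. min (b i) (g i)) \<in> ?B" using determinedD[OF assms(1), of b] by simp
    moreover have "b \<in> cell (\<lambda>i. min (b i) (g i)) {i. g i \<le> min (b i) (g i)}"
      by (subst cell) simp_all
    ultimately show "b \<in> (\<Union>p\<in>?c ` ?B. case_prod cell p)" by blast
  qed
  ultimately show ?thesis
    unfolding partitionable_def using cell assms(2)
    by (intro exI[of _ "?c ` ?B"] conjI) auto
qed

text \<open>
  For \<open>A = U - V\<close> and \<open>W\<close> the set of all variables, the last hypothesis says that \<open>I/J\<close> has no socle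
  elements, so this is the case of positive Stanley depth. The proof is by induction on \<open>W\<close>. Look at
  the columns of \<open>A\<close> in a direction \<open>w\<close>. Infinite columns are one-dimensional cells already.
  The finite ones are cut into slices with constant \<open>w\<close>-coordinate, and each slice again satisfies
  the hypothesis, with \<open>w\<close> removed: from a point go to the top of its column, where one can only move
  in some direction \<open>i \<noteq> w\<close>, and by convexity the original point can be moved in that direction.
\<close>

lemma partitionable_positive:
  fixes A :: "('n::finite \<Rightarrow> nat) set"
  assumes "finite W" "determined g A"
    and "\<And>a b c. a \<in> A \<Longrightarrow> c \<in> A \<Longrightarrow> a \<le> b \<Longrightarrow> b \<le> c \<Longrightarrow> b \<in> A"
    and "\<And>a. a \<in> A \<Longrightarrow> \<exists>i\<in>W. a(i := Suc (a i)) \<in> A"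
  shows "partitionable 1 A"
  using assms
proof (induction W arbitrary: A g)
  case empty
  then have "A = {}" by blast
  then show ?case by (simp add: partitionable_empty)
next
  case (insert w W)
  note det = insert.prems(1) and conv = insert.prems(2) and step = insert.prems(3)
  have cong: "b \<in> A \<longleftrightarrow> c \<in> A" if "\<And>i. min (b i) (g i) = min (c i) (g i)" for b c
    using determined_cong[OF det that] .
  \<comment> \<open>An element of \<open>A\<close> lies in an infinite column iff it stays in \<open>A\<close> when raised to level \<open>g w\<close>.\<close>
  define raise where "raise b = b(w := max (b w) (g w))" for b
  have raise_mono: "raise b \<le> raise c" if "b \<le> c" for b c
    using that[THEN le_funD] by (auto simp: le_fun_def raise_def max.coboundedI1)
  have raise_ge: "b \<le> raise b" for b by (auto simp: raise_def le_fun_def)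
  have raise_down: "raise a \<in> A" if "a \<in> A" "a \<le> b" "raise b \<in> A" for a b
    using conv[OF that(1,3) raise_ge raise_mono[OF that(2)]] .
  \<comment> \<open>The union of the infinite columns that start at level \<open>p\<close>.\<close>
  define start where "start p = {b. p \<le> b w \<and> b(w := p) \<in> A \<and> b(w := g w) \<in> A \<and>
      (\<forall>q<p. b(w := q) \<notin> A)}" for p
  \<comment> \<open>The part of the finite columns at level \<open>k\<close>.\<close>
  define slice where "slice k = {b \<in> A. b w = k \<and> raise b \<notin> A}" for k
  have "partitionable 1 (\<Union>p\<in>{..g w}. start p)"
  proof (rule partitionable_UN)
    fix p assume p: "p \<in> {..g w}"
    have "determined (g(w := p)) (start p)"
    proof (rule determinedI)
      fix b :: "'n \<Rightarrow> nat"
      let ?b = "\<lambda>i. min (b i) ((g(w := p)) i)"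
      have "b(w := q) \<in> A \<longleftrightarrow> ?b(w := q) \<in> A" for q
        by (rule cong) simp
      then show "b \<in> start p \<longleftrightarrow> ?b \<in> start p" by (simp add: start_def)
    qed
    moreover have "1 \<le> card {i. (g(w := p)) i \<le> b i}" if "b \<in> start p" for b
      using that by (auto simp: Suc_le_eq card_gt_0_iff start_def)
    ultimately show "partitionable 1 (start p)" by (rule partitionable_determined)
  next
    fix p q :: nat assume "p \<noteq> q"
    then show "start p \<inter> start q = {}" by (auto simp: start_def) (metis nat_neq_iff)
  qed simp
  moreover have "partitionable 1 (\<Union>k\<in>{..<g w}. slice k)"
  proof (rule partitionable_UN)
    fix k assume k: "k \<in> {..<g w}"
    \<comment> \<open>The bound \<open>Suc k\<close> distinguishes the value \<open>k\<close> from all larger ones.\<close>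
    have "determined (g(w := Suc k)) (slice k)"
    proof (rule determinedI)
      fix b :: "'n \<Rightarrow> nat"
      let ?b = "\<lambda>i. min (b i) ((g(w := Suc k)) i)"
      have w: "b w = k \<longleftrightarrow> ?b w = k" by auto
      have "b \<in> A \<longleftrightarrow> ?b \<in> A" "raise b \<in> A \<longleftrightarrow> raise ?b \<in> A" if "b w = k"
        using that k by (auto intro!: cong simp: raise_def)
      with w show "b \<in> slice k \<longleftrightarrow> ?b \<in> slice k" by (auto simp: slice_def)
    qed
    then show "partitionable 1 (slice k)"
    proof (rule insert.IH)
      fix a b c assume *: "a \<in> slice k" "c \<in> slice k" "a \<le> b" "b \<le> c"
      then have "b \<in> A" using conv[of a c b] by (simp add: slice_def)
      moreover have "b w = k" using *
        by (auto simp: slice_def intro!: antisym dest: le_funD[of _ _ w])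
      moreover have "raise b \<notin> A" using * raise_down[of a b] by (auto simp: slice_def)
      ultimately show "b \<in> slice k" by (simp add: slice_def)
    next
      fix a assume a: "a \<in> slice k"
      then have aA: "a \<in> A" "a w = k" "raise a \<notin> A" by (auto simp: slice_def)
      define Q where "Q = {q. k \<le> q \<and> a(w := q) \<in> A}"
      have "Q \<subseteq> {..<g w}"
      proof
        fix q assume q: "q \<in> Q"
        show "q \<in> {..<g w}"
        proof (rule ccontr)
          assume "q \<notin> {..<g w}"
          then have "a(w := q) \<in> A \<longleftrightarrow> raise a \<in> A"
            using aA(2) k by (intro cong) (auto simp: raise_def)
          then show False using q aA by (simp add: Q_def)
        qed
      qed
      then have fin: "finite Q" by (rule finite_subset) simp
      have "k \<in> Q" using aA by (auto simp: Q_def fun_upd_idem)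
      then have M: "Max Q \<in> Q" using fin Max_in by blast
      define top where "top = a(w := Max Q)"
      have "top \<in> A" using M by (simp add: Q_def top_def)
      moreover have "top(w := Suc (top w)) \<notin> A"
      proof
        assume "top(w := Suc (top w)) \<in> A"
        then have "Suc (Max Q) \<in> Q" using M by (simp add: Q_def top_def)
        then show False using Max_ge[OF fin] by fastforce
      qed
      ultimately obtain i where i: "i \<in> W" "top(i := Suc (top i)) \<in> A"
        using step[of top] by blast
      have "i \<noteq> w" using i insert.hyps by blast
      then have le: "a \<le> a(i := Suc (a i))" "a(i := Suc (a i)) \<le> top(i := Suc (top i))"
        using M aA(2) by (auto simp: le_fun_def top_def Q_def)
      then have "a(i := Suc (a i)) \<in> A" using conv[OF aA(1) i(2)] by blast
      moreover have "raise (a(i := Suc (a i))) \<notin> A"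
        using raise_down[OF aA(1) le(1)] aA(3) by blast
      ultimately show "\<exists>i\<in>W. a(i := Suc (a i)) \<in> slice k"
        using i(1) \<open>i \<noteq> w\<close> aA(2) by (intro bexI[of _ i]) (simp_all add: slice_def)
    qed
  qed (auto simp: slice_def)
  moreover have sub: "b \<in> A \<and> raise b \<in> A" if "b \<in> start p" "p \<le> g w" for b p
  proof -
    have *: "p \<le> b w" "b(w := p) \<in> A" "b(w := g w) \<in> A" using that by (auto simp: start_def)
    then have "raise b \<in> A"
      using cong[of "b(w := g w)" "raise b"] by (simp add: raise_def)
    moreover have "b(w := p) \<le> b" using * by (simp add: le_fun_def)
    ultimately show ?thesis using conv[OF *(2)] raise_ge by blast
  qed
  then have "(\<Union>p\<in>{..g w}. start p) \<inter> (\<Union>k\<in>{..<g w}. slice k) = {}"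
    by (fastforce simp: slice_def)
  moreover have "(\<Union>p\<in>{..g w}. start p) \<union> (\<Union>k\<in>{..<g w}. slice k) = A"
  proof (intro equalityI subsetI)
    fix b assume "b \<in> A"
    show "b \<in> (\<Union>p\<in>{..g w}. start p) \<union> (\<Union>k\<in>{..<g w}. slice k)"
    proof (cases "raise b \<in> A")
      case True
      define p where "p = (LEAST p. b(w := p) \<in> A)"
      have "b(w := b w) \<in> A" using \<open>b \<in> A\<close> by simp
      then have 1: "p \<le> b w" "b(w := p) \<in> A" unfolding p_def by (rule Least_le, rule LeastI)
      have 2: "b(w := g w) \<in> A"
        using True cong[of "b(w := g w)" "raise b"] by (simp add: raise_def)
      then have "p \<le> g w" unfolding p_def by (rule Least_le)
      moreover have "b(w := q) \<notin> A" if "q < p" for q using that not_less_Least p_def by blast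
      ultimately show ?thesis using 1 2 by (auto simp: start_def)
    next
      case False
      then have "\<not> g w \<le> b w" using \<open>b \<in> A\<close> by (auto simp: raise_def max_def fun_upd_idem split: if_splits)
      then show ?thesis using False \<open>b \<in> A\<close> by (auto simp: slice_def)
    qed
  qed (use sub in \<open>auto simp: slice_def\<close>)
  ultimately show ?case using partitionable_Un by metis
qed


section \<open>Monomial ideals and their exponent vectors\<close>

definition up_closed :: "('n \<Rightarrow> nat) set \<Rightarrow> bool" where
  "up_closed U \<longleftrightarrow> (\<forall>a b. a \<in> U \<longrightarrow> a \<le> b \<longrightarrow> b \<in> U)"

definition supported :: "('n \<Rightarrow> nat) set \<Rightarrow> ('n, 'k::comm_ring_1) poly_ring set" where
  "supported U = {p. \<forall>k\<in>Poly_Mapping.keys p. Poly_Mapping.lookup k \<in> U}"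

definition expo :: "('n::finite \<Rightarrow> nat) \<Rightarrow> 'n exps" where
  "expo f = Poly_Mapping.Abs_poly_mapping f"

lemma lookup_expo [simp]: "Poly_Mapping.lookup (expo f) = f"
  by (simp add: expo_def)

lemma expo_lookup [simp]: "expo (Poly_Mapping.lookup a) = a"
  by (simp add: expo_def)

lemma up_closedD: "up_closed U \<Longrightarrow> a \<in> U \<Longrightarrow> a \<le> b \<Longrightarrow> b \<in> U"
  unfolding up_closed_def by blast

lemma lookup_le_add: "Poly_Mapping.lookup (a :: 'n exps) \<le> Poly_Mapping.lookup (a + b)"
  by (simp add: le_fun_def lookup_add)

lemma le_imp_add:
  fixes a b :: "'n::finite exps"
  assumes "Poly_Mapping.lookup a \<le> Poly_Mapping.lookup b"
  shows "\<exists>c. b = a + c"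
proof
  show "b = a + expo (\<lambda>i. Poly_Mapping.lookup b i - Poly_Mapping.lookup a i)"
    using assms by (intro poly_mapping_eqI) (simp add: lookup_add le_fun_def)
qed

lemma sum_terms: "(\<Sum>k\<in>Poly_Mapping.keys p. Poly_Mapping.single k (Poly_Mapping.lookup p k)) = p"
proof (rule poly_mapping_eqI)
  fix m
  have "(\<Sum>k\<in>Poly_Mapping.keys p. Poly_Mapping.lookup p k when k = m)
      = (\<Sum>k\<in>Poly_Mapping.keys p. if m = k then Poly_Mapping.lookup p k else 0)"
    by (intro sum.cong) (auto simp: when_def)
  then show "Poly_Mapping.lookup (\<Sum>k\<in>Poly_Mapping.keys p.
      Poly_Mapping.single k (Poly_Mapping.lookup p k)) m = Poly_Mapping.lookup p m"
    by (simp add: lookup_sum lookup_single in_keys_iff)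
qed

lemma single_eq_monom:
  "(Poly_Mapping.single k c :: ('n, 'k::comm_ring_1) poly_ring) = Poly_Mapping.single 0 c * monom k"
  by (simp add: monom_def mult_single)

lemma keys_monom [simp]: "Poly_Mapping.keys (monom a :: ('n, 'k::comm_ring_1) poly_ring) = {a}"
  by (simp add: monom_def)

lemma monom_zero [simp]: "monom 0 = (1 :: ('n, 'k::comm_ring_1) poly_ring)"
  by (simp add: monom_def)

lemma lookup_monom_mult:
  "Poly_Mapping.lookup (monom a * (q :: ('n, 'k::comm_ring_1) poly_ring)) (a + k)
    = Poly_Mapping.lookup q k"
proof -
  have "monom a * q = (\<Sum>m\<in>Poly_Mapping.keys q.
      Poly_Mapping.single (a + m) (Poly_Mapping.lookup q m))"
    by (subst sum_terms[of q, symmetric])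
      (simp add: sum_distrib_left monom_def mult_single)
  also have "Poly_Mapping.lookup \<dots> (a + k)
      = (\<Sum>m\<in>Poly_Mapping.keys q. if k = m then Poly_Mapping.lookup q m else 0)"
    unfolding lookup_sum by (intro sum.cong) (auto simp: lookup_single when_def)
  finally show ?thesis by (simp add: in_keys_iff)
qed

lemma keys_monom_mult:
  "Poly_Mapping.keys (monom a * (q :: ('n, 'k::comm_ring_1) poly_ring))
    = (+) a ` Poly_Mapping.keys q"
proof
  show "Poly_Mapping.keys (monom a * q) \<subseteq> (+) a ` Poly_Mapping.keys q"
    using keys_mult[of "monom a" q] by auto
  show "(+) a ` Poly_Mapping.keys q \<subseteq> Poly_Mapping.keys (monom a * q)"
    by (auto simp: in_keys_iff lookup_monom_mult)
qed

lemma supportedD: "p \<in> supported U \<Longrightarrow> k \<in> Poly_Mapping.keys p \<Longrightarrow> Poly_Mapping.lookup k \<in> U"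
  by (simp add: supported_def)

lemma supported_UNIV [simp]: "supported UNIV = UNIV"
  by (simp add: supported_def)

lemma supported_mono: "U \<subseteq> V \<Longrightarrow> supported U \<subseteq> supported V"
  by (auto simp: supported_def)

lemma monom_in_supported [simp]:
  "(monom a :: ('n, 'k::comm_ring_1) poly_ring) \<in> supported U \<longleftrightarrow> Poly_Mapping.lookup a \<in> U"
  by (simp add: supported_def)

lemma subspace_supported:
  assumes "up_closed U"
  shows "ideal.subspace (supported U :: ('n, 'k::comm_ring_1) poly_ring set)"
proof (rule ideal.subspaceI)
  show "0 \<in> (supported U :: ('n, 'k) poly_ring set)" by (simp add: supported_def)
next
  fix p q :: "('n, 'k) poly_ring" assume "p \<in> supported U" "q \<in> supported U"
  then show "p + q \<in> supported U" using keys_add[of p q] by (auto simp: supported_def)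
next
  fix c p :: "('n, 'k) poly_ring" assume p: "p \<in> supported U"
  show "c * p \<in> supported U"
    unfolding supported_def
  proof (clarify)
    fix k assume "k \<in> Poly_Mapping.keys (c * p)"
    then obtain s t where st: "k = s + t" "t \<in> Poly_Mapping.keys p"
      using keys_mult[of c p] by blast
    then have "Poly_Mapping.lookup t \<le> Poly_Mapping.lookup k"
      using lookup_le_add[of t s] by (simp add: add.commute)
    with p st assms show "Poly_Mapping.lookup k \<in> U"
      by (metis supportedD up_closedD)
  qed
qed

lemma supported_subset:
  fixes M :: "('n, 'k::comm_ring_1) poly_ring set"
  assumes "ideal.subspace M" "\<And>k. Poly_Mapping.lookup k \<in> U \<Longrightarrow> monom k \<in> M"
  shows "supported U \<subseteq> M"
proof
  fix p :: "('n, 'k) poly_ring" assume p: "p \<in> supported U"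
  have "Poly_Mapping.single k (Poly_Mapping.lookup p k) \<in> M" if "k \<in> Poly_Mapping.keys p" for k
    using assms(2)[OF supportedD[OF p that]] ideal.subspace_scale[OF assms(1)]
    by (subst single_eq_monom) blast
  then have "(\<Sum>k\<in>Poly_Mapping.keys p. Poly_Mapping.single k (Poly_Mapping.lookup p k)) \<in> M"
    by (intro ideal.subspace_sum[OF assms(1)])
  then show "p \<in> M" by (simp add: sum_terms)
qed

definition exponents :: "('n, 'k::comm_ring_1) poly_ring set \<Rightarrow> ('n \<Rightarrow> nat) set" where
  "exponents I = Poly_Mapping.lookup ` {a. monom a \<in> I}"

lemma exponents_iff:
  "a \<in> exponents (I :: ('n::finite, 'k::comm_ring_1) poly_ring set) \<longleftrightarrow> monom (expo a) \<in> I"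
  unfolding exponents_def by (force intro: image_eqI[of _ _ "expo a"])

lemma exponents_iff_min_gens:
  fixes I :: "('n::finite, 'k::comm_ring_1) poly_ring set"
  assumes "monomial_ideal I"
  shows "b \<in> exponents I \<longleftrightarrow> (\<exists>a\<in>min_gens I. Poly_Mapping.lookup a \<le> b)"
proof
  assume "b \<in> exponents I"
  then have "monom (expo b) \<in> I" by (simp add: exponents_iff)
  from ex_min_gen_dvd[OF this] obtain a where a: "a \<in> min_gens I"
    "(monom a :: ('n, 'k) poly_ring) dvd monom (expo b)" by blast
  then obtain c where "expo b = a + c" using monom_dvd_iff by blast
  then have "Poly_Mapping.lookup a \<le> b" using lookup_le_add[of a c] by (metis lookup_expo)
  with a show "\<exists>a\<in>min_gens I. Poly_Mapping.lookup a \<le> b" by blast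
next
  assume "\<exists>a\<in>min_gens I. Poly_Mapping.lookup a \<le> b"
  then obtain a c where a: "a \<in> min_gens I" "expo b = a + c"
    using le_imp_add[of _ "expo b"] by (metis lookup_expo)
  then have "monom (expo b) = monom c * (monom a :: ('n, 'k) poly_ring)"
    by (simp add: monom_add mult.commute)
  moreover have "monom a \<in> I" using a(1) by (rule min_gensD)
  moreover have "ideal.subspace I" using assms unfolding monomial_ideal_def by auto
  ultimately show "b \<in> exponents I" by (simp add: exponents_iff ideal.subspace_scale)
qed

lemma up_closed_exponents:
  fixes I :: "('n::finite, 'k::comm_ring_1) poly_ring set"
  assumes "monomial_ideal I"
  shows "up_closed (exponents I)"
  unfolding up_closed_def exponents_iff_min_gens[OF assms] by (meson order_trans)

text \<open>
  From here on a monomial ideal is handled through its up-closed set of exponent vectors.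
\<close>

lemma monomial_ideal_eq_supported:
  fixes I :: "('n::finite, 'k::comm_ring_1) poly_ring set"
  assumes "monomial_ideal I"
  shows "I = supported (exponents I)"
proof
  obtain A where A: "I = ideal.span (monom ` A)" using assms unfolding monomial_ideal_def by blast
  have "monom ` A \<subseteq> supported (exponents I)"
  proof clarify
    fix a assume "a \<in> A"
    then have "monom a \<in> I" unfolding A by (intro ideal.span_base imageI)
    then show "monom a \<in> supported (exponents I)" by (simp add: exponents_iff)
  qed
  then show "I \<subseteq> supported (exponents I)"
    by (subst A) (intro ideal.span_minimal subspace_supported up_closed_exponents assms)
  have "ideal.subspace I" unfolding A by simp
  then show "supported (exponents I) \<subseteq> I"
    by (rule supported_subset) (simp add: exponents_iff)
qed


section \<open>Partitions into cells give Stanley decompositions\<close>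

text \<open>
  The sum is direct because a monomial in the support of \<open>p\<^sub>l u\<^sub>l\<close> lies in the cell number \<open>l\<close>, and so
  cannot be cancelled by another summand. The summands span because each monomial of \<open>U - V\<close> lies in
  some cell.
\<close>

lemma stanley_decomp_of_cells:
  fixes U V :: "('n::finite \<Rightarrow> nat) set" and ds :: "(('n \<Rightarrow> nat) \<times> 'n set) list"
  defines "D \<equiv> map (\<lambda>(a, Z). (Z, monom (expo a) :: ('n, 'k::field) poly_ring)) ds"
  assumes "up_closed U" "up_closed V" "V \<subseteq> U" "distinct ds"
    and disj: "\<And>p q. p \<in> set ds \<Longrightarrow> q \<in> set ds \<Longrightarrow> p \<noteq> q \<Longrightarrow>
          case_prod cell p \<inter> case_prod cell q = {}"
    and un: "(\<Union>p\<in>set ds. case_prod cell p) = U - V"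
  shows "stanley_decomp (supported U) (supported V) D"
proof -
  have in_cell: "Poly_Mapping.lookup (expo a + k) \<in> cell a Z \<longleftrightarrow> Poly_Mapping.keys k \<subseteq> Z" for a Z k
    by (auto simp: cell_def lookup_add in_keys_iff)
  have UV: "Poly_Mapping.lookup (expo a + k) \<in> U - V"
    if "(a, Z) \<in> set ds" "Poly_Mapping.keys k \<subseteq> Z" for a Z k
    using that in_cell[of a k Z] un by blast
  have len: "length D = length ds" by (simp add: D_def)
  have subV: "ideal.subspace (supported V :: ('n, 'k) poly_ring set)"
    using assms(3) by (rule subspace_supported)
  have nth: "fst (D ! l) = snd (ds ! l)" "snd (D ! l) = monom (expo (fst (ds ! l)))"
    if "l < length ds" for l
    using that by (simp_all add: D_def split: prod.split)
  have key_cell: "Poly_Mapping.lookup k \<in> case_prod cell (ds ! l)"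
    if l: "l < length ds" and p: "p \<in> poly_sub (fst (D ! l))"
      and k: "k \<in> Poly_Mapping.keys (p * snd (D ! l))" for l p k
  proof -
    obtain m where "k = expo (fst (ds ! l)) + m" "m \<in> Poly_Mapping.keys p"
      using k by (auto simp: nth[OF l] mult.commute[of p] keys_monom_mult)
    then show ?thesis
      using p by (simp add: nth[OF l] poly_sub_def split_beta in_cell)
  qed
  show ?thesis
    unfolding stanley_decomp_def
  proof (intro conjI)
    show "\<forall>(Z, u)\<in>set D. u \<in> supported U \<and> multihom u"
      using UV[of _ _ 0] by (auto simp: D_def multihom_def monom_def[of "expo _"] supported_def)
  next
    show "\<forall>(Z, u)\<in>set D. \<forall>p\<in>poly_sub Z. p * u \<in> supported V \<longrightarrow> p = 0"
    proof (clarsimp simp: D_def)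
      fix a Z and p :: "('n, 'k) poly_ring"
      assume a: "(a, Z) \<in> set ds" and p: "p \<in> poly_sub Z" "p * monom (expo a) \<in> supported V"
      have "k \<notin> Poly_Mapping.keys p" for k
      proof
        assume k: "k \<in> Poly_Mapping.keys p"
        then have "expo a + k \<in> Poly_Mapping.keys (p * monom (expo a))"
          by (simp add: mult.commute[of p] keys_monom_mult)
        then have "Poly_Mapping.lookup (expo a + k) \<in> V" using p(2) supportedD by blast
        moreover have "Poly_Mapping.keys k \<subseteq> Z" using p(1) k by (auto simp: poly_sub_def)
        ultimately show False using UV[OF a] by blast
      qed
      then show "p = 0" by (metis equals0I keys_eq_empty)
    qed
  next
    show "\<forall>v\<in>supported U. \<exists>p. (\<forall>l<length D. p l \<in> poly_sub (fst (D ! l))) \<and>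
        v - (\<Sum>l<length D. p l * snd (D ! l)) \<in> supported V"
    proof
      fix v :: "('n, 'k) poly_ring" assume v: "v \<in> supported U"
      let ?t = "\<lambda>k. Poly_Mapping.single k (Poly_Mapping.lookup v k)"
      have "\<forall>k\<in>Poly_Mapping.keys v. \<exists>p. (\<forall>l<length D. p l \<in> poly_sub (fst (D ! l))) \<and>
        ?t k - (\<Sum>l<length D. p l * snd (D ! l)) \<in> supported V"
      proof
        fix k assume "k \<in> Poly_Mapping.keys v"
        then have kU: "Poly_Mapping.lookup k \<in> U" using v supportedD by blast
        show "\<exists>p. (\<forall>l<length D. p l \<in> poly_sub (fst (D ! l))) \<and>
          ?t k - (\<Sum>l<length D. p l * snd (D ! l)) \<in> supported V"
        proof (cases "Poly_Mapping.lookup k \<in> V")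
          case True
          then show ?thesis by (intro exI[of _ "\<lambda>_. 0"]) (simp add: poly_sub_def supported_def)
        next
          case False
          with kU un obtain q where "q \<in> set ds" and kq: "Poly_Mapping.lookup k \<in> case_prod cell q"
            by blast
          then obtain j where j: "j < length ds" "ds ! j = q" by (auto simp: in_set_conv_nth)
          obtain a Z where q: "q = (a, Z)" by fastforce
          have "Poly_Mapping.lookup (expo a) \<le> Poly_Mapping.lookup k"
            using kq by (auto simp: q cell_def le_fun_def split: if_splits)
          then obtain m where m: "k = expo a + m" using le_imp_add by blast
          let ?p = "\<lambda>l. if l = j then Poly_Mapping.single m (Poly_Mapping.lookup v k) else 0"
          have "(\<Sum>l<length D. ?p l * snd (D ! l)) = (\<Sum>l<length D. if l = j then ?t k else 0)"
          proof (intro sum.cong refl)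
            fix l
            have "?p j * snd (D ! j) = Poly_Mapping.single (m + expo a) (Poly_Mapping.lookup v k)"
              unfolding nth(2)[OF j(1)] j(2) q by (simp add: monom_def mult_single)
            also have "m + expo a = k" using m by (simp only: add.commute)
            finally have "?p j * snd (D ! j) = ?t k" .
            then show "?p l * snd (D ! l) = (if l = j then ?t k else 0)" by simp
          qed
          also have "\<dots> = ?t k" using j len by simp
          finally have "?t k - (\<Sum>l<length D. ?p l * snd (D ! l)) \<in> supported V"
            using ideal.subspace_0[OF subV] by simp
          moreover have "?p l \<in> poly_sub (fst (D ! l))" if "l < length D" for l
            using kq that m in_cell[of a m Z] by (auto simp: poly_sub_def nth j q len split: if_splits)
          ultimately show ?thesis by (intro exI[of _ ?p] conjI allI impI)
        qed
      qed
      from bchoice[OF this] obtain P where P: "\<And>k l. k \<in> Poly_Mapping.keys v \<Longrightarrow> l < length D \<Longrightarrow>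
          P k l \<in> poly_sub (fst (D ! l))"
        "\<And>k. k \<in> Poly_Mapping.keys v \<Longrightarrow>
          ?t k - (\<Sum>l<length D. P k l * snd (D ! l)) \<in> supported V"
        by blast
      let ?p = "\<lambda>l. \<Sum>k\<in>Poly_Mapping.keys v. P k l"
      have "(\<Sum>l<length D. ?p l * snd (D ! l))
          = (\<Sum>k\<in>Poly_Mapping.keys v. \<Sum>l<length D. P k l * snd (D ! l))"
        by (subst sum.swap) (simp add: sum_distrib_right)
      then have "v - (\<Sum>l<length D. ?p l * snd (D ! l))
          = (\<Sum>k\<in>Poly_Mapping.keys v. ?t k - (\<Sum>l<length D. P k l * snd (D ! l)))"
        by (simp add: sum_subtractf sum_terms)
      then have "v - (\<Sum>l<length D. ?p l * snd (D ! l)) \<in> supported V"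
        using ideal.subspace_sum[OF subV P(2)] by simp
      moreover have "?p l \<in> poly_sub (fst (D ! l))" if "l < length D" for l
        using P(1)[OF _ that] keys_sum[of "\<lambda>k. P k l" "Poly_Mapping.keys v"]
        unfolding poly_sub_def by blast
      ultimately show "\<exists>p. (\<forall>l<length D. p l \<in> poly_sub (fst (D ! l))) \<and>
          v - (\<Sum>l<length D. p l * snd (D ! l)) \<in> supported V"
        by (intro exI[of _ ?p] conjI allI impI)
    qed
  next
    show "\<forall>p. (\<forall>l<length D. p l \<in> poly_sub (fst (D ! l))) \<longrightarrow>
        (\<Sum>l<length D. p l * snd (D ! l)) \<in> supported V \<longrightarrow>
        (\<forall>l<length D. p l * snd (D ! l) \<in> supported V)"
    proof (intro allI impI)
      fix p l
      assume p: "\<forall>l<length D. p l \<in> poly_sub (fst (D ! l))"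
        and sum: "(\<Sum>l<length D. p l * snd (D ! l)) \<in> supported V" and l: "l < length D"
      have "Poly_Mapping.lookup k \<in> V" if k: "k \<in> Poly_Mapping.keys (p l * snd (D ! l))" for k
      proof -
        have "Poly_Mapping.lookup (p j * snd (D ! j)) k = 0" if j: "j < length D" "j \<noteq> l" for j
        proof (rule ccontr)
          assume "Poly_Mapping.lookup (p j * snd (D ! j)) k \<noteq> 0"
          then have "k \<in> Poly_Mapping.keys (p j * snd (D ! j))" by (simp add: in_keys_iff)
          then have "Poly_Mapping.lookup k \<in> case_prod cell (ds ! j) \<inter> case_prod cell (ds ! l)"
            using key_cell[of j "p j" k] key_cell[of l "p l" k] p k l j len by simp
          moreover have "case_prod cell (ds ! j) \<inter> case_prod cell (ds ! l) = {}"
          proof (rule disj)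
            show "ds ! j \<in> set ds" "ds ! l \<in> set ds" using j l len by simp_all
            show "ds ! j \<noteq> ds ! l" using j l len \<open>distinct ds\<close> by (simp add: nth_eq_iff_index_eq)
          qed
          ultimately show False by simp
        qed
        then have "Poly_Mapping.lookup (\<Sum>j<length D. p j * snd (D ! j)) k
            = (\<Sum>j<length D. if j = l then Poly_Mapping.lookup (p l * snd (D ! l)) k else 0)"
          unfolding lookup_sum by (intro sum.cong) auto
        also have "\<dots> = Poly_Mapping.lookup (p l * snd (D ! l)) k" using l by simp
        finally have "k \<in> Poly_Mapping.keys (\<Sum>j<length D. p j * snd (D ! j))"
          using k by (simp add: in_keys_iff)
        then show ?thesis using sum supportedD by blast
      qed
      then show "p l * snd (D ! l) \<in> supported V" by (simp add: supported_def)
    qed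
  qed
qed

text \<open>
  The maximum that defines the Stanley depth is taken over a bounded set, as the minimum for a
  nonempty decomposition is at most the number of variables; and \<open>V \<subset> U\<close> excludes the empty one.
\<close>

lemma sdepth_ge:
  fixes U V :: "('n::finite \<Rightarrow> nat) set"
  assumes "up_closed U" "up_closed V" "V \<subset> U" "partitionable r (U - V)"
  shows "r \<le> sdepth (supported U :: ('n, 'k::field) poly_ring set) (supported V)"
proof -
  let ?I = "supported U :: ('n, 'k) poly_ring set" and ?J = "supported V :: ('n, 'k) poly_ring set"
  obtain C where C: "finite C" "\<forall>(a, Z)\<in>C. r \<le> card Z"
    "\<forall>p\<in>C. \<forall>q\<in>C. p \<noteq> q \<longrightarrow> case_prod cell p \<inter> case_prod cell q = {}"
    "(\<Union>p\<in>C. case_prod cell p) = U - V"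
    using assms(4) unfolding partitionable_def by blast
  obtain ds where ds: "set ds = C" "distinct ds" using C(1) finite_distinct_list by blast
  let ?D = "map (\<lambda>(a, Z). (Z, monom (expo a) :: ('n, 'k) poly_ring)) ds"
  have D: "stanley_decomp ?I ?J ?D"
    by (rule stanley_decomp_of_cells) (use assms C ds in auto)
  obtain a where a: "a \<in> U" "a \<notin> V" using assms(3) by blast
  have nonempty: "E \<noteq> []" if "stanley_decomp ?I ?J E" for E
  proof
    assume "E = []"
    with that have "\<forall>v\<in>?I. v \<in> ?J" by (simp add: stanley_decomp_def)
    moreover have "monom (expo a) \<in> ?I" using a by simp
    ultimately have "monom (expo a) \<in> ?J" by blast
    with a show False by simp
  qed
  have "sdepth_decomp E \<le> card (UNIV :: 'n set)" if E: "stanley_decomp ?I ?J E" for E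
  proof -
    obtain Z u where "(Z, u) \<in> set E" using nonempty[OF E] by (cases E) auto
    then have "sdepth_decomp E \<le> card Z"
      unfolding sdepth_decomp_def by (intro Min_le) (auto intro: rev_image_eqI)
    also have "\<dots> \<le> card (UNIV :: 'n set)" by (rule card_mono) auto
    finally show ?thesis .
  qed
  then have "{sdepth_decomp E | E. stanley_decomp ?I ?J E} \<subseteq> {..card (UNIV :: 'n set)}" by auto
  then have "finite {sdepth_decomp E | E. stanley_decomp ?I ?J E}" by (rule finite_subset) simp
  then have "sdepth_decomp ?D \<le> sdepth ?I ?J"
    unfolding sdepth_def using D by (intro Max_ge) blast+
  moreover have "r \<le> sdepth_decomp ?D"
    unfolding sdepth_decomp_def using C(2) ds(1) nonempty[OF D] by (subst Min_ge_iff) auto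
  ultimately show ?thesis by linarith
qed


section \<open>Koszul homology bounds the length of regular sequences\<close>

text \<open>
  A chain of the Koszul complex is a function \<open>w\<close> on sets of variables, where \<open>w T\<close> is the coefficient
  of the exterior product of the \<open>e\<^sub>i\<close> with \<open>i \<in> T\<close> in increasing order.
\<close>

definition koszul_sign :: "'n::linorder \<Rightarrow> 'n set \<Rightarrow> 'a::comm_ring_1" where
  "koszul_sign i T = (- 1) ^ card {k \<in> T. k < i}"

definition koszul_diff :: "('n::{finite,linorder} \<Rightarrow> 'a::comm_ring_1) \<Rightarrow> ('n set \<Rightarrow> 'a) \<Rightarrow> 'n set \<Rightarrow> 'a" where
  "koszul_diff x w T = (\<Sum>i\<in>-T. koszul_sign i T * x i * w (insert i T))"

definition koszul_wedge :: "('n::{finite,linorder} \<Rightarrow> 'a::comm_ring_1) \<Rightarrow> ('n set \<Rightarrow> 'a) \<Rightarrow> 'n set \<Rightarrow> 'a" where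
  "koszul_wedge c w T = (\<Sum>i\<in>T. koszul_sign i T * c i * w (T - {i}))"

lemma koszul_sign_same [simp]:
  "koszul_sign i (insert i T) = koszul_sign i T" "koszul_sign i (T - {i}) = koszul_sign i T"
  unfolding koszul_sign_def by (rule arg_cong[where f = "\<lambda>S. (- 1) ^ card S"]; auto)+

lemma koszul_sign_square [simp]: "koszul_sign i T * koszul_sign i T = (1 :: 'a::comm_ring_1)"
  by (simp add: koszul_sign_def flip: power_add)

lemma koszul_sign_insert_less:
  fixes i j :: "'n::{finite,linorder}"
  assumes "j < i" "j \<notin> T"
  shows "koszul_sign i (insert j T) = - (koszul_sign i T :: 'a::comm_ring_1)"
proof -
  have "{k \<in> insert j T. k < i} = insert j {k \<in> T. k < i}" using assms by auto
  then show ?thesis using assms by (simp add: koszul_sign_def)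
qed

lemma koszul_sign_insert_greater:
  fixes i j :: "'n::{finite,linorder}"
  assumes "i < j"
  shows "koszul_sign i (insert j T) = (koszul_sign i T :: 'a::comm_ring_1)"
proof -
  have "{k \<in> insert j T. k < i} = {k \<in> T. k < i}" using assms by auto
  then show ?thesis by (simp add: koszul_sign_def)
qed

lemma koszul_sign_anticommute:
  fixes i j :: "'n::{finite,linorder}"
  assumes "i \<noteq> j" "i \<notin> T" "j \<notin> T"
  shows "koszul_sign i T * koszul_sign j (insert i T)
    = - (koszul_sign j T * koszul_sign i (insert j T) :: 'a::comm_ring_1)"
proof (cases "i < j")
  case True
  then show ?thesis
    using assms by (simp add: koszul_sign_insert_less koszul_sign_insert_greater)
next
  case False
  then have "j < i" using assms by simp
  then show ?thesis
    using assms by (simp add: koszul_sign_insert_less koszul_sign_insert_greater)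
qed

text \<open>
  The terms for the two orders in which \<open>i\<close> and \<open>j\<close> can be removed cancel. The sum is split by
  \<open>i < j\<close> because twice a sum being zero says nothing in characteristic two.
\<close>

lemma koszul_diff_diff:
  fixes x :: "'n::{finite,linorder} \<Rightarrow> 'a::comm_ring_1"
  shows "koszul_diff x (koszul_diff x w) T = 0"
proof -
  define f where "f i j = koszul_sign i T * koszul_sign j (insert i T) * (x i * x j) *
      w (insert i (insert j T))" for i j
  have anti: "f i j = - f j i" if "i \<noteq> j" "i \<notin> T" "j \<notin> T" for i j
  proof -
    have "f i j = - (koszul_sign j T * koszul_sign i (insert j T)) * (x i * x j) *
      w (insert i (insert j T))"
      unfolding f_def by (subst koszul_sign_anticommute) (use that in auto)
    moreover have "insert i (insert j T) = insert j (insert i T)" by auto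
    ultimately show ?thesis unfolding f_def by (simp only: minus_mult_left mult.commute[of "x j"])
  qed
  let ?L = "{p \<in> (-T) \<times> (-T). fst p < snd p}" and ?G = "{p \<in> (-T) \<times> (-T). snd p < fst p}"
  have "koszul_diff x (koszul_diff x w) T = (\<Sum>i\<in>-T. \<Sum>j\<in>-insert i T. f i j)"
    unfolding koszul_diff_def sum_distrib_left
  proof (intro sum.cong refl)
    fix i j
    have "insert i (insert j T) = insert j (insert i T)" by auto
    then show "koszul_sign i T * x i * (koszul_sign j (insert i T) * x j * w (insert j (insert i T)))
        = f i j"
      unfolding f_def by (simp only: mult_ac)
  qed
  also have "\<dots> = (\<Sum>(i, j)\<in>(SIGMA i:-T. -insert i T). f i j)"
    by (rule sum.Sigma) auto
  also have "(SIGMA i:-T. -insert i T) = ?L \<union> ?G" by auto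
  also have "(\<Sum>(i, j)\<in>?L \<union> ?G. f i j) = (\<Sum>(i, j)\<in>?L. f i j) + (\<Sum>(i, j)\<in>?G. f i j)"
    by (rule sum.union_disjoint) auto
  also have "(\<Sum>(i, j)\<in>?G. f i j) = (\<Sum>(i, j)\<in>?L. f j i)"
    by (rule sum.reindex_bij_witness[of _ "\<lambda>(i, j). (j, i)" "\<lambda>(i, j). (j, i)"]) auto
  also have "\<dots> = (\<Sum>(i, j)\<in>?L. - f i j)"
  proof (intro sum.cong refl, clarsimp)
    fix i j assume "i \<notin> T" "j \<notin> T" "i < j"
    then show "f j i = - f i j" by (intro anti) auto
  qed
  finally show ?thesis by (simp add: sum_negf split_beta)
qed

text \<open>
  Hence the elements of the ideal generated by the \<open>x i\<close> act as zero on Koszul homology.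
\<close>

lemma koszul_homotopy:
  fixes x :: "'n::{finite,linorder} \<Rightarrow> 'a::comm_ring_1"
  shows "koszul_diff x (koszul_wedge c w) T + koszul_wedge c (koszul_diff x w) T
    = (\<Sum>i\<in>UNIV. c i * x i) * w T"
proof -
  \<comment> \<open>The terms of the two composites. Those with \<open>i = j\<close> give the right-hand side, the others cancel.\<close>
  define f where "f i j = koszul_sign i T * x i *
      (koszul_sign j (insert i T) * c j * w (insert i T - {j}))" for i j
  define g where "g j i = koszul_sign j T * c j *
      (koszul_sign i (T - {j}) * x i * w (insert i (T - {j})))" for i j
  have solve: "a * c = - (d * b)" if "b * c = - (d * a)" "a * a = 1" "b * b = 1" for a b c d :: 'a
  proof -
    have "a * c = (b * b) * (a * c)" using that by simp
    also have "\<dots> = (a * b) * (b * c)" by (simp only: ac_simps)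
    also have "\<dots> = - ((a * a) * (d * b))" unfolding that(1) by (simp only: mult_minus_right ac_simps)
    finally show ?thesis using that by simp
  qed
  have "f i j = - g j i" if "i \<notin> T" "j \<in> T" for i j
  proof -
    have "i \<noteq> j" using that by auto
    then have set: "insert i T - {j} = insert i (T - {j})" by auto
    have "koszul_sign i (T - {j}) * koszul_sign j (insert i (T - {j}))
        = - (koszul_sign j (T - {j}) * koszul_sign i (insert j (T - {j})) :: 'a)"
      using that \<open>i \<noteq> j\<close> by (intro koszul_sign_anticommute) auto
    then have "koszul_sign i (T - {j}) * koszul_sign j (insert i T - {j})
        = - (koszul_sign j T * koszul_sign i T :: 'a)"
      using that \<open>i \<noteq> j\<close> by (simp add: insert_Diff_if insert_absorb)
    then have *: "koszul_sign i (T - {j}) * koszul_sign j (insert i T)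
        = - (koszul_sign j T * koszul_sign i T :: 'a)" by simp
    have "koszul_sign i T * koszul_sign j (insert i T)
        = - (koszul_sign j T * koszul_sign i (T - {j}) :: 'a)"
      by (rule solve) (rule *, simp_all)
    moreover have "f i j = (koszul_sign i T * koszul_sign j (insert i T)) *
        (x i * c j * w (insert i (T - {j})))"
      unfolding f_def set by (simp only: ac_simps)
    moreover have "g j i = (koszul_sign j T * koszul_sign i (T - {j})) *
        (x i * c j * w (insert i (T - {j})))"
      unfolding g_def by (simp only: ac_simps)
    ultimately show ?thesis by simp
  qed
  then have cancel: "(\<Sum>i\<in>-T. \<Sum>j\<in>T. f i j) + (\<Sum>j\<in>T. \<Sum>i\<in>-T. g j i) = 0"
    by (subst (2) sum.swap) (simp flip: sum.distrib)
  have diag1: "f i i = c i * x i * w T" if "i \<notin> T" for i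
  proof -
    have set: "insert i T - {i} = T" using that by auto
    have "f i i = (koszul_sign i T * koszul_sign i T) * (c i * x i * w T)"
      unfolding f_def set koszul_sign_same by (simp only: mult_ac)
    then show ?thesis by simp
  qed
  have diag2: "g i i = c i * x i * w T" if "i \<in> T" for i
  proof -
    have set: "insert i (T - {i}) = T" using that by auto
    have "g i i = (koszul_sign i T * koszul_sign i T) * (c i * x i * w T)"
      unfolding g_def set koszul_sign_same by (simp only: mult_ac)
    then show ?thesis by simp
  qed
  have "koszul_diff x (koszul_wedge c w) T = (\<Sum>i\<in>-T. \<Sum>j\<in>insert i T. f i j)"
    unfolding koszul_diff_def koszul_wedge_def sum_distrib_left f_def ..
  also have "\<dots> = (\<Sum>i\<in>-T. c i * x i * w T + (\<Sum>j\<in>T. f i j))"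
    by (intro sum.cong refl) (simp add: diag1)
  finally have 1: "koszul_diff x (koszul_wedge c w) T
      = (\<Sum>i\<in>-T. c i * x i * w T) + (\<Sum>i\<in>-T. \<Sum>j\<in>T. f i j)"
    by (simp add: sum.distrib)
  have "koszul_wedge c (koszul_diff x w) T = (\<Sum>j\<in>T. \<Sum>i\<in>-(T - {j}). g j i)"
    unfolding koszul_diff_def koszul_wedge_def sum_distrib_left g_def ..
  also have "\<dots> = (\<Sum>j\<in>T. c j * x j * w T + (\<Sum>i\<in>-T. g j i))"
  proof (intro sum.cong refl)
    fix j assume "j \<in> T"
    moreover from this have "-(T - {j}) = insert j (-T)" by auto
    ultimately show "(\<Sum>i\<in>-(T - {j}). g j i) = c j * x j * w T + (\<Sum>i\<in>-T. g j i)"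
      by (simp add: diag2)
  qed
  finally have 2: "koszul_wedge c (koszul_diff x w) T
      = (\<Sum>j\<in>T. c j * x j * w T) + (\<Sum>j\<in>T. \<Sum>i\<in>-T. g j i)"
    by (simp add: sum.distrib)
  have "(\<Sum>i\<in>-T. c i * x i * w T) + (\<Sum>j\<in>T. c j * x j * w T) = (\<Sum>i\<in>UNIV. c i * x i * w T)"
    by (subst sum.union_disjoint[symmetric]) auto
  then show ?thesis unfolding sum_distrib_right using 1 2 cancel by (simp add: algebra_simps)
qed

text \<open>
  The homology is that of the complex with coefficients in \<open>N/P\<close>. The chain \<open>v\<close> ranges over chains of
  mixed degree; this does not change which homogeneous cycles are boundaries.
\<close>

definition koszul_homology_nonzero ::
  "('n::{finite,linorder} \<Rightarrow> 'a::comm_ring_1) \<Rightarrow> nat \<Rightarrow> 'a set \<Rightarrow> 'a set \<Rightarrow> bool" where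
  "koszul_homology_nonzero x j N P \<longleftrightarrow> (\<exists>w. (\<forall>T. w T \<in> N) \<and> (\<forall>T. card T \<noteq> j \<longrightarrow> w T = 0) \<and>
     (\<forall>T. koszul_diff x w T \<in> P) \<and>
     \<not> (\<exists>v. (\<forall>T. v T \<in> N) \<and> (\<forall>T. w T - koszul_diff x v T \<in> P)))"

text \<open>
  If the pair \<open>(N, P)\<close> stands for the module \<open>M = N/P\<close>, then \<open>(N, ext_ideal P f N)\<close> stands for \<open>M/fM\<close>.
\<close>

definition ext_ideal :: "'a::comm_ring_1 set \<Rightarrow> 'a \<Rightarrow> 'a set \<Rightarrow> 'a set" where
  "ext_ideal P f N = {p + f * u | p u. p \<in> P \<and> u \<in> N}"

lemma ext_idealI: "p \<in> P \<Longrightarrow> u \<in> N \<Longrightarrow> p + f * u \<in> ext_ideal P f N"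
  unfolding ext_ideal_def by blast

lemma ext_idealE:
  assumes "v \<in> ext_ideal P f N"
  obtains p u where "v = p + f * u" "p \<in> P" "u \<in> N"
  using assms unfolding ext_ideal_def by blast

lemma subspace_ext_ideal:
  fixes P N :: "'a::comm_ring_1 set"
  assumes "ideal.subspace P" "ideal.subspace N"
  shows "ideal.subspace (ext_ideal P f N)"
proof (rule ideal.subspaceI)
  show "0 \<in> ext_ideal P f N"
    using ext_idealI[of 0 P 0 N f] ideal.subspace_0[OF assms(1)] ideal.subspace_0[OF assms(2)] by simp
next
  fix v w assume "v \<in> ext_ideal P f N" "w \<in> ext_ideal P f N"
  then obtain p u q z where *: "v = p + f * u" "w = q + f * z" "p \<in> P" "u \<in> N" "q \<in> P" "z \<in> N"
    by (elim ext_idealE)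
  then have "(p + q) + f * (u + z) \<in> ext_ideal P f N"
    using assms by (intro ext_idealI ideal.subspace_add)
  then show "v + w \<in> ext_ideal P f N" by (simp add: * algebra_simps)
next
  fix c v assume "v \<in> ext_ideal P f N"
  then obtain p u where *: "v = p + f * u" "p \<in> P" "u \<in> N"
    by (elim ext_idealE)
  then have "c * p + f * (c * u) \<in> ext_ideal P f N"
    using assms by (intro ext_idealI ideal.subspace_scale)
  then show "c * v \<in> ext_ideal P f N" by (simp add: * algebra_simps)
qed

lemma ext_ideal_subset:
  fixes N :: "'a::comm_ring_1 set"
  assumes "ideal.subspace N" "P \<subseteq> N"
  shows "ext_ideal P f N \<subseteq> N"
  using assms by (auto elim!: ext_idealE intro!: ideal.subspace_add ideal.subspace_scale)

lemma subset_ext_ideal: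
  fixes N :: "'a::comm_ring_1 set"
  assumes "ideal.subspace N"
  shows "P \<subseteq> ext_ideal P f N"
  using ext_idealI[of _ P 0 N f] ideal.subspace_0[OF assms] by auto

lemma mult_in_ext_ideal:
  fixes P :: "'a::comm_ring_1 set"
  assumes "ideal.subspace P" "u \<in> N"
  shows "f * u \<in> ext_ideal P f N"
  using ext_idealI[of 0 P u N f] ideal.subspace_0[OF assms(1)] assms(2) by auto

lemma regular_seq_Cons:
  "regular_seq N P (f # fs) \<longleftrightarrow>
    (\<forall>u\<in>N. f * u \<in> P \<longrightarrow> u \<in> P) \<and> regular_seq N (ext_ideal P f N) fs"
  by (simp add: ext_ideal_def)

lemma koszul_diff_in:
  assumes "ideal.subspace N" "\<And>T. w T \<in> N"
  shows "koszul_diff x w T \<in> N"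
  unfolding koszul_diff_def using assms
  by (intro ideal.subspace_sum ideal.subspace_scale) auto

lemma koszul_wedge_in:
  assumes "ideal.subspace N" "\<And>T. w T \<in> N"
  shows "koszul_wedge x w T \<in> N"
  unfolding koszul_wedge_def using assms
  by (intro ideal.subspace_sum ideal.subspace_scale) auto

lemma koszul_diff_add: "koszul_diff x (\<lambda>T. v T + w T) T = koszul_diff x v T + koszul_diff x w T"
  unfolding koszul_diff_def by (simp add: sum.distrib distrib_left)

lemma koszul_diff_mult: "koszul_diff x (\<lambda>T. f * w T) T = f * koszul_diff x w T"
  unfolding koszul_diff_def sum_distrib_left by (simp only: mult_ac)

text \<open>
  This is the connecting homomorphism of the sequence \<open>0 \<rightarrow> M \<rightarrow> M \<rightarrow> M/fM \<rightarrow> 0\<close>. As \<open>f\<close> kills the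
  homology, a cycle \<open>w\<close> has \<open>f w = \<partial>v\<close> with \<open>v = \<Sum> c\<^sub>i e\<^sub>i \<and> w\<close>, up to terms in \<open>P\<close>, so that \<open>v\<close> is a
  cycle for \<open>M/fM\<close>. If \<open>v\<close> were a boundary there, then \<open>w\<close> would be one since \<open>f\<close> can be cancelled.
\<close>

lemma koszul_homology_nonzero_step:
  fixes x :: "'n::{finite,linorder} \<Rightarrow> 'a::comm_ring_1"
  assumes N: "ideal.subspace N" and P: "ideal.subspace P"
    and f: "f = (\<Sum>i\<in>UNIV. c i * x i)" and nzd: "\<And>u. u \<in> N \<Longrightarrow> f * u \<in> P \<Longrightarrow> u \<in> P"
    and "koszul_homology_nonzero x j N P"
  shows "koszul_homology_nonzero x (Suc j) N (ext_ideal P f N)"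
proof -
  obtain w where w: "\<And>T. w T \<in> N" "\<And>T. card T \<noteq> j \<Longrightarrow> w T = 0" "\<And>T. koszul_diff x w T \<in> P"
    and not_bd: "\<And>v. (\<And>T. v T \<in> N) \<Longrightarrow> \<exists>T. w T - koszul_diff x v T \<notin> P"
    using assms(5) unfolding koszul_homology_nonzero_def by blast
  define v where "v = koszul_wedge c w"
  have dv: "koszul_diff x v T = - koszul_wedge c (koszul_diff x w) T + f * w T" for T
    using koszul_homotopy[of x c w T] unfolding v_def f by (simp add: algebra_simps)
  have wd: "koszul_wedge c (koszul_diff x w) T \<in> P" for T
    by (intro koszul_wedge_in P w)
  show ?thesis
    unfolding koszul_homology_nonzero_def
  proof (intro exI[of _ v] conjI allI impI)
    fix T show "v T \<in> N" unfolding v_def by (intro koszul_wedge_in N w)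
  next
    fix T :: "'n set" assume T: "card T \<noteq> Suc j"
    have "w (T - {i}) = 0" if "i \<in> T" for i
    proof -
      have "card T = Suc (card (T - {i}))" by (subst card_Suc_Diff1) (use that in auto)
      then show ?thesis using T w(2)[of "T - {i}"] by simp
    qed
    then show "v T = 0" by (simp add: v_def koszul_wedge_def)
  next
    fix T show "koszul_diff x v T \<in> ext_ideal P f N"
      unfolding dv by (intro ext_idealI ideal.subspace_neg P wd w)
  next
    show "\<not> (\<exists>u. (\<forall>T. u T \<in> N) \<and> (\<forall>T. v T - koszul_diff x u T \<in> ext_ideal P f N))"
    proof
      assume "\<exists>u. (\<forall>T. u T \<in> N) \<and> (\<forall>T. v T - koszul_diff x u T \<in> ext_ideal P f N)"
      then obtain u where u: "\<And>T. u T \<in> N" "\<And>T. v T - koszul_diff x u T \<in> ext_ideal P f N" by blast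
      have "\<forall>T. \<exists>p z. v T - koszul_diff x u T = p + f * z \<and> p \<in> P \<and> z \<in> N"
        using u(2) by (blast elim: ext_idealE)
      then obtain p z where pz: "\<And>T. v T - koszul_diff x u T = p T + f * z T"
        "\<And>T. p T \<in> P" "\<And>T. z T \<in> N" by metis
      have "v = (\<lambda>T. koszul_diff x u T + (p T + f * z T))"
        using pz(1) by (auto simp: algebra_simps)
      then have "koszul_diff x v T = koszul_diff x p T + f * koszul_diff x z T" for T
        by (simp add: koszul_diff_add koszul_diff_mult koszul_diff_diff)
      then have eq: "f * (w T - koszul_diff x z T)
          = koszul_diff x p T + koszul_wedge c (koszul_diff x w) T" for T
        using dv[of T] by (simp add: algebra_simps)
      have "w T - koszul_diff x z T \<in> P" for T
      proof (rule nzd)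
        show "w T - koszul_diff x z T \<in> N"
          by (intro ideal.subspace_diff N w koszul_diff_in pz)
        show "f * (w T - koszul_diff x z T) \<in> P"
          unfolding eq by (intro ideal.subspace_add P wd koszul_diff_in pz)
      qed
      then show False using not_bd[of z] pz(3) by blast
    qed
  qed
qed

text \<open>
  For each member of the regular sequence, homology that is nonzero in some degree moves up by one
  degree, and the Koszul complex ends in the degree that equals the number of variables.
\<close>

lemma koszul_homology_bound:
  fixes x :: "'n::{finite,linorder} \<Rightarrow> 'a::comm_ring_1"
  assumes "ideal.subspace N" "ideal.subspace P"
    and "\<And>f. f \<in> set fs \<Longrightarrow> \<exists>c. f = (\<Sum>i\<in>UNIV. c i * x i)"
    and "regular_seq N P fs" "koszul_homology_nonzero x j N P"
  shows "j + length fs \<le> card (UNIV :: 'n set)"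
  using assms(2-)
proof (induction fs arbitrary: j P)
  case Nil
  show ?case
  proof (rule ccontr)
    assume "\<not> j + length [] \<le> card (UNIV :: 'n set)"
    then have j: "card T \<noteq> j" for T :: "'n set" using card_mono[of UNIV T] by fastforce
    obtain w where w: "\<forall>T. card T \<noteq> j \<longrightarrow> w T = 0"
      and not_bd: "\<not> (\<exists>v. (\<forall>T. v T \<in> N) \<and> (\<forall>T. w T - koszul_diff x v T \<in> P))"
      using Nil(4) unfolding koszul_homology_nonzero_def by (elim exE conjE)
    have "\<forall>T. w T - koszul_diff x (\<lambda>_. 0) T \<in> P"
      using w j ideal.subspace_0[OF Nil(1)] by (simp add: koszul_diff_def)
    moreover have "\<forall>T :: 'n set. (\<lambda>_. 0) T \<in> N" using ideal.subspace_0[OF assms(1)] by simp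
    ultimately show False using not_bd by (auto intro: exI[of _ "\<lambda>_. 0"])
  qed
next
  case (Cons f fs)
  obtain c where "f = (\<Sum>i\<in>UNIV. c i * x i)" using Cons.prems(2)[of f] by auto
  then have "koszul_homology_nonzero x (Suc j) N (ext_ideal P f N)"
    using Cons.prems assms(1) by (intro koszul_homology_nonzero_step) (auto simp: regular_seq_Cons)
  then have "Suc j + length fs \<le> card (UNIV :: 'n set)"
    using Cons.prems assms(1)
    by (intro Cons.IH[of "ext_ideal P f N"] subspace_ext_ideal) (auto simp: ext_ideal_def)
  then show ?case by simp
qed


section \<open>Elementary symmetric polynomials form regular sequences\<close>

subsection \<open>Weakly regular sequences\<close>

text \<open>
  Regularity without the condition that the last quotient is nonzero. It is the notion that passes
  through filtrations, where zero factors may occur; the missing condition is added at the end by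
  \<open>regular_seq_of_weakly_regular\<close>.
\<close>

fun weakly_regular :: "'a::comm_ring_1 set \<Rightarrow> 'a set \<Rightarrow> 'a list \<Rightarrow> bool" where
  "weakly_regular N P [] \<longleftrightarrow> True"
| "weakly_regular N P (f # fs) \<longleftrightarrow>
     (\<forall>u\<in>N. f * u \<in> P \<longrightarrow> u \<in> P) \<and> weakly_regular N (ext_ideal P f N) fs"

lemma weakly_regular_refl:
  assumes "ideal.subspace (N :: 'a::comm_ring_1 set)"
  shows "weakly_regular N N fs"
proof (induction fs)
  case (Cons f fs)
  have "ext_ideal N f N = N"
    using ext_ideal_subset[OF assms order_refl] subset_ext_ideal[OF assms] by blast
  then show ?case using Cons by simp
qed simp

text \<open>
  The hypotheses say that multiplication by \<open>y\<close> induces an isomorphism from \<open>Q/P\<close> to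
  \<open>(A + yQ)/(A + yP)\<close>. With \<open>y = 1\<close> this is the second isomorphism theorem; with a monomial \<open>y\<close> it
  is a shift of degrees.
\<close>

lemma weakly_regular_transport:
  fixes Q P A :: "'a::comm_ring_1 set"
  assumes "ideal.subspace Q" "ideal.subspace P" "ideal.subspace A" "P \<subseteq> Q"
    and "\<And>q. q \<in> Q \<Longrightarrow> y * q \<in> ext_ideal A y P \<Longrightarrow> q \<in> P"
    and "weakly_regular Q P fs"
  shows "weakly_regular (ext_ideal A y Q) (ext_ideal A y P) fs"
  using assms(2,4-)
proof (induction fs arbitrary: P)
  case (Cons f fs)
  note P = Cons.prems(1) and PQ = Cons.prems(2) and inj = Cons.prems(3)
  have nzd: "u \<in> ext_ideal A y P"
    if uQ: "u \<in> ext_ideal A y Q" and fuP: "f * u \<in> ext_ideal A y P" for u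
  proof -
    obtain a q where u: "u = a + y * q" "a \<in> A" "q \<in> Q" using uQ by (rule ext_idealE)
    obtain a' p where fu: "f * u = a' + y * p" "a' \<in> A" "p \<in> P" using fuP by (rule ext_idealE)
    have "y * (f * q) = (a' - f * a) + y * p" using fu(1) u(1) by (simp add: algebra_simps)
    then have "y * (f * q) \<in> ext_ideal A y P"
      using fu u assms(3) by (auto intro!: ext_idealI ideal.subspace_diff ideal.subspace_scale)
    then have "f * q \<in> P" using inj u(3) ideal.subspace_scale[OF assms(1)] by blast
    then have "q \<in> P" using Cons.prems(4) u(3) by simp
    then show ?thesis unfolding u(1) using u(2) by (intro ext_idealI)
  qed
  let ?P = "ext_ideal P f Q"
  have "weakly_regular (ext_ideal A y Q) (ext_ideal A y ?P) fs"
  proof (rule Cons.IH)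
    show "ideal.subspace ?P" by (rule subspace_ext_ideal[OF P assms(1)])
    show "?P \<subseteq> Q" by (rule ext_ideal_subset[OF assms(1) PQ])
    show "weakly_regular Q ?P fs" using Cons.prems(4) by simp
    fix q assume q: "q \<in> Q" "y * q \<in> ext_ideal A y ?P"
    obtain a p where a: "y * q = a + y * p" "a \<in> A" "p \<in> ?P" using q(2) by (rule ext_idealE)
    have "p \<in> Q" using a(3) \<open>?P \<subseteq> Q\<close> by blast
    have "y * (q - p) = a + y * 0" using a(1) by (simp add: algebra_simps)
    then have "y * (q - p) \<in> ext_ideal A y P"
      using ext_idealI[OF a(2) ideal.subspace_0[OF P], of y] by simp
    then have "q - p \<in> P" using inj ideal.subspace_diff[OF assms(1) q(1) \<open>p \<in> Q\<close>] by blast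
    then have "q - p \<in> ?P" using subset_ext_ideal[OF assms(1)] by blast
    then have "(q - p) + p \<in> ?P"
      using a(3) subspace_ext_ideal[OF P assms(1)] by (intro ideal.subspace_add)
    then show "q \<in> ?P" by simp
  qed
  moreover have "ext_ideal A y ?P = ext_ideal (ext_ideal A y P) f (ext_ideal A y Q)"
  proof (intro equalityI subsetI)
    fix v assume "v \<in> ext_ideal A y ?P"
    then obtain a p q where *: "v = a + y * (p + f * q)" "a \<in> A" "p \<in> P" "q \<in> Q"
      by (auto elim!: ext_idealE)
    have "(a + y * p) + f * (0 + y * q) \<in> ext_ideal (ext_ideal A y P) f (ext_ideal A y Q)"
      using * ideal.subspace_0[OF assms(3)] by (intro ext_idealI)
    then show "v \<in> ext_ideal (ext_ideal A y P) f (ext_ideal A y Q)"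
      unfolding *(1) by (simp add: algebra_simps)
  next
    fix v assume "v \<in> ext_ideal (ext_ideal A y P) f (ext_ideal A y Q)"
    then obtain a p b q where *: "v = (a + y * p) + f * (b + y * q)"
      "a \<in> A" "p \<in> P" "b \<in> A" "q \<in> Q"
      by (auto elim!: ext_idealE)
    have "(a + f * b) + y * (p + f * q) \<in> ext_ideal A y ?P"
      using * by (intro ext_idealI ideal.subspace_add ideal.subspace_scale assms(3))
    then show "v \<in> ext_ideal A y ?P" unfolding *(1) by (simp add: algebra_simps)
  qed
  ultimately show ?case using nzd by simp
qed simp

text \<open>
  Consider \<open>0 \<rightarrow> Q/P \<rightarrow> N/P \<rightarrow> N/Q \<rightarrow> 0\<close>. A nonzerodivisor on both ends is one in the middle, and
  the sequence stays exact modulo it. The submodule of \<open>N/(P + fN)\<close> that arises is \<open>(Q + fN)/(P + fN)\<close>,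
  which is \<open>Q/(P + fQ)\<close> up to isomorphism as \<open>f\<close> is a nonzerodivisor on \<open>N/Q\<close>.
\<close>

lemma weakly_regular_filtration:
  fixes N P Q :: "'a::comm_ring_1 set"
  assumes "ideal.subspace N" "ideal.subspace P" "ideal.subspace Q" "P \<subseteq> Q" "Q \<subseteq> N"
    and "weakly_regular Q P fs" "weakly_regular N Q fs"
  shows "weakly_regular N P fs"
  using assms(2-)
proof (induction fs arbitrary: P Q)
  case (Cons f fs)
  note P = Cons.prems(1) and Q = Cons.prems(2) and PQ = Cons.prems(3) and QN = Cons.prems(4)
    and QP = Cons.prems(5) and NQ = Cons.prems(6)
  let ?A = "ext_ideal {0} f N"
  have A: "ideal.subspace ?A" by (intro subspace_ext_ideal assms(1)) simp
  have subQ: "ideal.subspace (ext_ideal P f Q)" by (rule subspace_ext_ideal[OF P Q])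
  have eq: "ext_ideal ?A 1 S = ext_ideal S f N" for S
  proof (intro equalityI subsetI)
    fix v assume "v \<in> ext_ideal ?A 1 S"
    then obtain u s where "v = (0 + f * u) + 1 * s" "u \<in> N" "s \<in> S" by (auto elim!: ext_idealE)
    then show "v \<in> ext_ideal S f N" using ext_idealI[of s S u N f] by (simp add: add.commute)
  next
    fix v assume "v \<in> ext_ideal S f N"
    then obtain u s where "v = s + f * u" "u \<in> N" "s \<in> S" by (auto elim!: ext_idealE)
    then show "v \<in> ext_ideal ?A 1 S"
      using ext_idealI[OF ext_idealI[of 0 "{0}" u N f], of s S 1] by (simp add: add.commute)
  qed
  have absorb: "ext_ideal (ext_ideal P f Q) f N = ext_ideal P f N"
  proof (intro equalityI subsetI)
    fix v assume "v \<in> ext_ideal (ext_ideal P f Q) f N"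
    then obtain p q n where *: "v = (p + f * q) + f * n" "p \<in> P" "q \<in> Q" "n \<in> N"
      by (auto elim!: ext_idealE)
    then have "p + f * (q + n) \<in> ext_ideal P f N"
      using QN by (intro ext_idealI ideal.subspace_add assms(1)) auto
    then show "v \<in> ext_ideal P f N" unfolding *(1) by (simp add: algebra_simps)
  next
    fix v assume "v \<in> ext_ideal P f N"
    then obtain p n where "v = p + f * n" "p \<in> P" "n \<in> N" by (auto elim!: ext_idealE)
    then show "v \<in> ext_ideal (ext_ideal P f Q) f N"
      using subset_ext_ideal[OF Q, of P f] by (auto intro: ext_idealI)
  qed
  have "weakly_regular (ext_ideal ?A 1 Q) (ext_ideal ?A 1 (ext_ideal P f Q)) fs"
  proof (rule weakly_regular_transport[OF Q subQ A])
    show "ext_ideal P f Q \<subseteq> Q" by (rule ext_ideal_subset[OF Q PQ])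
    show "weakly_regular Q (ext_ideal P f Q) fs" using QP by simp
    fix q assume q: "q \<in> Q" "1 * q \<in> ext_ideal ?A 1 (ext_ideal P f Q)"
    then have "q \<in> ext_ideal P f N" by (simp add: eq absorb)
    then obtain p n where pn: "q = p + f * n" "p \<in> P" "n \<in> N" by (rule ext_idealE)
    then have "f * n = q - p" by simp
    then have "f * n \<in> Q" using q(1) pn(2) PQ Q by (auto intro: ideal.subspace_diff)
    then have "n \<in> Q" using NQ pn(3) by simp
    then show "q \<in> ext_ideal P f Q" unfolding pn(1) using pn(2) by (intro ext_idealI)
  qed
  then have "weakly_regular (ext_ideal Q f N) (ext_ideal P f N) fs" by (simp add: eq absorb)
  moreover have "weakly_regular N (ext_ideal Q f N) fs" using NQ by simp
  moreover have "ext_ideal P f N \<subseteq> ext_ideal Q f N" using PQ unfolding ext_ideal_def by blast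
  moreover have "ext_ideal Q f N \<subseteq> N" by (rule ext_ideal_subset[OF assms(1) QN])
  ultimately have "weakly_regular N (ext_ideal P f N) fs"
    using Cons.IH[OF subspace_ext_ideal[OF P assms(1)] subspace_ext_ideal[OF Q assms(1)]] by blast
  moreover have "u \<in> P" if "u \<in> N" "f * u \<in> P" for u
  proof -
    have "u \<in> Q" using NQ that PQ by (simp add: subset_iff)
    then show ?thesis using QP that(2) by simp
  qed
  ultimately show ?case by simp
qed simp


subsection \<open>Degrees\<close>

definition hom_component :: "nat \<Rightarrow> ('n::finite, 'k::comm_ring_1) poly_ring \<Rightarrow> ('n, 'k) poly_ring" where
  "hom_component d p =
    Poly_Mapping.Abs_poly_mapping (\<lambda>k. if mdeg k = d then Poly_Mapping.lookup p k else 0)"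

definition homogeneous :: "nat \<Rightarrow> ('n::finite, 'k::comm_ring_1) poly_ring \<Rightarrow> bool" where
  "homogeneous d p \<longleftrightarrow> (\<forall>k\<in>Poly_Mapping.keys p. mdeg k = d)"

definition graded :: "('n::finite, 'k::comm_ring_1) poly_ring set \<Rightarrow> bool" where
  "graded P \<longleftrightarrow> (\<forall>p\<in>P. \<forall>d. hom_component d p \<in> P)"

lemma lookup_hom_component:
  "Poly_Mapping.lookup (hom_component d p) k = (if mdeg k = d then Poly_Mapping.lookup p k else 0)"
proof -
  have "finite {k. (if mdeg k = d then Poly_Mapping.lookup p k else 0) \<noteq> 0}"
    by (rule finite_subset[OF _ finite_lookup[of p]]) auto
  then show ?thesis by (simp add: hom_component_def)
qed

lemma hom_component_add: "hom_component d (p + q) = hom_component d p + hom_component d q"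
  by (rule poly_mapping_eqI) (simp add: lookup_hom_component lookup_add)

lemma hom_component_sum: "hom_component d (\<Sum>i\<in>X. f i) = (\<Sum>i\<in>X. hom_component d (f i))"
proof (rule poly_mapping_eqI)
  fix k
  show "Poly_Mapping.lookup (hom_component d (\<Sum>i\<in>X. f i)) k
    = Poly_Mapping.lookup (\<Sum>i\<in>X. hom_component d (f i)) k"
    by (cases "mdeg k = d") (simp_all add: lookup_hom_component lookup_sum)
qed

lemma homogeneous_hom_component: "homogeneous d (hom_component d p)"
  by (auto simp: homogeneous_def in_keys_iff lookup_hom_component split: if_splits)

lemma hom_component_homogeneous:
  assumes "homogeneous e p"
  shows "hom_component d p = (if d = e then p else 0)"
proof (rule poly_mapping_eqI)
  fix k
  have "mdeg k = e \<or> Poly_Mapping.lookup p k = 0"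
    using assms by (auto simp: homogeneous_def in_keys_iff)
  then show "Poly_Mapping.lookup (hom_component d p) k
      = Poly_Mapping.lookup (if d = e then p else 0) k"
    by (auto simp: lookup_hom_component)
qed

lemma mdeg_add: "mdeg (a + b) = mdeg a + mdeg b"
  by (simp add: mdeg_def lookup_add sum.distrib)

lemma homogeneous_mult:
  assumes "homogeneous d p" "homogeneous e q"
  shows "homogeneous (d + e) (p * q)"
  unfolding homogeneous_def
proof
  fix k assume "k \<in> Poly_Mapping.keys (p * q)"
  then obtain a b where "k = a + b" "a \<in> Poly_Mapping.keys p" "b \<in> Poly_Mapping.keys q"
    using keys_mult[of p q] by blast
  with assms show "mdeg k = d + e" by (simp add: homogeneous_def mdeg_add)
qed

lemma homogeneous_power:
  assumes "homogeneous d p"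
  shows "homogeneous (k * d) (p ^ k)"
proof (induction k)
  case 0
  show ?case by (simp add: homogeneous_def mdeg_def)
next
  case (Suc k)
  then show ?case using homogeneous_mult[OF assms] by simp
qed

lemma sum_hom_components:
  "(\<Sum>d\<in>mdeg ` Poly_Mapping.keys p. hom_component d p) = p"
proof (rule poly_mapping_eqI)
  fix k
  have "Poly_Mapping.lookup (\<Sum>d\<in>mdeg ` Poly_Mapping.keys p. hom_component d p) k
      = (\<Sum>d\<in>mdeg ` Poly_Mapping.keys p. if d = mdeg k then Poly_Mapping.lookup p k else 0)"
    unfolding lookup_sum by (intro sum.cong) (auto simp: lookup_hom_component)
  also have "\<dots> = Poly_Mapping.lookup p k" by (auto simp: in_keys_iff)
  finally show "Poly_Mapping.lookup (\<Sum>d\<in>mdeg ` Poly_Mapping.keys p. hom_component d p) k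
      = Poly_Mapping.lookup p k" .
qed

lemma hom_component_mult:
  assumes "homogeneous e f"
  shows "hom_component d (f * u) = (if e \<le> d then f * hom_component (d - e) u else 0)"
proof -
  let ?X = "mdeg ` Poly_Mapping.keys u"
  have out: "hom_component c u = 0" if "c \<notin> ?X" for c
    by (rule poly_mapping_eqI) (use that in \<open>auto simp: lookup_hom_component in_keys_iff\<close>)
  have "hom_component d (f * u) = (\<Sum>c\<in>?X. hom_component d (f * hom_component c u))"
    by (subst sum_hom_components[of u, symmetric])
      (simp only: sum_distrib_left hom_component_sum)
  also have "\<dots> = (\<Sum>c\<in>?X. if d = e + c then f * hom_component c u else 0)"
    by (intro sum.cong refl hom_component_homogeneous homogeneous_mult assms
        homogeneous_hom_component)
  also have "\<dots> = (if e \<le> d then f * hom_component (d - e) u else 0)"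
  proof (cases "e \<le> d")
    case True
    then have "d = e + c \<longleftrightarrow> c = d - e" for c by auto
    then show ?thesis using True out by auto
  qed auto
  finally show ?thesis .
qed

lemma graded_supported: "graded (supported U)"
  by (auto simp: graded_def supported_def in_keys_iff lookup_hom_component split: if_splits)

lemma graded_ext_ideal:
  assumes "graded P" "graded N" "homogeneous e f" "ideal.subspace N"
  shows "graded (ext_ideal P f N)"
  unfolding graded_def
proof (intro ballI allI)
  fix v d assume "v \<in> ext_ideal P f N"
  then obtain p u where v: "v = p + f * u" "p \<in> P" "u \<in> N" by (rule ext_idealE)
  have "hom_component d v = hom_component d p + f * (if e \<le> d then hom_component (d - e) u else 0)"
    by (simp add: v hom_component_add hom_component_mult[OF assms(3)])
  moreover have "hom_component d p \<in> P" "hom_component c u \<in> N" for c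
    using v assms(1,2) by (simp_all add: graded_def)
  ultimately show "hom_component d v \<in> ext_ideal P f N"
    using ideal.subspace_0[OF assms(4)] by (simp only:) (intro ext_idealI; simp)
qed

text \<open>
  A graded substitute for Krull's intersection theorem: in degree \<open>d\<close> the multiples of \<open>f ^ Suc d\<close>
  vanish.
\<close>

lemma graded_separated:
  assumes "graded P" "ideal.subspace P" "homogeneous e f" "e > 0"
    and "\<And>k. \<exists>p\<in>P. \<exists>n. u = p + f ^ k * n"
  shows "u \<in> P"
proof -
  have "hom_component d u \<in> P" for d
  proof -
    obtain p n where u: "u = p + f ^ Suc d * n" "p \<in> P" using assms(5) by blast
    have "d < Suc d * e" using assms(4) by (cases e) auto
    then have "hom_component d (f ^ Suc d * n) = 0"
      using hom_component_mult[OF homogeneous_power[OF assms(3), of "Suc d"], of d n] by simp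
    then have "hom_component d u = hom_component d p" unfolding u(1) hom_component_add by simp
    then show ?thesis using u(2) assms(1) by (simp add: graded_def)
  qed
  then have "(\<Sum>d\<in>mdeg ` Poly_Mapping.keys u. hom_component d u) \<in> P"
    by (intro ideal.subspace_sum assms(2))
  then show ?thesis by (simp add: sum_hom_components)
qed

text \<open>
  If \<open>x\<close> is regular on \<open>M\<close> and the sequence is regular on \<open>M/xM\<close>, then it is regular on \<open>M\<close>.
  Indeed, if \<open>f u = 0\<close> in \<open>M\<close>, then \<open>u\<close> is a multiple of \<open>x\<close>; cancelling \<open>x\<close> one can go on, and so
  \<open>u\<close> is divisible by all powers of \<open>x\<close>, hence zero. Moreover \<open>x\<close> stays regular on \<open>M/fM\<close>.
\<close>

lemma weakly_regular_lift:
  fixes N P :: "('n::finite, 'k::comm_ring_1) poly_ring set"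
  assumes "ideal.subspace N" "graded N" "homogeneous e x" "e > 0"
    and "\<And>f. f \<in> set fs \<Longrightarrow> \<exists>d. homogeneous d f"
    and "ideal.subspace P" "graded P"
    and "\<And>u. u \<in> N \<Longrightarrow> x * u \<in> P \<Longrightarrow> u \<in> P"
    and "weakly_regular N (ext_ideal P x N) fs"
  shows "weakly_regular N P fs"
  using assms(5-)
proof (induction fs arbitrary: P)
  case (Cons f fs)
  note P = Cons.prems(2,3) and x = Cons.prems(4)
  obtain d where d: "homogeneous d f" using Cons.prems(1)[of f] by auto
  have f: "u \<in> ext_ideal P x N" if "u \<in> N" "f * u \<in> ext_ideal P x N" for u
    using Cons.prems(5) that by simp
  have sub: "P \<subseteq> ext_ideal P x N" by (rule subset_ext_ideal[OF assms(1)])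
  have nzd: "u \<in> P" if "u \<in> N" "f * u \<in> P" for u
  proof (rule graded_separated[OF P(2,1) assms(3,4)])
    fix k
    have "\<exists>p\<in>P. \<exists>n. u = p + x ^ k * n \<and> n \<in> N \<and> f * n \<in> P"
    proof (induction k)
      case 0
      show ?case using that ideal.subspace_0[OF P(1)] by (intro bexI[of _ 0] exI[of _ u]) auto
    next
      case (Suc k)
      then obtain p n where pn: "p \<in> P" "u = p + x ^ k * n" "n \<in> N" "f * n \<in> P" by blast
      then obtain q m where m: "n = q + x * m" "q \<in> P" "m \<in> N"
        using f[of n] sub by (blast elim: ext_idealE)
      have "x * (f * m) = f * n - f * q" by (simp add: m(1) algebra_simps)
      then have "x * (f * m) \<in> P"
        using pn(4) m(2) P(1) by (auto intro: ideal.subspace_diff ideal.subspace_scale)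
      then have "f * m \<in> P" using x m(3) ideal.subspace_scale[OF assms(1)] by blast
      moreover have "u = (p + x ^ k * q) + x ^ Suc k * m"
        by (simp add: pn(2) m(1) algebra_simps)
      moreover have "p + x ^ k * q \<in> P"
        using pn m P(1) by (intro ideal.subspace_add ideal.subspace_scale)
      ultimately show ?case using m(3) by blast
    qed
    then show "\<exists>p\<in>P. \<exists>n. u = p + x ^ k * n" by blast
  qed
  have "weakly_regular N (ext_ideal P f N) fs"
  proof (rule Cons.IH)
    show "ideal.subspace (ext_ideal P f N)" by (rule subspace_ext_ideal[OF P(1) assms(1)])
    show "graded (ext_ideal P f N)" by (rule graded_ext_ideal[OF P(2) assms(2) d assms(1)])
    show "\<exists>d. homogeneous d g" if "g \<in> set fs" for g using Cons.prems(1) that by simp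
    fix u assume u: "u \<in> N" "x * u \<in> ext_ideal P f N"
    obtain p v where v: "x * u = p + f * v" "p \<in> P" "v \<in> N" using u(2) by (rule ext_idealE)
    have "f * v = - p + x * u" using v(1) by simp
    also have "\<dots> \<in> ext_ideal P x N"
      using v(2) u(1) P(1) by (intro ext_idealI ideal.subspace_neg)
    finally have "f * v \<in> ext_ideal P x N" .
    then obtain q w where w: "v = q + x * w" "q \<in> P" "w \<in> N"
      using f[OF v(3)] by (blast elim: ext_idealE)
    have "x * (u - f * w) = p + f * q" using v(1) by (simp add: w(1) algebra_simps)
    then have "x * (u - f * w) \<in> P"
      using v(2) w(2) P(1) by (auto intro: ideal.subspace_add ideal.subspace_scale)
    then have "u - f * w \<in> P"
      using x u(1) w(3) assms(1) by (auto intro: ideal.subspace_diff ideal.subspace_scale)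
    then have "(u - f * w) + f * w \<in> ext_ideal P f N" using w(3) by (intro ext_idealI)
    then show "u \<in> ext_ideal P f N" by simp
  next
    have "ext_ideal (ext_ideal P f N) x N = ext_ideal (ext_ideal P x N) f N"
    proof (intro equalityI subsetI)
      fix v assume "v \<in> ext_ideal (ext_ideal P f N) x N"
      then obtain p n m where *: "v = (p + f * n) + x * m" "p \<in> P" "n \<in> N" "m \<in> N"
        by (auto elim!: ext_idealE)
      then have "(p + x * m) + f * n \<in> ext_ideal (ext_ideal P x N) f N" by (intro ext_idealI)
      then show "v \<in> ext_ideal (ext_ideal P x N) f N" unfolding *(1) by (simp add: ac_simps)
    next
      fix v assume "v \<in> ext_ideal (ext_ideal P x N) f N"
      then obtain p n m where *: "v = (p + x * n) + f * m" "p \<in> P" "n \<in> N" "m \<in> N"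
        by (auto elim!: ext_idealE)
      then have "(p + f * m) + x * n \<in> ext_ideal (ext_ideal P f N) x N" by (intro ext_idealI)
      then show "v \<in> ext_ideal (ext_ideal P f N) x N" unfolding *(1) by (simp add: ac_simps)
    qed
    then show "weakly_regular N (ext_ideal (ext_ideal P f N) x N) fs" using Cons.prems(5) by simp
  qed
  then show ?case using nzd by simp
qed simp

text \<open>
  The nonvanishing of the quotients is Nakayama's lemma for graded modules: if \<open>M = fM\<close>, then \<open>M\<close>
  consists of elements that are divisible by all powers of \<open>f\<close>.
\<close>

lemma regular_seq_of_weakly_regular:
  fixes N P :: "('n::finite, 'k::comm_ring_1) poly_ring set"
  assumes "ideal.subspace N" "graded N"
    and "ideal.subspace P" "graded P" "P \<subset> N"
    and "\<And>f. f \<in> set fs \<Longrightarrow> \<exists>d>0. homogeneous d f"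
    and "weakly_regular N P fs"
  shows "regular_seq N P fs"
  using assms(3-)
proof (induction fs arbitrary: P)
  case (Cons f fs)
  note P = Cons.prems(1,2) and PN = Cons.prems(3)
  obtain d where d: "d > 0" "homogeneous d f" using Cons.prems(4)[of f] by auto
  have "ext_ideal P f N \<noteq> N"
  proof
    assume eq: "ext_ideal P f N = N"
    have "u \<in> P" if u: "u \<in> N" for u
    proof (rule graded_separated[OF P(2,1) d(2,1)])
      fix k
      have "\<exists>p\<in>P. \<exists>n\<in>N. u = p + f ^ k * n"
      proof (induction k)
        case 0
        show ?case using u ideal.subspace_0[OF P(1)] by (intro bexI[of _ 0] bexI[of _ u]) auto
      next
        case (Suc k)
        then obtain p n where pn: "p \<in> P" "n \<in> N" "u = p + f ^ k * n" by blast
        then obtain q m where m: "n = q + f * m" "q \<in> P" "m \<in> N"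
          using eq by (blast elim: ext_idealE)
        have "u = (p + f ^ k * q) + f ^ Suc k * m" by (simp add: pn(3) m(1) algebra_simps)
        moreover have "p + f ^ k * q \<in> P"
          using pn m P(1) by (intro ideal.subspace_add ideal.subspace_scale)
        ultimately show ?case using m(3) by blast
      qed
      then show "\<exists>p\<in>P. \<exists>n. u = p + f ^ k * n" by blast
    qed
    with PN show False by blast
  qed
  then have "ext_ideal P f N \<subset> N"
    using ext_ideal_subset[OF assms(1), of P f] PN by blast
  then have "regular_seq N (ext_ideal P f N) fs"
    using Cons.prems P subspace_ext_ideal[OF P(1) assms(1)]
      graded_ext_ideal[OF P(2) assms(2) d(2) assms(1)]
    by (intro Cons.IH) auto
  then show ?case using Cons.prems(5) unfolding regular_seq_Cons by simp
qed auto


subsection \<open>Elementary symmetric polynomials on coordinate subspaces\<close>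

definition indicator_exp :: "'n set \<Rightarrow> 'n \<Rightarrow> nat" where
  "indicator_exp F i = (if i \<in> F then 1 else 0)"

definition variable :: "'n::finite \<Rightarrow> ('n, 'k::comm_ring_1) poly_ring" where
  "variable i = monom (expo (indicator_exp {i}))"

definition elem_sym :: "nat \<Rightarrow> ('n::finite, 'k::comm_ring_1) poly_ring" where
  "elem_sym k = (\<Sum>F | card F = k. monom (expo (indicator_exp F)))"

text \<open>
  The degrees decrease, so that the first member becomes a monomial on a coordinate subspace of
  dimension \<open>t\<close>, and the remaining list is of the same kind.
\<close>

fun elem_syms :: "nat \<Rightarrow> ('n::finite, 'k::comm_ring_1) poly_ring list" where
  "elem_syms 0 = []"
| "elem_syms (Suc t) = elem_sym (Suc t) # elem_syms t"

text \<open>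
  The kernel of the projection onto \<open>K[Z]\<close>, generated by the variables outside \<open>Z\<close>.
\<close>

definition coord_ideal :: "'n set \<Rightarrow> ('n::finite, 'k::comm_ring_1) poly_ring set" where
  "coord_ideal Z = supported {b. \<exists>i. i \<notin> Z \<and> b i > 0}"

lemma length_elem_syms [simp]: "length (elem_syms t) = t"
  by (induction t) auto

lemma set_elem_syms: "f \<in> set (elem_syms t) \<Longrightarrow> \<exists>k>0. f = elem_sym k"
  by (induction t) auto

lemma homogeneous_elem_sym: "homogeneous k (elem_sym k)"
  unfolding homogeneous_def
proof
  fix m assume "m \<in> Poly_Mapping.keys (elem_sym k :: ('a, 'b) poly_ring)"
  then obtain F :: "'a set" where "card F = k" "m = expo (indicator_exp F)"
    using keys_sum[of "\<lambda>F. monom (expo (indicator_exp F)) :: ('a, 'b) poly_ring" "{F. card F = k}"]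
    unfolding elem_sym_def by auto
  then show "mdeg m = k" by (simp add: mdeg_def indicator_exp_def sum.If_cases)
qed

lemma up_closed_coord: "up_closed {b. \<exists>i. i \<notin> Z \<and> (0::nat) < b i}"
  unfolding up_closed_def le_fun_def by (auto intro: less_le_trans)

lemma subspace_coord_ideal: "ideal.subspace (coord_ideal Z)"
  unfolding coord_ideal_def by (rule subspace_supported[OF up_closed_coord])

lemma monom_mult_coord_ideal:
  fixes q :: "('n::finite, 'k::comm_ring_1) poly_ring"
  assumes "\<And>i. i \<notin> Z \<Longrightarrow> a i = 0"
  shows "monom (expo a) * q \<in> coord_ideal Z \<longleftrightarrow> q \<in> coord_ideal Z"
proof -
  have "(\<exists>i. i \<notin> Z \<and> 0 < Poly_Mapping.lookup (expo a + k) i) \<longleftrightarrow>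
      (\<exists>i. i \<notin> Z \<and> 0 < Poly_Mapping.lookup k i)" for k
    using assms by (auto simp: lookup_add)
  then show ?thesis by (simp add: coord_ideal_def supported_def keys_monom_mult)
qed

text \<open>
  Every other \<open>k\<close>-subset contains an element outside \<open>Z\<close>.
\<close>

lemma elem_sym_mod_coord_ideal:
  fixes Z :: "'n::finite set"
  assumes "card Z = k"
  shows "(elem_sym k - monom (expo (indicator_exp Z)) :: ('n, 'k::comm_ring_1) poly_ring) \<in> coord_ideal Z"
proof -
  have "(elem_sym k :: ('n, 'k) poly_ring) = monom (expo (indicator_exp Z)) +
      (\<Sum>F\<in>{F. card F = k} - {Z}. monom (expo (indicator_exp F)))"
    unfolding elem_sym_def using assms by (intro sum.remove) auto
  moreover have "(\<Sum>F\<in>{F. card F = k} - {Z}. monom (expo (indicator_exp F)) :: ('n, 'k) poly_ring)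
      \<in> coord_ideal Z"
  proof (rule ideal.subspace_sum[OF subspace_coord_ideal])
    fix F assume F: "F \<in> {F. card F = k} - {Z}"
    then have "\<not> F \<subseteq> Z" using card_subset_eq[of Z F] assms by auto
    then show "(monom (expo (indicator_exp F)) :: ('n, 'k) poly_ring) \<in> coord_ideal Z"
      by (auto simp: coord_ideal_def indicator_exp_def)
  qed
  ultimately show ?thesis by simp
qed

lemma ext_coord_ideal_variable:
  fixes z :: "'n::finite"
  assumes "z \<in> Z"
  shows "ext_ideal (coord_ideal Z) (variable z) UNIV
    = (coord_ideal (Z - {z}) :: ('n, 'k::comm_ring_1) poly_ring set)" (is "?L = ?R")
proof
  have L: "ideal.subspace ?L" by (intro subspace_ext_ideal subspace_coord_ideal ideal.subspace_UNIV)
  have 1: "coord_ideal Z \<subseteq> ?R"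
    unfolding coord_ideal_def by (rule supported_mono) auto
  have "(variable z :: ('n, 'k) poly_ring) \<in> ?R"
    by (auto simp: variable_def coord_ideal_def indicator_exp_def)
  then have "u * variable z \<in> ?R" for u
    using subspace_coord_ideal by (rule ideal.subspace_scale[rotated])
  then have 2: "variable z * u \<in> ?R" for u by (simp add: mult.commute)
  show "?L \<subseteq> ?R"
    using 1 2 by (auto elim!: ext_idealE intro!: ideal.subspace_add[OF subspace_coord_ideal])
  show "?R \<subseteq> ?L"
    unfolding coord_ideal_def[of "Z - {z}"]
  proof (rule supported_subset[OF L])
    fix k :: "'n exps"
    assume "Poly_Mapping.lookup k \<in> {b. \<exists>i. i \<notin> Z - {z} \<and> 0 < b i}"
    then consider "Poly_Mapping.lookup k \<in> {b. \<exists>i. i \<notin> Z \<and> 0 < b i}" | "0 < Poly_Mapping.lookup k z"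
      by auto
    then show "monom k \<in> ?L"
    proof cases
      case 1
      then have "monom k \<in> coord_ideal Z" by (simp add: coord_ideal_def)
      then show ?thesis using subset_ext_ideal[OF ideal.subspace_UNIV] by blast
    next
      case 2
      then have "Poly_Mapping.lookup (expo (indicator_exp {z})) \<le> Poly_Mapping.lookup k"
        by (auto simp: le_fun_def indicator_exp_def)
      then obtain c where "k = expo (indicator_exp {z}) + c" using le_imp_add by blast
      then show ?thesis
        using mult_in_ext_ideal[OF subspace_coord_ideal, of "monom c" UNIV]
        by (simp add: monom_add variable_def)
    qed
  qed
qed

lemma ext_ideal_cong:
  fixes P :: "'a::comm_ring_1 set"
  assumes "ideal.subspace P" "ideal.subspace N"
    and "\<And>u. u \<in> N \<Longrightarrow> (f - g) * u \<in> P"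
  shows "ext_ideal P f N = ext_ideal P g N"
proof (intro equalityI subsetI)
  fix v assume "v \<in> ext_ideal P f N"
  then obtain p u where *: "v = p + f * u" "p \<in> P" "u \<in> N" by (rule ext_idealE)
  then have "(p + (f - g) * u) + g * u \<in> ext_ideal P g N"
    using assms by (intro ext_idealI ideal.subspace_add)
  then show "v \<in> ext_ideal P g N" by (simp add: * algebra_simps)
next
  fix v assume "v \<in> ext_ideal P g N"
  then obtain p u where *: "v = p + g * u" "p \<in> P" "u \<in> N" by (rule ext_idealE)
  then have "(p - (f - g) * u) + f * u \<in> ext_ideal P f N"
    using assms by (intro ext_idealI ideal.subspace_diff)
  then show "v \<in> ext_ideal P f N" by (simp add: * algebra_simps)
qed

text \<open>
  Adding one variable after the other to \<open>F\<close> filters \<open>K[Z]/(x\<^sup>F)\<close>, where \<open>x\<^sup>F\<close> is the product of the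
  variables in \<open>F\<close>: the factor from \<open>F\<close> to \<open>F \<union> {z}\<close> is \<open>x\<^sup>F K[Z]/x\<^sup>F x\<^sub>z K[Z]\<close>, a shifted copy of
  \<open>K[Z - {z}]\<close>.
\<close>

lemma weakly_regular_monomial_quotient:
  fixes Z F :: "'n::finite set" and fs :: "('n, 'k::comm_ring_1) poly_ring list"
  assumes "F \<subseteq> Z"
    and "\<And>z. z \<in> Z \<Longrightarrow> weakly_regular UNIV (coord_ideal (Z - {z})) fs"
  shows "weakly_regular UNIV (ext_ideal (coord_ideal Z) (monom (expo (indicator_exp F))) UNIV) fs"
proof -
  have "finite F" by simp
  then show ?thesis using assms(1)
  proof (induction F)
    case empty
    have "expo (indicator_exp {}) = (0 :: 'n exps)"
      by (rule poly_mapping_eqI) (simp add: indicator_exp_def)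
    then have "ext_ideal (coord_ideal Z) (monom (expo (indicator_exp {}))) UNIV
        = (UNIV :: ('n, 'k) poly_ring set)"
      using mult_in_ext_ideal[OF subspace_coord_ideal, of _ UNIV 1] by auto
    then show ?case using weakly_regular_refl[OF ideal.subspace_UNIV] by simp
  next
    case (insert z F)
    let ?x = "\<lambda>F. monom (expo (indicator_exp F)) :: ('n, 'k) poly_ring"
    let ?E = "\<lambda>F. ext_ideal (coord_ideal Z) (?x F) UNIV"
    note U = ideal.subspace_UNIV and C = subspace_coord_ideal
    have z: "z \<in> Z" and FZ: "F \<subseteq> Z" using insert.prems by auto
    note ext_z = ext_coord_ideal_variable[OF z, unfolded variable_def]
    have "expo (indicator_exp (insert z F)) = expo (indicator_exp F) + expo (indicator_exp {z})"
      using insert.hyps by (intro poly_mapping_eqI) (auto simp: lookup_add indicator_exp_def)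
    then have x: "?x (insert z F) = ?x F * ?x {z}" by (simp add: monom_add)
    have xC: "?x F * q \<in> coord_ideal Y \<longleftrightarrow> q \<in> coord_ideal Y" if "F \<subseteq> Y" for q Y
      using that by (intro monom_mult_coord_ideal) (auto simp: indicator_exp_def)
    have CC: "coord_ideal Z \<subseteq> (coord_ideal (Z - {z}) :: ('n, 'k) poly_ring set)"
      unfolding coord_ideal_def by (rule supported_mono) auto
    have eq: "ext_ideal (coord_ideal Z) (?x F) (coord_ideal (Z - {z})) = ?E (insert z F)"
    proof (intro equalityI subsetI)
      fix v assume "v \<in> ext_ideal (coord_ideal Z) (?x F) (coord_ideal (Z - {z}))"
      then obtain p q u where *: "v = p + ?x F * (q + ?x {z} * u)"
        "p \<in> coord_ideal Z" "q \<in> coord_ideal Z"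
        unfolding ext_z[symmetric] by (auto elim!: ext_idealE)
      have "(p + ?x F * q) + ?x (insert z F) * u \<in> ?E (insert z F)"
        using * by (intro ext_idealI ideal.subspace_add ideal.subspace_scale C) auto
      then show "v \<in> ?E (insert z F)" by (simp add: * x algebra_simps)
    next
      fix v assume "v \<in> ?E (insert z F)"
      then obtain p u where *: "v = p + ?x F * (?x {z} * u)" "p \<in> coord_ideal Z"
        by (auto elim!: ext_idealE simp: x mult.assoc)
      have "?x {z} * u \<in> coord_ideal (Z - {z})"
        unfolding ext_z[symmetric] by (rule mult_in_ext_ideal[OF C]) simp
      then show "v \<in> ext_ideal (coord_ideal Z) (?x F) (coord_ideal (Z - {z}))"
        unfolding *(1) using *(2) by (intro ext_idealI)
    qed
    have "weakly_regular (?E F) (ext_ideal (coord_ideal Z) (?x F) (coord_ideal (Z - {z}))) fs"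
    proof (rule weakly_regular_transport[OF U C C])
      show "weakly_regular UNIV (coord_ideal (Z - {z})) fs" using assms(2) z by blast
      fix q assume "?x F * q \<in> ext_ideal (coord_ideal Z) (?x F) (coord_ideal (Z - {z}))"
      then obtain p r where "?x F * q = p + ?x F * r" "p \<in> coord_ideal Z" "r \<in> coord_ideal (Z - {z})"
        by (rule ext_idealE)
      then have r: "?x F * (q - r) \<in> coord_ideal Z" "r \<in> coord_ideal (Z - {z})"
        by (simp_all add: algebra_simps)
      then have "q - r \<in> coord_ideal (Z - {z})" using xC[OF FZ] CC by blast
      then have "(q - r) + r \<in> coord_ideal (Z - {z})" using r(2) by (rule ideal.subspace_add[OF C])
      then show "q \<in> coord_ideal (Z - {z})" by simp
    qed simp
    then have "weakly_regular (?E F) (?E (insert z F)) fs" unfolding eq .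
    moreover have "weakly_regular UNIV (?E F) fs" by (rule insert.IH[OF FZ])
    moreover have "?E (insert z F) \<subseteq> ?E F"
    proof
      fix v assume "v \<in> ?E (insert z F)"
      then obtain p u where "v = p + ?x F * (?x {z} * u)" "p \<in> coord_ideal Z"
        by (auto elim!: ext_idealE simp: x mult.assoc)
      then show "v \<in> ?E F" by (auto intro: ext_idealI)
    qed
    moreover have "ideal.subspace (?E G)" for G by (rule subspace_ext_ideal[OF C U])
    ultimately show ?case using weakly_regular_filtration[OF U _ _ _ subset_UNIV] by blast
  qed
qed

text \<open>
  Double induction. If \<open>Z\<close> has exactly as many elements as the degree of the first polynomial, then
  that polynomial is the product of all variables of \<open>Z\<close>, and the quotient by it is filtered by
  the \<open>K[Z - {z}]\<close>, for which the shorter sequence is regular. If \<open>Z\<close> is larger, then a variable of \<open>Z\<close>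
  can be divided out first.
\<close>

lemma weakly_regular_coord_ideal:
  fixes Z :: "'n::finite set"
  assumes "t \<le> card Z"
  shows "weakly_regular UNIV (coord_ideal Z :: ('n, 'k::comm_ring_1) poly_ring set) (elem_syms t)"
  using assms
proof (induction t arbitrary: Z)
  case (Suc t)
  note small = Suc.IH
  let ?e = "elem_sym (Suc t) :: ('n, 'k) poly_ring"
  note C = subspace_coord_ideal and U = ideal.subspace_UNIV
  show ?case using Suc.prems
  proof (induction "card Z" arbitrary: Z rule: less_induct)
    case less
    show ?case
    proof (cases "card Z = Suc t")
      case True
      let ?x = "monom (expo (indicator_exp Z)) :: ('n, 'k) poly_ring"
      have diff: "?e - ?x \<in> coord_ideal Z" by (rule elem_sym_mod_coord_ideal[OF True])
      have diff_mult: "(?e - ?x) * u \<in> coord_ideal Z" for u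
        using ideal.subspace_scale[OF C diff, of u] by (simp add: mult.commute)
      have "u \<in> coord_ideal Z" if "?e * u \<in> coord_ideal Z" for u
      proof -
        have "?e * u - (?e - ?x) * u \<in> coord_ideal Z"
          using that diff_mult by (rule ideal.subspace_diff[OF C])
        then have "?x * u \<in> coord_ideal Z" by (simp add: algebra_simps)
        moreover have "?x * u \<in> coord_ideal Z \<longleftrightarrow> u \<in> coord_ideal Z"
          by (rule monom_mult_coord_ideal) (simp add: indicator_exp_def)
        ultimately show ?thesis by blast
      qed
      moreover have "ext_ideal (coord_ideal Z) ?e UNIV = ext_ideal (coord_ideal Z) ?x UNIV"
        by (rule ext_ideal_cong[OF C U diff_mult])
      moreover have "weakly_regular UNIV (ext_ideal (coord_ideal Z) ?x UNIV) (elem_syms t)"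
      proof (rule weakly_regular_monomial_quotient[OF order_refl])
        fix z assume "z \<in> Z"
        then have "t \<le> card (Z - {z})" using True by simp
        then show "weakly_regular UNIV (coord_ideal (Z - {z}) :: ('n, 'k) poly_ring set) (elem_syms t)"
          by (rule small)
      qed
      ultimately show ?thesis by simp
    next
      case False
      with less.prems have big: "Suc t < card Z" by simp
      then obtain z where z: "z \<in> Z" by fastforce
      let ?x = "variable z :: ('n, 'k) poly_ring"
      show ?thesis
      proof (rule weakly_regular_lift[OF U])
        show "graded (UNIV :: ('n, 'k) poly_ring set)" by (simp add: graded_def)
        show "homogeneous 1 ?x" by (simp add: variable_def homogeneous_def mdeg_def indicator_exp_def)
        show "\<exists>d. homogeneous d f" if "f \<in> set (elem_syms (Suc t))" for f :: "('n, 'k) poly_ring"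
          using set_elem_syms[OF that] homogeneous_elem_sym by blast
        show "graded (coord_ideal Z :: ('n, 'k) poly_ring set)"
          unfolding coord_ideal_def by (rule graded_supported)
        show "u \<in> coord_ideal Z" if "?x * u \<in> coord_ideal Z" for u
        proof -
          have "?x * u \<in> coord_ideal Z \<longleftrightarrow> u \<in> coord_ideal Z"
            unfolding variable_def by (rule monom_mult_coord_ideal) (use z in \<open>auto simp: indicator_exp_def\<close>)
          with that show ?thesis by blast
        qed
        have "card (Z - {z}) < card Z" using z by (intro card_Diff1_less) auto
        moreover have "Suc t \<le> card (Z - {z})" using z big by simp
        ultimately show "weakly_regular UNIV (ext_ideal (coord_ideal Z) ?x UNIV) (elem_syms (Suc t))"
          unfolding ext_coord_ideal_variable[OF z] by (rule less.hyps)
      qed (simp_all add: C)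
    qed
  qed
qed simp

text \<open>
  Induction on the number of vectors below \<open>g\<close>. A maximal such vector \<open>a\<close> in \<open>U - V\<close> gives the
  submodule of \<open>I/J\<close> spanned by the fibre of the truncation over \<open>a\<close>. It is a shifted \<open>K[Z]\<close> with \<open>Z\<close>
  the set of coordinates where \<open>a\<close> reaches \<open>g\<close>.
\<close>

lemma weakly_regular_supported:
  fixes U V :: "('n::finite \<Rightarrow> nat) set"
  assumes "up_closed U" "up_closed V" "V \<subseteq> U" "determined g U" "determined g V"
    and "\<And>b. b \<in> U - V \<Longrightarrow> t \<le> card {i. g i \<le> b i}"
  shows "weakly_regular (supported U :: ('n, 'k::comm_ring_1) poly_ring set) (supported V) (elem_syms t)"
  using assms(2,3,5,6)
proof (induction "card {a \<in> U - V. \<forall>i. a i \<le> g i}" arbitrary: V rule: less_induct)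
  case less
  note up = less.prems(1) and VU = less.prems(2) and det = less.prems(3) and big = less.prems(4)
  let ?B = "{a \<in> U - V. \<forall>i. a i \<le> g i}"
  let ?tr = "\<lambda>b i. min (b i) (g i)"
  have fin: "finite ?B" by (rule finite_subset[OF _ finite_below[of g]]) blast
  have tr: "?tr b \<in> ?B" if "b \<in> U - V" for b
    using that determinedD[OF assms(4), of b] determinedD[OF det, of b] by simp
  show ?case
  proof (cases "?B = {}")
    case True
    then have "U = V" using tr VU by blast
    then show ?thesis using weakly_regular_refl[OF subspace_supported[OF assms(1)]] by simp
  next
    case False
    obtain a where a: "a \<in> ?B" and max: "\<And>b. b \<in> ?B \<Longrightarrow> a \<le> b \<Longrightarrow> b = a"
      using finite_has_maximal[OF fin False] by blast
    define Z where "Z = {i. g i \<le> a i}"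
    define W where "W = V \<union> {b. ?tr b = a}"
    have W_iff: "b \<in> W \<longleftrightarrow> b \<in> V \<or> ?tr b = a" for b by (simp add: W_def)
    have agZ: "a i = g i" if "i \<in> Z" for i using that a by (auto simp: Z_def intro: antisym)
    have agN: "a i < g i" if "i \<notin> Z" for i using that by (auto simp: Z_def)
    have tr_le: "?tr b \<le> b" for b by (simp add: le_fun_def)
    have WU: "W \<subseteq> U"
    proof
      fix b assume "b \<in> W"
      then show "b \<in> U"
        using VU a determinedD[OF assms(4), of b] by (auto simp: W_iff)
    qed
    have upW: "up_closed W"
      unfolding up_closed_def
    proof (intro allI impI)
      fix b c :: "'n \<Rightarrow> nat" assume b: "b \<in> W" "b \<le> c"
      show "c \<in> W"
      proof (cases "c \<in> V")
        case False
        then have "b \<notin> V" using up_closedD[OF up] b(2) by blast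
        then have "?tr b = a" using b(1) by (simp add: W_iff)
        then have "a \<le> ?tr c" using b(2) by (auto simp: le_fun_def intro: min.coboundedI1)
        moreover have "c \<in> U - V" using False b WU up_closedD[OF assms(1)] by blast
        ultimately have "?tr c = a" using max tr by blast
        then show ?thesis by (simp add: W_iff)
      qed (simp add: W_iff)
    qed
    have detW: "determined g W"
    proof (rule determinedI)
      fix b
      show "b \<in> W \<longleftrightarrow> ?tr b \<in> W"
        using determinedD[OF det, of b] by (simp add: W_iff)
    qed
    have aV: "a \<notin> V" "a \<in> U" using a by auto
    have trk: "?tr (Poly_Mapping.lookup (expo a + k)) = a \<longleftrightarrow> Poly_Mapping.keys k \<subseteq> Z" for k
    proof
      assume eq: "?tr (Poly_Mapping.lookup (expo a + k)) = a"
      show "Poly_Mapping.keys k \<subseteq> Z"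
      proof
        fix i assume "i \<in> Poly_Mapping.keys k"
        then have "Poly_Mapping.lookup k i > 0" by (simp add: in_keys_iff)
        moreover have "min (a i + Poly_Mapping.lookup k i) (g i) = a i"
          using fun_cong[OF eq, of i] by (simp add: lookup_add)
        ultimately show "i \<in> Z" by (auto simp: Z_def min_def split: if_splits)
      qed
    next
      assume k: "Poly_Mapping.keys k \<subseteq> Z"
      show "?tr (Poly_Mapping.lookup (expo a + k)) = a"
      proof
        fix i
        show "min (Poly_Mapping.lookup (expo a + k) i) (g i) = a i"
        proof (cases "i \<in> Z")
          case False
          then have "Poly_Mapping.lookup k i = 0" using k by (auto simp: in_keys_iff)
          then show ?thesis using agN[OF False] by (simp add: lookup_add)
        qed (simp add: lookup_add agZ)
      qed
    qed
    have out: "Poly_Mapping.lookup (expo a + k) \<in> V \<longleftrightarrow> \<not> Poly_Mapping.keys k \<subseteq> Z" for k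
    proof
      assume "Poly_Mapping.lookup (expo a + k) \<in> V"
      then show "\<not> Poly_Mapping.keys k \<subseteq> Z"
        using trk[of k] determinedD[OF det] aV by metis
    next
      assume nk: "\<not> Poly_Mapping.keys k \<subseteq> Z"
      let ?b = "Poly_Mapping.lookup (expo a + k)"
      have le: "a \<le> ?b" using lookup_le_add[of "expo a" k] by simp
      show "?b \<in> V"
      proof (rule ccontr)
        assume "?b \<notin> V"
        then have "?b \<in> U - V" using le up_closedD[OF assms(1) aV(2)] by blast
        moreover have "a \<le> ?tr ?b" using le a by (auto simp: le_fun_def)
        ultimately have "?tr ?b = a" using max tr by blast
        then show False using nk trk by blast
      qed
    qed
    have not_sub: "(\<exists>i. i \<notin> Z \<and> 0 < Poly_Mapping.lookup k i) \<longleftrightarrow> \<not> Poly_Mapping.keys k \<subseteq> Z"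
      for k :: "'n exps"
      by (auto simp: subset_iff in_keys_iff)
    let ?V = "supported V :: ('n, 'k) poly_ring set" and ?x = "monom (expo a) :: ('n, 'k) poly_ring"
    note sV = subspace_supported[OF up] and C = subspace_coord_ideal and sU = ideal.subspace_UNIV
    have mult: "?x * q \<in> ?V \<longleftrightarrow> q \<in> coord_ideal Z" for q
      using out not_sub by (simp add: supported_def coord_ideal_def keys_monom_mult)
    have eqV: "ext_ideal ?V ?x (coord_ideal Z) = ?V"
      using subset_ext_ideal[OF C] mult
      by (auto elim!: ext_idealE intro: ideal.subspace_add[OF sV])
    have eqW: "ext_ideal ?V ?x UNIV = supported W"
    proof
      have "?x \<in> supported W" using a by (simp add: W_iff fun_eq_iff min_def)
      then have "u * ?x \<in> supported W" for u
        by (rule ideal.subspace_scale[OF subspace_supported[OF upW]])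
      then have "?x * u \<in> supported W" for u by (simp add: mult.commute)
      moreover have "?V \<subseteq> supported W" by (rule supported_mono) (auto simp: W_iff)
      ultimately show "ext_ideal ?V ?x UNIV \<subseteq> supported W"
        by (auto elim!: ext_idealE intro!: ideal.subspace_add[OF subspace_supported[OF upW]])
      show "supported W \<subseteq> ext_ideal ?V ?x UNIV"
      proof (rule supported_subset[OF subspace_ext_ideal[OF sV sU]])
        fix k :: "'n exps" assume "Poly_Mapping.lookup k \<in> W"
        then consider "Poly_Mapping.lookup k \<in> V" | "?tr (Poly_Mapping.lookup k) = a"
          by (auto simp: W_iff)
        then show "monom k \<in> ext_ideal ?V ?x UNIV"
        proof cases
          case 1
          then show ?thesis using subset_ext_ideal[OF sU, of ?V ?x] by auto
        next
          case 2
          then have "Poly_Mapping.lookup (expo a) \<le> Poly_Mapping.lookup k" using tr_le by auto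
          then obtain c where "k = expo a + c" using le_imp_add by blast
          then show ?thesis
            using mult_in_ext_ideal[OF sV, of "monom c" UNIV] by (simp add: monom_add)
        qed
      qed
    qed
    have "t \<le> card Z" using big[of a] a by (simp add: Z_def)
    then have "weakly_regular (ext_ideal ?V ?x UNIV) (ext_ideal ?V ?x (coord_ideal Z)) (elem_syms t)"
      using eqV mult by (intro weakly_regular_transport[OF sU C sV] weakly_regular_coord_ideal) auto
    then have WV: "weakly_regular (supported W) ?V (elem_syms t)" by (simp only: eqV eqW)
    have "{b \<in> U - W. \<forall>i. b i \<le> g i} \<subset> ?B"
    proof (rule psubsetI)
      show "{b \<in> U - W. \<forall>i. b i \<le> g i} \<subseteq> ?B" by (auto simp: W_iff)
      have "a \<in> W" using a by (auto simp: W_iff min_def)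
      then show "{b \<in> U - W. \<forall>i. b i \<le> g i} \<noteq> ?B" using a by blast
    qed
    then have "card {b \<in> U - W. \<forall>i. b i \<le> g i} < card ?B" using fin by (rule psubset_card_mono[rotated])
    then have UW: "weakly_regular (supported U :: ('n, 'k) poly_ring set) (supported W) (elem_syms t)"
      using upW WU detW big by (rule less.hyps) (auto simp: W_iff)
    have VW: "V \<subseteq> W" by (auto simp: W_iff)
    show ?thesis
      by (rule weakly_regular_filtration[OF subspace_supported[OF assms(1)] sV
            subspace_supported[OF upW] supported_mono[OF VW] supported_mono[OF WU] WV UW])
  qed
qed


section \<open>The index and the ranks of exponents\<close>

text \<open>
  Induction on the set of coordinates. Let \<open>B\<close> be a finite set that works without the coordinate \<open>w\<close>.
  It also works for all vectors whose \<open>w\<close>-coordinate is at least the largest one in \<open>B\<close>, and for each of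
  the finitely many smaller values of that coordinate one more finite set is enough.
\<close>

lemma dickson:
  fixes A :: "('n \<Rightarrow> nat) set"
  assumes "finite W"
  shows "\<exists>B. finite B \<and> B \<subseteq> A \<and> (\<forall>a\<in>A. \<exists>b\<in>B. \<forall>i\<in>W. b i \<le> a i)"
  using assms
proof (induction W arbitrary: A)
  case empty
  show ?case
  proof (cases "A = {}")
    case False
    then obtain a where "a \<in> A" by blast
    then show ?thesis by (intro exI[of _ "{a}"]) auto
  qed auto
next
  case (insert w W)
  obtain B where B: "finite B" "B \<subseteq> A" "\<forall>a\<in>A. \<exists>b\<in>B. \<forall>i\<in>W. b i \<le> a i"
    using insert.IH[of A] by (elim exE conjE)
  have "\<forall>k. \<exists>C. finite C \<and> C \<subseteq> {a \<in> A. a w = k} \<and>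
      (\<forall>a\<in>{a \<in> A. a w = k}. \<exists>b\<in>C. \<forall>i\<in>W. b i \<le> a i)"
    by (intro allI insert.IH)
  from choice[OF this] obtain C where C: "\<forall>k. finite (C k) \<and> C k \<subseteq> {a \<in> A. a w = k} \<and>
      (\<forall>a\<in>{a \<in> A. a w = k}. \<exists>b\<in>C k. \<forall>i\<in>W. b i \<le> a i)" by (elim exE)
  define m where "m = Max (insert 0 ((\<lambda>b. b w) ` B))"
  have m: "b w \<le> m" if "b \<in> B" for b using B(1) that by (simp add: m_def)
  let ?B = "B \<union> (\<Union>k<m. C k)"
  have "\<exists>b\<in>?B. \<forall>i\<in>insert w W. b i \<le> a i" if a: "a \<in> A" for a
  proof (cases "a w < m")
    case True
    obtain b where "b \<in> C (a w)" "\<forall>i\<in>W. b i \<le> a i" "b w = a w" using C a by blast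
    then show ?thesis using True by (intro bexI[of _ b]) auto
  next
    case False
    obtain b where "b \<in> B" "\<forall>i\<in>W. b i \<le> a i" using B(3) a by blast
    then show ?thesis using m[of b] False by (intro bexI[of _ b]) auto
  qed
  moreover have "finite ?B" "?B \<subseteq> A" using B C by auto
  ultimately show ?case by blast
qed

lemma monom_dvd_iff_le:
  "(monom a :: ('n::finite, 'k::comm_ring_1) poly_ring) dvd monom b \<longleftrightarrow>
    Poly_Mapping.lookup a \<le> Poly_Mapping.lookup b"
  unfolding monom_dvd_iff using le_imp_add lookup_le_add by metis

lemma lookup_antisym:
  "Poly_Mapping.lookup a \<le> Poly_Mapping.lookup b \<Longrightarrow>
    Poly_Mapping.lookup b \<le> Poly_Mapping.lookup (a :: 'n exps) \<Longrightarrow> a = b"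
  by (intro poly_mapping_eqI) (auto simp: le_fun_def intro: antisym)

lemma min_gens_antichain:
  fixes I :: "('n::finite, 'k::comm_ring_1) poly_ring set"
  assumes "a \<in> min_gens I" "b \<in> min_gens I" "Poly_Mapping.lookup a \<le> Poly_Mapping.lookup b"
  shows "a = b"
  using min_gensD(2)[OF assms(2) min_gensD(1)[OF assms(1)]] assms(3) by (simp add: monom_dvd_iff_le)

lemma finite_min_gens: "finite (min_gens (I :: ('n::finite, 'k::comm_ring_1) poly_ring set))"
proof -
  have fin: "finite (UNIV :: 'n set)" by simp
  from dickson[OF fin, of "Poly_Mapping.lookup ` min_gens I"]
  obtain B where B: "finite B" "B \<subseteq> Poly_Mapping.lookup ` min_gens I"
    "\<forall>a\<in>Poly_Mapping.lookup ` min_gens I. \<exists>b\<in>B. \<forall>i\<in>UNIV. b i \<le> a i" by blast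
  have "min_gens I \<subseteq> expo ` B"
  proof
    fix a assume a: "a \<in> min_gens I"
    then obtain b where b: "b \<in> B" "b \<le> Poly_Mapping.lookup a"
      using B(3) by (auto simp: le_fun_def)
    then obtain c where "c \<in> min_gens I" "b = Poly_Mapping.lookup c" using B(2) by blast
    then have "c = a" using min_gens_antichain[OF _ a] b(2) by blast
    then show "a \<in> expo ` B" using b(1) \<open>b = _\<close> by (intro image_eqI[of _ _ b]) auto
  qed
  then show ?thesis using B(1) finite_subset by blast
qed

lemma min_gens_span:
  fixes G :: "'n::finite exps set"
  assumes "\<And>a b. a \<in> G \<Longrightarrow> b \<in> G \<Longrightarrow> Poly_Mapping.lookup a \<le> Poly_Mapping.lookup b \<Longrightarrow> a = b"
  shows "min_gens (ideal.span (monom ` G) :: ('n, 'k::comm_ring_1) poly_ring set) = G"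
proof
  show "min_gens (ideal.span (monom ` G) :: ('n, 'k) poly_ring set) \<subseteq> G"
    by (rule min_gens_least[OF refl])
  show "G \<subseteq> min_gens (ideal.span (monom ` G) :: ('n, 'k) poly_ring set)"
  proof
    fix a assume a: "a \<in> G"
    show "a \<in> min_gens (ideal.span (monom ` G) :: ('n, 'k) poly_ring set)"
    proof (rule min_gensI)
      show "(monom a :: ('n, 'k) poly_ring) \<in> ideal.span (monom ` G)"
        using a by (intro ideal.span_base imageI)
      fix b assume b: "(monom b :: ('n, 'k) poly_ring) \<in> ideal.span (monom ` G)"
        "(monom b :: ('n, 'k) poly_ring) dvd monom a"
      have "\<exists>c\<in>G. \<exists>d. b = c + d" by (rule in_span_monom_keys[OF b(1)]) simp
      then obtain c where c: "c \<in> G" "Poly_Mapping.lookup c \<le> Poly_Mapping.lookup b"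
        using lookup_le_add by blast
      have ba: "Poly_Mapping.lookup b \<le> Poly_Mapping.lookup a" using b(2) by (simp add: monom_dvd_iff_le)
      then have "c = a" using assms[OF c(1) a] c(2) by (meson order_trans)
      then show "b = a" using c(2) ba lookup_antisym by blast
    qed
  qed
qed

definition rank :: "nat set \<Rightarrow> nat \<Rightarrow> nat" where
  "rank E x = card {k \<in> E. k \<le> x}"

lemma rank_mono: "finite E \<Longrightarrow> x \<le> y \<Longrightarrow> rank E x \<le> rank E y"
  unfolding rank_def by (intro card_mono) auto

lemma le_of_rank_le:
  assumes "finite E" "x \<in> E \<or> x = 0" "rank E x \<le> rank E y"
  shows "x \<le> y"
proof (rule ccontr)
  assume "\<not> x \<le> y"
  then have "{k \<in> E. k \<le> y} \<subset> {k \<in> E. k \<le> x}" using assms(2) by auto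
  then have "rank E y < rank E x" unfolding rank_def using assms(1) by (intro psubset_card_mono) auto
  with assms(3) show False by simp
qed

text \<open>
  The effect on generators of passing to the canonical form in the variables of \<open>X\<close>, with \<open>E i\<close> the
  set of exponents of \<open>x\<^sub>i\<close> in the original generators.
\<close>

definition rank_exps :: "('n \<Rightarrow> nat set) \<Rightarrow> 'n set \<Rightarrow> 'n::finite exps \<Rightarrow> 'n exps" where
  "rank_exps E X a =
    expo (\<lambda>i. if i \<in> X then rank (E i) (Poly_Mapping.lookup a i) else Poly_Mapping.lookup a i)"

lemma finite_pos_exps: "finite (pos_exps I (J :: ('n::finite, 'k::comm_ring_1) poly_ring set) i)"
proof -
  have "pos_exps I J i \<subseteq> (\<lambda>a. Poly_Mapping.lookup a i) ` (min_gens I \<union> min_gens J)"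
    by (auto simp: pos_exps_def)
  then show ?thesis by (rule finite_subset) (simp add: finite_min_gens)
qed

lemma lookup_in_pos_exps:
  "a \<in> min_gens I \<union> min_gens J \<Longrightarrow>
    Poly_Mapping.lookup a i \<in> pos_exps I J i \<or> Poly_Mapping.lookup a i = 0"
  by (auto simp: pos_exps_def Suc_le_eq)

text \<open>
  On the exponents that occur, the rank is strictly increasing. So the new generators are again
  pairwise incomparable, and none of them becomes redundant.
\<close>

lemma min_gens_rank_exps:
  fixes I J :: "('n::finite, 'k::comm_ring_1) poly_ring set"
  assumes "M \<in> {I, J}"
  shows "min_gens (ideal.span (monom ` rank_exps (pos_exps I J) X ` min_gens M)
      :: ('n, 'k) poly_ring set) = rank_exps (pos_exps I J) X ` min_gens M"
proof (rule min_gens_span)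
  fix a' b'
  assume *: "a' \<in> rank_exps (pos_exps I J) X ` min_gens M"
    "b' \<in> rank_exps (pos_exps I J) X ` min_gens M"
    "Poly_Mapping.lookup a' \<le> Poly_Mapping.lookup b'"
  then obtain a b where ab: "a \<in> min_gens M" "b \<in> min_gens M"
    "a' = rank_exps (pos_exps I J) X a" "b' = rank_exps (pos_exps I J) X b" by blast
  have "Poly_Mapping.lookup a i \<le> Poly_Mapping.lookup b i" for i
  proof (cases "i \<in> X")
    case True
    have "rank (pos_exps I J i) (Poly_Mapping.lookup a i) \<le> rank (pos_exps I J i) (Poly_Mapping.lookup b i)"
      using le_funD[OF *(3), of i] True by (simp add: ab rank_exps_def)
    moreover have "a \<in> min_gens I \<union> min_gens J" using ab(1) assms by auto
    ultimately show ?thesis using le_of_rank_le[OF finite_pos_exps lookup_in_pos_exps] by blast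
  next
    case False
    then show ?thesis using le_funD[OF *(3), of i] by (simp add: ab rank_exps_def)
  qed
  then have "a = b" by (intro min_gens_antichain[OF ab(1,2)]) (simp add: le_fun_def)
  then show "a' = b'" by (simp add: ab)
qed

text \<open>
  Treating one variable leaves the exponents of the others unchanged, so each step may use the sets
  of exponents of the original pair of ideals.
\<close>

lemma min_gens_fold_canonical_var:
  fixes I J :: "('n::{finite,linorder}, 'k::comm_ring_1) poly_ring set"
  assumes "distinct xs"
  shows "min_gens (fst (fold canonical_var xs (I, J))) = rank_exps (pos_exps I J) (set xs) ` min_gens I \<and>
    min_gens (snd (fold canonical_var xs (I, J))) = rank_exps (pos_exps I J) (set xs) ` min_gens J"
  using assms
proof (induction xs rule: rev_induct)
  case Nil
  have "rank_exps (pos_exps I J) {} a = a" for a by (simp add: rank_exps_def)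
  then show ?case by simp
next
  case (snoc x xs)
  let ?E = "pos_exps I J"
  let ?R = "rank_exps ?E (set xs)" and ?R' = "rank_exps ?E (set (xs @ [x]))"
  obtain I' J' where C: "fold canonical_var xs (I, J) = (I', J')" by fastforce
  have mins: "min_gens I' = ?R ` min_gens I" "min_gens J' = ?R ` min_gens J"
    using snoc by (simp_all add: C)
  have "x \<notin> set xs" using snoc.prems by simp
  then have "Poly_Mapping.lookup (?R a) x = Poly_Mapping.lookup a x" for a
    by (simp add: rank_exps_def)
  then have E: "pos_exps I' J' x = ?E x" by (auto simp: pos_exps_def mins)
  have R: "relabel (?E x) x ` ?R ` A = ?R' ` A" for A
  proof -
    have "relabel (?E x) x (?R a) = ?R' a" for a
      using \<open>x \<notin> set xs\<close>
      by (intro poly_mapping_eqI) (auto simp: relabel_def rank_exps_def lookup_update rank_def)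
    then show ?thesis by (simp add: image_image)
  qed
  have "fold canonical_var (xs @ [x]) (I, J) =
      (ideal.span (monom ` ?R' ` min_gens I), ideal.span (monom ` ?R' ` min_gens J))"
    by (simp only: fold_append comp_apply fold.simps id_apply C canonical_var_def prod.case E mins R)
  then show ?case using min_gens_rank_exps[of I I J] min_gens_rank_exps[of J I J] by simp
qed

text \<open>
  The sum on the right is at least the degree of some generator of the canonical form of \<open>I\<close>, hence
  at least \<open>d\<close>. The sum on the left is at most \<open>e\<close>, since the largest exponent of a variable in the
  canonical form is at least the number of its exponents. For index \<open>0\<close> the difference \<open>d - e\<close> may
  be negative, and then nothing follows.
\<close>

lemma index_le_ranks:
  fixes I J :: "('n::{finite,linorder}, 'k::comm_ring_1) poly_ring set"
  assumes "monomial_ideal I" "index I J > 0" "b \<in> exponents I"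
  shows "index I J + (\<Sum>i\<in>UNIV. card (pos_exps I J i) - 1) \<le> (\<Sum>i\<in>UNIV. rank (pos_exps I J i) (b i))"
proof -
  let ?E = "pos_exps I J" and ?R = "rank_exps (pos_exps I J) UNIV"
  obtain I' J' where C: "canonical_form I J = (I', J')" by fastforce
  have mins: "min_gens I' = ?R ` min_gens I" "min_gens J' = ?R ` min_gens J"
    using min_gens_fold_canonical_var[of "sorted_list_of_set UNIV" I J] C
    by (simp_all add: canonical_form_def)
  obtain a where a: "a \<in> min_gens I" "Poly_Mapping.lookup a \<le> b"
    using assms(3) exponents_iff_min_gens[OF assms(1)] by blast
  have "d_inv I' J' \<le> mdeg (?R a)"
    unfolding d_inv_def using a by (intro Min_le) (auto simp: mins finite_min_gens)
  also have "\<dots> = (\<Sum>i\<in>UNIV. rank (?E i) (Poly_Mapping.lookup a i))"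
    by (simp add: mdeg_def rank_exps_def)
  also have "\<dots> \<le> (\<Sum>i\<in>UNIV. rank (?E i) (b i))"
    using a(2) by (intro sum_mono rank_mono finite_pos_exps) (auto simp: le_fun_def)
  finally have d: "d_inv I' J' \<le> (\<Sum>i\<in>UNIV. rank (?E i) (b i))" .
  have e: "card (?E i) \<le> e_var I' J' i" for i
  proof (cases "?E i = {}")
    case False
    let ?m = "Max (?E i)"
    have "?m \<in> ?E i" using False finite_pos_exps by (rule Max_in[rotated])
    then obtain a where a: "a \<in> min_gens I \<union> min_gens J" "Poly_Mapping.lookup a i = ?m"
      by (auto simp: pos_exps_def)
    have "{k \<in> ?E i. k \<le> ?m} = ?E i" using Max_ge[OF finite_pos_exps] by blast
    then have "card (?E i) = Poly_Mapping.lookup (?R a) i"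
      by (simp add: rank_exps_def a(2) rank_def)
    also have "\<dots> \<le> e_var I' J' i"
      unfolding e_var_def using a(1) by (intro Max_ge) (auto simp: mins finite_min_gens)
    finally show ?thesis .
  qed simp
  have "(\<Sum>i\<in>UNIV. card (?E i) - 1) \<le> (\<Sum>i\<in>UNIV. e_var I' J' i - 1)"
    using e by (intro sum_mono diff_le_mono)
  also have "\<dots> = e_inv I' J'"
    unfolding e_inv_def by (rule sum.mono_neutral_right) auto
  finally have "(\<Sum>i\<in>UNIV. card (?E i) - 1) \<le> e_inv I' J'" .
  moreover have "index I J = nat (max (int (d_inv I' J') - int (e_inv I' J')) 0)"
    by (simp add: index_def C)
  ultimately show ?thesis using d assms(2) by linarith
qed


section \<open>Linear independence and matchings\<close>

text \<open>
  A nonsingular maximal minor has a nonzero term in its expansion; this is the same argument without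
  determinants. It suffices to find a column \<open>y\<close> with \<open>v z y \<noteq> 0\<close> such that the rows other than \<open>z\<close> stay
  independent when the column \<open>y\<close> is deleted. If there were none, then for each \<open>y\<close> in the support
  of the row \<open>z\<close> the unit vector of \<open>y\<close> would be a combination of the other rows, and so the row \<open>z\<close>
  would be one as well.
\<close>

lemma independent_rows_matching:
  fixes v :: "'x \<Rightarrow> 'y \<Rightarrow> 'k::field"
  assumes "finite X" "finite Y"
    and "\<And>c. (\<And>y. y \<in> Y \<Longrightarrow> (\<Sum>x\<in>X. c x * v x y) = 0) \<Longrightarrow> \<forall>x\<in>X. c x = 0"
  shows "\<exists>m. inj_on m X \<and> (\<forall>x\<in>X. m x \<in> Y \<and> v x (m x) \<noteq> 0)"
  using assms
proof (induction X arbitrary: Y)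
  case (insert z X)
  note indep = insert.prems(2)
  let ?S = "{y \<in> Y. v z y \<noteq> 0}"
  let ?ind = "\<lambda>y. \<forall>c. (\<forall>y'\<in>Y - {y}. (\<Sum>x\<in>X. c x * v x y') = 0) \<longrightarrow> (\<forall>x\<in>X. c x = 0)"
  have "\<exists>y\<in>?S. ?ind y"
  proof (rule ccontr)
    assume "\<not> (\<exists>y\<in>?S. ?ind y)"
    then have "\<forall>y\<in>?S. \<exists>c. (\<forall>y'\<in>Y - {y}. (\<Sum>x\<in>X. c x * v x y') = 0) \<and> (\<exists>x\<in>X. c x \<noteq> 0)"
      by blast
    from bchoice[OF this] obtain C where C: "\<forall>y\<in>?S.
        (\<forall>y'\<in>Y - {y}. (\<Sum>x\<in>X. C y x * v x y') = 0) \<and> (\<exists>x\<in>X. C y x \<noteq> 0)"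
      by (elim exE)
    have C1: "(\<Sum>x\<in>X. C y x * v x y') = 0" if "y \<in> ?S" "y' \<in> Y - {y}" for y y'
      using bspec[OF conjunct1[OF bspec[OF C that(1)]] that(2)] .
    have C2: "\<exists>x\<in>X. C y x \<noteq> 0" if "y \<in> ?S" for y
      using conjunct2[OF bspec[OF C that]] .
    \<comment> \<open>The combination \<open>C y\<close> of the other rows is \<open>d y\<close> times the unit vector of \<open>y\<close>.\<close>
    define d where "d y = (\<Sum>x\<in>X. C y x * v x y)" for y
    have d: "d y \<noteq> 0" if y: "y \<in> ?S" for y
    proof
      assume d0: "d y = 0"
      let ?c = "(C y)(z := 0)"
      have "\<forall>x\<in>insert z X. ?c x = 0"
      proof (rule indep[of ?c])
        fix y' assume y': "y' \<in> Y"
        have "(\<Sum>x\<in>insert z X. ?c x * v x y') = (\<Sum>x\<in>X. ?c x * v x y')"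
          by (simp only: sum.insert[OF insert.hyps(1,2)] fun_upd_same mult_zero_left add_0_left)
        also have "\<dots> = (\<Sum>x\<in>X. C y x * v x y')"
          using insert.hyps by (intro sum.cong) auto
        also have "\<dots> = 0" using C1[OF y, of y'] y' d0 by (cases "y' = y") (auto simp: d_def)
        finally show "(\<Sum>x\<in>insert z X. ?c x * v x y') = 0" .
      qed
      then show False using C2[OF y] insert.hyps by (auto split: if_splits)
    qed
    define c where "c x = (if x = z then -1 else (\<Sum>y\<in>?S. v z y / d y * C y x))" for x
    have "\<forall>x\<in>insert z X. c x = 0"
    proof (rule indep[of c])
      fix y' assume y': "y' \<in> Y"
      have "(\<Sum>x\<in>X. c x * v x y') = (\<Sum>x\<in>X. \<Sum>y\<in>?S. v z y / d y * (C y x * v x y'))"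
        unfolding c_def using insert.hyps
        by (intro sum.cong) (auto simp: sum_distrib_right mult.assoc)
      also have "\<dots> = (\<Sum>y\<in>?S. v z y / d y * (\<Sum>x\<in>X. C y x * v x y'))"
        by (subst sum.swap) (simp add: sum_distrib_left)
      also have "\<dots> = (\<Sum>y\<in>?S. if y = y' then v z y' else 0)"
      proof (intro sum.cong refl)
        fix y assume y: "y \<in> ?S"
        show "v z y / d y * (\<Sum>x\<in>X. C y x * v x y') = (if y = y' then v z y' else 0)"
        proof (cases "y = y'")
          case True
          then show ?thesis using d[OF y] by (simp add: d_def)
        next
          case False
          then show ?thesis using C1[OF y, of y'] y' by simp
        qed
      qed
      also have "\<dots> = v z y'" using insert.prems(1) y' by auto
      finally show "(\<Sum>x\<in>insert z X. c x * v x y') = 0"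
        using insert.hyps by (simp add: c_def)
    qed
    then show False by (simp add: c_def)
  qed
  then obtain y where y: "y \<in> Y" "v z y \<noteq> 0" "?ind y" by blast
  have "\<exists>m. inj_on m X \<and> (\<forall>x\<in>X. m x \<in> Y - {y} \<and> v x (m x) \<noteq> 0)"
    using insert.prems(1) y(3) by (intro insert.IH) auto
  then obtain m where m: "inj_on m X" "\<forall>x\<in>X. m x \<in> Y - {y} \<and> v x (m x) \<noteq> 0" by blast
  have "inj_on (m(z := y)) (insert z X)"
    using m insert.hyps by (auto simp: inj_on_def)
  moreover have "\<forall>x\<in>insert z X. (m(z := y)) x \<in> Y \<and> v x ((m(z := y)) x) \<noteq> 0"
    using m(2) y(1,2) insert.hyps by auto
  ultimately show ?case by (intro exI[of _ "m(z := y)"] conjI)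
qed simp


section \<open>Vectors with the fewest saturated coordinates\<close>

text \<open>
  The situation of two monomial ideals, seen through the sets \<open>E i\<close> of positive exponents of their
  generators: membership of \<open>b\<close> depends only on which elements of \<open>E i\<close> are at most \<open>b i\<close>.
\<close>

locale exponent_levels =
  fixes E :: "'n::{finite,linorder} \<Rightarrow> nat set" and U V :: "('n \<Rightarrow> nat) set"
  assumes finite_E: "finite (E i)" and E_pos: "k \<in> E i \<Longrightarrow> k > 0"
    and up_U: "up_closed U" and up_V: "up_closed V"
    and levels_U: "(\<And>i k. k \<in> E i \<Longrightarrow> k \<le> b i \<longleftrightarrow> k \<le> c i) \<Longrightarrow> b \<in> U \<longleftrightarrow> c \<in> U"
    and levels_V: "(\<And>i k. k \<in> E i \<Longrightarrow> k \<le> b i \<longleftrightarrow> k \<le> c i) \<Longrightarrow> b \<in> V \<longleftrightarrow> c \<in> V"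
begin

definition top :: "'n \<Rightarrow> nat" where
  "top i = Max (insert 0 (E i))"

text \<open>
  The start of the last level below \<open>top i\<close>: the largest element of \<open>E i\<close> other than \<open>top i\<close>, or
  \<open>0\<close> if there is none.
\<close>

definition pretop :: "'n \<Rightarrow> nat" where
  "pretop i = Max (insert 0 (E i - {top i}))"

definition sat :: "('n \<Rightarrow> nat) \<Rightarrow> 'n set" where
  "sat b = {i. top i \<le> b i}"

text \<open>
  If \<open>top i > 0\<close> for all \<open>i\<close>, then \<open>corner S\<close> has \<open>S\<close> as its set of saturated coordinates and is on the
  last level below \<open>top\<close> elsewhere. The value \<open>top i - 1\<close> is chosen because of the Koszul complex: the
  monomial of \<open>top\<close> is that of \<open>corner S\<close> times the product of the \<open>x\<^sub>i\<close> with \<open>i \<notin> S\<close>.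
\<close>

definition corner :: "'n set \<Rightarrow> 'n \<Rightarrow> nat" where
  "corner S i = (if i \<in> S then top i else top i - 1)"

lemma le_top: "k \<in> E i \<Longrightarrow> k \<le> top i"
  unfolding top_def using finite_E by (intro Max_ge) auto

lemma top_in: "E i \<noteq> {} \<Longrightarrow> top i \<in> E i"
  using Max_in[OF finite_E, of i] finite_E[of i] by (simp add: top_def)

lemma le_pretop: "k \<in> E i \<Longrightarrow> k < top i \<Longrightarrow> k \<le> pretop i"
  unfolding pretop_def using finite_E by (intro Max_ge) auto

lemma pretop_in: "pretop i = 0 \<or> pretop i \<in> E i - {top i}"
proof -
  have "pretop i \<in> insert 0 (E i - {top i})"
    unfolding pretop_def using finite_E by (intro Max_in) auto
  then show ?thesis by blast
qed

lemma pretop_le_top: "pretop i \<le> top i"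
  using pretop_in[of i] le_top[of "pretop i" i] by auto

lemma determined_U: "determined top U"
  by (intro determinedI levels_U) (simp add: le_top)

lemma determined_V: "determined top V"
  by (intro determinedI levels_V) (simp add: le_top)

lemma determined_diff: "determined top (U - V)"
proof (rule determinedI)
  fix b
  show "b \<in> U - V \<longleftrightarrow> (\<lambda>i. min (b i) (top i)) \<in> U - V"
    using determinedD[OF determined_U, of b] determinedD[OF determined_V, of b] by simp
qed

lemma rank_le: "rank (E i) x \<le> card (E i)"
  unfolding rank_def using finite_E by (intro card_mono) auto

lemma rank_less_top:
  assumes "x < top i"
  shows "E i \<noteq> {}" "rank (E i) x \<le> card (E i) - 1"
proof -
  show ne: "E i \<noteq> {}" using assms by (auto simp: top_def)
  have "{k \<in> E i. k \<le> x} \<subseteq> E i - {top i}" using assms by auto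
  then have "rank (E i) x \<le> card (E i - {top i})"
    unfolding rank_def using finite_E by (intro card_mono) auto
  then show "rank (E i) x \<le> card (E i) - 1" using top_in[OF ne] by simp
qed

lemma rank_less_pretop:
  assumes "x < pretop i"
  shows "rank (E i) x < card (E i) - 1"
proof -
  have p: "pretop i \<in> E i" "pretop i \<noteq> top i" using pretop_in[of i] assms by auto
  then have t: "top i \<in> E i" using top_in by blast
  have "x < top i" using assms pretop_le_top[of i] by simp
  then have "{k \<in> E i. k \<le> x} \<subseteq> E i - {top i} - {pretop i}" using assms by auto
  then have "{k \<in> E i. k \<le> x} \<subset> E i - {top i}" using p by blast
  then have "rank (E i) x < card (E i - {top i})"
    unfolding rank_def using finite_E by (intro psubset_card_mono) auto
  then show ?thesis using t by simp
qed

text \<open>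
  The rank of \<open>b i\<close> in \<open>E i\<close> is at most \<open>card (E i)\<close>, and at most \<open>card (E i) - 1\<close> if \<open>i\<close> is not
  saturated. Summation gives the first claim. In the case of equality all these bounds are attained,
  so there are no empty \<open>E i\<close> (where a saturated coordinate has rank \<open>0\<close>) and no coordinate is below
  the last level.
\<close>

lemma card_sat_ge:
  assumes "t + (\<Sum>i\<in>UNIV. card (E i) - 1) \<le> (\<Sum>i\<in>UNIV. rank (E i) (b i))"
  shows "t \<le> card (sat b)"
    and "card (sat b) = t \<Longrightarrow> E i \<noteq> {} \<and> pretop i \<le> b i"
proof -
  define h where "h i = (card (E i) - 1) + (if i \<in> sat b then 1 else 0)" for i
  have le: "rank (E i) (b i) \<le> h i" for i
    using rank_le[of i "b i"] rank_less_top(2)[of "b i" i] by (auto simp: h_def sat_def)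
  have sum: "(\<Sum>i\<in>UNIV. h i) = (\<Sum>i\<in>UNIV. card (E i) - 1) + card (sat b)"
    by (simp add: h_def sum.distrib sum.If_cases)
  have mono: "(\<Sum>i\<in>UNIV. rank (E i) (b i)) \<le> (\<Sum>i\<in>UNIV. h i)" by (intro sum_mono le)
  show "t \<le> card (sat b)" using assms sum mono by linarith
  assume "card (sat b) = t"
  then have "(\<Sum>i\<in>UNIV. rank (E i) (b i)) = (\<Sum>i\<in>UNIV. h i)"
    using assms sum mono by linarith
  then have eq: "rank (E i) (b i) = h i" by (rule sum_mono_inv) (use le in auto)
  show "E i \<noteq> {} \<and> pretop i \<le> b i"
  proof (intro conjI notI)
    assume "E i = {}"
    then show False using eq by (simp add: rank_def h_def sat_def top_def)
  next
    show "pretop i \<le> b i"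
    proof (rule ccontr)
      assume "\<not> pretop i \<le> b i"
      then have "rank (E i) (b i) < card (E i) - 1" by (intro rank_less_pretop) simp
      then show False using eq by (simp add: h_def)
    qed
  qed
qed

lemma corner_class:
  assumes "\<And>i. pretop i \<le> b i" "sat b = S"
  shows "b \<in> U - V \<longleftrightarrow> corner S \<in> U - V"
proof -
  have "k \<le> b i \<longleftrightarrow> k \<le> corner S i" if k: "k \<in> E i" for i k
  proof (cases "i \<in> S")
    case True
    then show ?thesis using assms(2) le_top[OF k] by (auto simp: corner_def sat_def)
  next
    case False
    then have "b i < top i" using assms(2) by (auto simp: sat_def)
    moreover have "k \<le> top i - 1 \<longleftrightarrow> k < top i" using \<open>b i < top i\<close> by linarith
    ultimately show ?thesis
      using False le_pretop[OF k] assms(1)[of i] by (auto simp: corner_def)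
  qed
  then show ?thesis using levels_U[of b "corner S"] levels_V[of b "corner S"] by blast
qed

text \<open>
  Cutting \<open>U - V\<close> into the fibres of the truncation at \<open>top\<close> fails only at the vectors with
  exactly \<open>t\<close> saturated coordinates. Such a vector belongs to the class of some \<open>S \<in> X\<close>. The
  union of the classes of \<open>S\<close> and of \<open>m S = S \<union> {j}\<close> is a block in which only \<open>pretop j\<close> bounds the
  coordinate \<open>j\<close>, from below. After lowering the bound for \<open>j\<close> to \<open>pretop j\<close>, every vector of the block
  reaches the bound in all coordinates of \<open>S \<union> {j}\<close>.
\<close>

lemma partitionable_of_matching:
  assumes sat_ge: "\<And>b. b \<in> U - V \<Longrightarrow> t \<le> card (sat b)"
    and sat_eq: "\<And>b i. b \<in> U - V \<Longrightarrow> card (sat b) = t \<Longrightarrow> pretop i \<le> b i"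
    and X: "X = {S. card S = t \<and> corner S \<in> U - V}"
    and inj: "inj_on m X"
    and m: "\<And>S. S \<in> X \<Longrightarrow> corner (m S) \<in> U - V \<and> (\<exists>i. i \<notin> S \<and> m S = insert i S)"
  shows "partitionable (Suc t) (U - V)"
proof -
  define block where "block S = {b. (\<forall>i. pretop i \<le> b i) \<and> (\<forall>i\<in>S. top i \<le> b i) \<and>
      (\<forall>i. i \<notin> m S \<longrightarrow> b i < top i)}" for S
  have block_sat: "sat b = S \<or> sat b = m S" if b: "b \<in> block S" and S: "S \<in> X" for b S
  proof -
    obtain j where j: "j \<notin> S" "m S = insert j S" using m[OF S] by blast
    have "S \<subseteq> sat b" "sat b \<subseteq> m S" using b by (auto simp: block_def sat_def not_less[symmetric])
    then show ?thesis using j by (cases "j \<in> sat b") auto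
  qed
  have block_UV: "block S \<subseteq> U - V" if S: "S \<in> X" for S
  proof
    fix b assume b: "b \<in> block S"
    then have "\<And>i. pretop i \<le> b i" by (simp add: block_def)
    then have "b \<in> U - V \<longleftrightarrow> corner (sat b) \<in> U - V" by (rule corner_class) simp
    moreover have "corner (sat b) \<in> U - V" using block_sat[OF b S] m[OF S] S X by auto
    ultimately show "b \<in> U - V" by blast
  qed
  have part_block: "partitionable (Suc t) (block S)" if S: "S \<in> X" for S
  proof -
    obtain j where j: "j \<notin> S" "m S = insert j S" using m[OF S] by blast
    show ?thesis
    proof (rule partitionable_determined)
      show "determined (top(j := pretop j)) (block S)"
      proof (rule determinedI)
        fix b :: "'n \<Rightarrow> nat"
        let ?b = "\<lambda>i. min (b i) ((top(j := pretop j)) i)"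
        have 1: "(\<forall>i. pretop i \<le> b i) \<longleftrightarrow> (\<forall>i. pretop i \<le> ?b i)"
          by (intro all_cong1) (simp add: pretop_le_top)
        have 2: "(\<forall>i\<in>S. top i \<le> b i) \<longleftrightarrow> (\<forall>i\<in>S. top i \<le> ?b i)"
          using j by (intro ball_cong refl) (auto simp: fun_upd_apply)
        have 3: "(\<forall>i. i \<notin> m S \<longrightarrow> b i < top i) \<longleftrightarrow> (\<forall>i. i \<notin> m S \<longrightarrow> ?b i < top i)"
          using j by (intro all_cong1 imp_cong refl) (simp add: min_less_iff_disj)
        show "b \<in> block S \<longleftrightarrow> ?b \<in> block S"
          unfolding block_def mem_Collect_eq using 1 2 3 by (intro conj_cong)
      qed
      fix b assume "b \<in> block S"
      then have "m S \<subseteq> {i. (top(j := pretop j)) i \<le> b i}" using j by (auto simp: block_def)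
      then have "card (m S) \<le> card {i. (top(j := pretop j)) i \<le> b i}" by (intro card_mono) auto
      then show "Suc t \<le> card {i. (top(j := pretop j)) i \<le> b i}" using j S X by simp
    qed
  qed
  have disj: "block S \<inter> block S' = {}" if S: "S \<in> X" "S' \<in> X" "S \<noteq> S'" for S S'
  proof (rule ccontr)
    assume "block S \<inter> block S' \<noteq> {}"
    then obtain b where "b \<in> block S" "b \<in> block S'" by blast
    then have "sat b = S \<or> sat b = m S" "sat b = S' \<or> sat b = m S'"
      using block_sat S by blast+
    moreover have "card (m S'') = Suc t \<and> card S'' = t" if S'': "S'' \<in> X" for S''
      using m[OF S''] S'' X by auto
    ultimately have "m S = m S'" using S by (metis n_not_Suc_n)
    then show False using inj S by (auto dest: inj_onD)
  qed
  have fin: "finite X" by simp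
  have part_blocks: "partitionable (Suc t) (\<Union>S\<in>X. block S)"
    by (rule partitionable_UN[OF fin part_block disj])
  define rest where "rest = U - V - (\<Union>S\<in>X. block S)"
  have "determined top rest"
  proof (rule determinedI)
    fix b :: "'n \<Rightarrow> nat"
    let ?b = "\<lambda>i. min (b i) (top i)"
    have "b \<in> block S \<longleftrightarrow> ?b \<in> block S" for S
      by (simp add: block_def pretop_le_top min_less_iff_disj)
    moreover have "b \<in> U - V \<longleftrightarrow> ?b \<in> U - V" by (rule determinedD[OF determined_diff])
    ultimately show "b \<in> rest \<longleftrightarrow> ?b \<in> rest" by (auto simp: rest_def)
  qed
  moreover have "Suc t \<le> card {i. top i \<le> b i}" if b: "b \<in> rest" for b
  proof -
    have bUV: "b \<in> U - V" using b by (simp add: rest_def)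
    have "card (sat b) \<noteq> t"
    proof
      assume eq: "card (sat b) = t"
      then have pre: "\<And>i. pretop i \<le> b i" using sat_eq[OF bUV] by blast
      then have "corner (sat b) \<in> U - V" using corner_class[OF pre refl] bUV by blast
      then have SX: "sat b \<in> X" using eq X by blast
      have "b \<in> block (sat b)"
        using pre m[OF SX] by (auto simp: block_def sat_def not_le[symmetric])
      then show False using b SX by (auto simp: rest_def)
    qed
    then show ?thesis using sat_ge[OF bUV] by (simp add: sat_def)
  qed
  ultimately have "partitionable (Suc t) rest" by (rule partitionable_determined)
  then have "partitionable (Suc t) (rest \<union> (\<Union>S\<in>X. block S))"
    using part_blocks by (rule partitionable_Un) (auto simp: rest_def)
  moreover have "rest \<union> (\<Union>S\<in>X. block S) = U - V" using block_UV by (auto simp: rest_def)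
  ultimately show ?thesis by simp
qed

end

lemma koszul_sign_mult_single:
  "koszul_sign i T * (Poly_Mapping.single k c :: ('n, 'k::comm_ring_1) poly_ring)
    = Poly_Mapping.single k (koszul_sign i T * c)"
  by (cases "even (card {k \<in> T. k < i})") (simp_all add: koszul_sign_def single_uminus)

context exponent_levels
begin

text \<open>
  In multidegree \<open>top\<close> the coefficient of \<open>e\<^sub>T\<close> in a Koszul chain is a multiple of the monomial with
  exponent \<open>corner (- T)\<close>. So the relation between the corners with \<open>t\<close> saturated coordinates is a
  cycle of degree \<open>n - t\<close>. It is not a boundary: chains of degree \<open>n - t + 1\<close> in this multidegree involve
  corners with \<open>t - 1\<close> saturated coordinates, and none of these is in \<open>U - V\<close>.
\<close>

lemma koszul_homology_nonzero_of_relation: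
  fixes c :: "'n set \<Rightarrow> 'k::field"
  assumes sat_ge: "\<And>b. b \<in> U - V \<Longrightarrow> t \<le> card (sat b)"
    and E_nonempty: "\<And>i. E i \<noteq> {}"
    and X: "X = {S. card S = t \<and> corner S \<in> U - V}"
    and rel: "\<And>S. card S = Suc t \<Longrightarrow> corner S \<in> U - V \<Longrightarrow>
      (\<Sum>i\<in>S. koszul_sign i (- S) * (if S - {i} \<in> X then c (S - {i}) else 0)) = 0"
    and nz: "S0 \<in> X" "c S0 \<noteq> 0"
  shows "koszul_homology_nonzero variable (card (UNIV :: 'n set) - t)
    (supported U :: ('n, 'k) poly_ring set) (supported V)"
proof -
  let ?N = "supported U :: ('n, 'k) poly_ring set" and ?P = "supported V :: ('n, 'k) poly_ring set"
  note sU = subspace_supported[OF up_U] and sV = subspace_supported[OF up_V]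
  have top_pos: "top i > 0" for i using top_in[OF E_nonempty] E_pos by blast
  have sat_corner: "sat (corner S) = S" for S
  proof -
    have "\<not> top i \<le> top i - 1" for i using top_pos[of i] by simp
    then show ?thesis by (auto simp: sat_def corner_def split: if_splits)
  qed
  have corner_step: "expo (indicator_exp {i}) + expo (corner (S - {i})) = expo (corner S)"
    if "i \<in> S" for i S
    using that top_pos[of i] by (intro poly_mapping_eqI) (auto simp: lookup_add corner_def indicator_exp_def)
  have corner_mono: "corner (S - {i}) \<le> corner S" for i S
    by (auto simp: corner_def le_fun_def)
  define d where "d S = (if S \<in> X then c S else 0)" for S
  define w :: "'n set \<Rightarrow> ('n, 'k) poly_ring"
    where "w T = Poly_Mapping.single (expo (corner (- T))) (d (- T))" for T
  have compl: "- insert i T = - T - {i}" for i and T :: "'n set" by auto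
  have dw: "koszul_diff variable w T = Poly_Mapping.single (expo (corner (- T)))
      (\<Sum>i\<in>-T. koszul_sign i T * d (- T - {i}))" for T
  proof -
    have "koszul_sign i T * variable i * w (insert i T) = Poly_Mapping.single (expo (corner (- T)))
      (koszul_sign i T * d (- T - {i}))" if "i \<in> - T" for i
    proof -
      have "variable i * w (insert i T) = Poly_Mapping.single
          (expo (indicator_exp {i}) + expo (corner (- T - {i}))) (d (- T - {i}))"
        unfolding w_def compl variable_def monom_def by (simp only: mult_single mult_1)
      also have "expo (indicator_exp {i}) + expo (corner (- T - {i})) = expo (corner (- T))"
        by (rule corner_step[OF that])
      finally show ?thesis by (simp only: mult.assoc koszul_sign_mult_single)
    qed
    then have "koszul_diff variable w T = (\<Sum>i\<in>-T. Poly_Mapping.single (expo (corner (- T)))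
      (koszul_sign i T * d (- T - {i})))"
      unfolding koszul_diff_def by (intro sum.cong refl)
    also have "\<dots> = Poly_Mapping.single (expo (corner (- T)))
      (\<Sum>i\<in>-T. koszul_sign i T * d (- T - {i}))"
      by (rule poly_mapping_eqI) (simp add: lookup_sum lookup_single when_def)
    finally show ?thesis .
  qed
  show ?thesis
    unfolding koszul_homology_nonzero_def
  proof (intro exI[of _ w] conjI allI impI)
    fix T show "w T \<in> ?N"
      by (auto simp: w_def d_def X supported_def)
  next
    fix T :: "'n set" assume T: "card T \<noteq> card (UNIV :: 'n set) - t"
    have "card (- T) \<noteq> t"
    proof
      assume "card (- T) = t"
      moreover have "card (- T) = card (UNIV :: 'n set) - card T"
        by (simp add: Compl_eq_Diff_UNIV card_Diff_subset)
      moreover have "card T \<le> card (UNIV :: 'n set)" by (intro card_mono) auto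
      ultimately show False using T by simp
    qed
    then show "w T = 0" by (simp add: w_def d_def X)
  next
    fix T :: "'n set"
    let ?S = "- T"
    let ?d = "\<Sum>i\<in>-T. koszul_sign i T * d (- T - {i})"
    have "corner ?S \<in> V \<or> ?d = 0"
    proof (cases "\<exists>i\<in>?S. d (?S - {i}) \<noteq> 0")
      case True
      then obtain i where i: "i \<in> ?S" "?S - {i} \<in> X" by (auto simp: d_def split: if_splits)
      then have "card ?S = Suc t" using X card_Suc_Diff1[of ?S i] by simp
      moreover have "corner ?S \<in> U" using i X corner_mono[of ?S i] up_closedD[OF up_U] by blast
      ultimately show ?thesis using rel[of ?S] by (auto simp: d_def)
    next
      case False
      then show ?thesis by (auto intro: sum.neutral)
    qed
    then show "koszul_diff variable w T \<in> ?P" unfolding dw by (auto simp: supported_def)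
  next
    show "\<not> (\<exists>v. (\<forall>T. v T \<in> ?N) \<and> (\<forall>T. w T - koszul_diff variable v T \<in> ?P))"
    proof
      assume "\<exists>v. (\<forall>T. v T \<in> ?N) \<and> (\<forall>T. w T - koszul_diff variable v T \<in> ?P)"
      then obtain v where v: "\<And>T. v T \<in> ?N" "\<And>T. w T - koszul_diff variable v T \<in> ?P" by blast
      let ?T = "- S0" and ?k = "expo (corner S0)"
      have S0: "card S0 = t" "corner S0 \<in> U" "corner S0 \<notin> V" using nz(1) X by auto
      have vanish: "Poly_Mapping.lookup (koszul_sign i ?T * variable i * v (insert i ?T)) ?k = 0"
        if i: "i \<in> S0" for i
      proof -
        let ?q = "koszul_sign i ?T * v (insert i ?T)"
        have q: "?q \<in> ?N" by (rule ideal.subspace_scale[OF sU v(1)])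
        have "corner (S0 - {i}) \<notin> U"
        proof
          assume "corner (S0 - {i}) \<in> U"
          moreover have "corner (S0 - {i}) \<notin> V"
            using S0(3) corner_mono[of S0 i] up_closedD[OF up_V] by blast
          ultimately have "t \<le> card (S0 - {i})" using sat_ge[of "corner (S0 - {i})"] sat_corner by simp
          moreover have "card (S0 - {i}) < card S0" using i by (intro card_Diff1_less) auto
          ultimately show False using S0(1) by simp
        qed
        then have "expo (corner (S0 - {i})) \<notin> Poly_Mapping.keys ?q"
          using supportedD[OF q] by (metis lookup_expo)
        then have "Poly_Mapping.lookup ?q (expo (corner (S0 - {i}))) = 0" by (simp add: in_keys_iff)
        then have "Poly_Mapping.lookup (variable i * ?q) ?k = 0"
          unfolding variable_def corner_step[OF i, symmetric] by (simp only: lookup_monom_mult)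
        moreover have "variable i * ?q = koszul_sign i ?T * variable i * v (insert i ?T)"
          by (simp only: mult_ac)
        ultimately show ?thesis by (simp only:)
      qed
      then have "Poly_Mapping.lookup (koszul_diff variable v ?T) ?k = 0"
        unfolding koszul_diff_def lookup_sum by (intro sum.neutral ballI vanish) simp
      then have "Poly_Mapping.lookup (w ?T - koszul_diff variable v ?T) ?k = c S0"
        using nz(1) by (simp add: lookup_minus w_def d_def)
      then have "?k \<in> Poly_Mapping.keys (w ?T - koszul_diff variable v ?T)"
        using nz(2) by (simp add: in_keys_iff)
      then have "Poly_Mapping.lookup ?k \<in> V" by (rule supportedD[OF v(2)])
      then show False using S0(3) by simp
    qed
  qed
qed

text \<open>
  The matrix \<open>v\<close> is the Koszul differential in multidegree \<open>top\<close>, from the corners with \<open>t\<close> to those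
  with \<open>t + 1\<close> saturated coordinates. Its nonzero entries are incidences, so a matching along them
  is one of the kind required for merging classes.
\<close>

lemma koszul_homology_nonzero_or_partitionable:
  assumes rank: "\<And>b. b \<in> U \<Longrightarrow>
      t + (\<Sum>i\<in>UNIV. card (E i) - 1) \<le> (\<Sum>i\<in>UNIV. rank (E i) (b i))"
    and no_partition: "\<not> partitionable (Suc t) (U - V)"
  shows "koszul_homology_nonzero variable (card (UNIV :: 'n set) - t)
    (supported U :: ('n, 'k::field) poly_ring set) (supported V)"
proof -
  have sat_ge: "t \<le> card (sat b)" if "b \<in> U - V" for b
    using card_sat_ge(1)[OF rank] that by blast
  have sat_eq: "E i \<noteq> {} \<and> pretop i \<le> b i" if "b \<in> U - V" "card (sat b) = t" for b i
    using card_sat_ge(2)[OF rank] that by blast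
  \<comment> \<open>This provides a vector to which \<open>sat_eq\<close> applies, so that no \<open>E i\<close> is empty.\<close>
  have "\<exists>b\<in>U - V. card (sat b) = t"
  proof (rule ccontr)
    assume "\<not> (\<exists>b\<in>U - V. card (sat b) = t)"
    then have "Suc t \<le> card (sat b)" if "b \<in> U - V" for b
      using sat_ge[OF that] that by (metis Suc_leI le_neq_implies_less)
    then have "Suc t \<le> card {i. top i \<le> b i}" if "b \<in> U - V" for b
      using that by (simp add: sat_def)
    then have "partitionable (Suc t) (U - V)"
      by (rule partitionable_determined[OF determined_diff])
    with no_partition show False by blast
  qed
  then have ne: "E i \<noteq> {}" for i using sat_eq by blast
  define X where "X = {S. card S = t \<and> corner S \<in> U - V}"
  define Y where "Y = {S. card S = Suc t \<and> corner S \<in> U - V}"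
  define v where "v S S' = (\<Sum>i\<in>S'. if S' - {i} = S then koszul_sign i (- S') else (0::'k))"
    for S S' :: "'n set"
  have combination: "(\<Sum>S\<in>X. c S * v S S')
      = (\<Sum>i\<in>S'. koszul_sign i (- S') * (if S' - {i} \<in> X then c (S' - {i}) else 0))" for c S'
  proof -
    have "(\<Sum>S\<in>X. c S * v S S')
        = (\<Sum>i\<in>S'. \<Sum>S\<in>X. if S' - {i} = S then koszul_sign i (- S') * c S else 0)"
      unfolding v_def sum_distrib_left by (subst sum.swap) (intro sum.cong refl, simp)
    also have "\<dots> = (\<Sum>i\<in>S'. koszul_sign i (- S') * (if S' - {i} \<in> X then c (S' - {i}) else 0))"
      by (intro sum.cong refl) (subst sum.delta', auto)
    finally show ?thesis .
  qed
  have "\<exists>c. (\<forall>S'\<in>Y. (\<Sum>S\<in>X. c S * v S S') = 0) \<and> (\<exists>S\<in>X. c S \<noteq> 0)"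
  proof (rule ccontr)
    assume no_rel: "\<not> (\<exists>c. (\<forall>S'\<in>Y. (\<Sum>S\<in>X. c S * v S S') = 0) \<and> (\<exists>S\<in>X. c S \<noteq> 0))"
    have "\<exists>m. inj_on m X \<and> (\<forall>S\<in>X. m S \<in> Y \<and> v S (m S) \<noteq> 0)"
      by (rule independent_rows_matching) (use no_rel in auto)
    then obtain m where m: "inj_on m X" "\<And>S. S \<in> X \<Longrightarrow> m S \<in> Y \<and> v S (m S) \<noteq> 0" by blast
    have "corner (m S) \<in> U - V \<and> (\<exists>i. i \<notin> S \<and> m S = insert i S)" if S: "S \<in> X" for S
    proof -
      have "\<exists>i\<in>m S. m S - {i} = S"
      proof (rule ccontr)
        assume "\<not> (\<exists>i\<in>m S. m S - {i} = S)"
        then have "v S (m S) = 0" unfolding v_def by (intro sum.neutral) simp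
        then show False using m(2)[OF S] by simp
      qed
      then obtain i where "i \<in> m S" "m S - {i} = S" by blast
      then have "i \<notin> S \<and> m S = insert i S" by blast
      then show ?thesis using m(2)[OF S] by (auto simp: Y_def)
    qed
    then have "partitionable (Suc t) (U - V)"
      using partitionable_of_matching[OF sat_ge _ X_def m(1)] sat_eq by blast
    with no_partition show False by blast
  qed
  then obtain c S0 where c: "\<forall>S'\<in>Y. (\<Sum>S\<in>X. c S * v S S') = 0" "S0 \<in> X" "c S0 \<noteq> 0" by blast
  show ?thesis
  proof (rule koszul_homology_nonzero_of_relation[OF sat_ge ne X_def])
    fix S :: "'n set" assume "card S = Suc t" "corner S \<in> U - V"
    then have "S \<in> Y" by (simp add: Y_def)
    then show "(\<Sum>i\<in>S. koszul_sign i (- S) * (if S - {i} \<in> X then c (S - {i}) else 0)) = 0"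
      using c(1) by (simp only: combination)
  qed (use c in auto)
qed

end


section \<open>Comparison of the depth with the index\<close>

lemma pos_exps_positive: "k \<in> pos_exps I J i \<Longrightarrow> k > 0"
  by (auto simp: pos_exps_def)

lemma exponents_levels:
  fixes I J M :: "('n::finite, 'k::comm_ring_1) poly_ring set"
  assumes "monomial_ideal M" "M \<in> {I, J}"
    and "\<And>i k. k \<in> pos_exps I J i \<Longrightarrow> k \<le> b i \<longleftrightarrow> k \<le> c i"
  shows "b \<in> exponents M \<longleftrightarrow> c \<in> exponents M"
proof -
  have "Poly_Mapping.lookup a i \<le> b i \<longleftrightarrow> Poly_Mapping.lookup a i \<le> c i"
    if "a \<in> min_gens M" for a i
  proof -
    have "a \<in> min_gens I \<union> min_gens J" using that assms(2) by auto
    then have "Poly_Mapping.lookup a i \<in> pos_exps I J i \<or> Poly_Mapping.lookup a i = 0"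
      by (rule lookup_in_pos_exps)
    then show ?thesis using assms(3)[of "Poly_Mapping.lookup a i" i] by auto
  qed
  then show ?thesis by (simp add: exponents_iff_min_gens[OF assms(1)] le_fun_def)
qed

lemma max_ideal_coefficients:
  assumes "f \<in> (max_ideal :: ('n::{finite,linorder}, 'k::comm_ring_1) poly_ring set)"
  shows "\<exists>c. f = (\<Sum>i\<in>UNIV. c i * variable i)"
proof -
  let ?T = "{f :: ('n, 'k) poly_ring. \<exists>c. f = (\<Sum>i\<in>UNIV. c i * variable i)}"
  have "ideal.subspace ?T"
  proof (rule ideal.subspaceI)
    show "0 \<in> ?T" by (auto intro: exI[of _ "\<lambda>_. 0"])
  next
    fix f g assume "f \<in> ?T" "g \<in> ?T"
    then obtain c d where "f = (\<Sum>i\<in>UNIV. c i * variable i)" "g = (\<Sum>i\<in>UNIV. d i * variable i)"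
      by auto
    then have "f + g = (\<Sum>i\<in>UNIV. (c i + d i) * variable i)"
      by (simp add: distrib_right sum.distrib)
    then show "f + g \<in> ?T" by (intro CollectI exI)
  next
    fix h f assume "f \<in> ?T"
    then obtain c where "f = (\<Sum>i\<in>UNIV. c i * variable i)" by auto
    then have "h * f = (\<Sum>i\<in>UNIV. (h * c i) * variable i)"
      by (simp add: sum_distrib_left mult.assoc)
    then show "h * f \<in> ?T" by (intro CollectI exI)
  qed
  moreover have "monom (Poly_Mapping.single j 1) \<in> ?T" for j
  proof -
    have "expo (indicator_exp {j}) = Poly_Mapping.single j (1::nat)"
      by (rule poly_mapping_eqI) (auto simp: lookup_single when_def indicator_exp_def)
    then have "variable j = (monom (Poly_Mapping.single j 1) :: ('n, 'k) poly_ring)"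
      by (simp add: variable_def)
    moreover have "(\<Sum>i\<in>UNIV. (if i = j then 1 else 0) * variable i) = (variable j :: ('n, 'k) poly_ring)"
      by (simp add: if_distrib[of "\<lambda>x. x * _"] cong: if_cong)
    ultimately have "monom (Poly_Mapping.single j 1)
        = (\<Sum>i\<in>UNIV. (if i = j then 1 else 0) * (variable i :: ('n, 'k) poly_ring))" by simp
    then show ?thesis by (intro CollectI exI)
  qed
  ultimately have "max_ideal \<subseteq> ?T"
    unfolding max_ideal_def by (intro ideal.span_minimal) auto
  with assms show ?thesis by blast
qed

lemma elem_sym_in_max_ideal:
  assumes "k > 0"
  shows "elem_sym k \<in> (max_ideal :: ('n::{finite,linorder}, 'k::comm_ring_1) poly_ring set)"
  unfolding elem_sym_def
proof (rule ideal.subspace_sum)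
  show "ideal.subspace (max_ideal :: ('n, 'k) poly_ring set)" by (simp add: max_ideal_def)
  fix F :: "'n set" assume "F \<in> {F. card F = k}"
  then obtain j where j: "j \<in> F" using assms by fastforce
  have "Poly_Mapping.lookup (Poly_Mapping.single j 1) \<le> Poly_Mapping.lookup (expo (indicator_exp F))"
    using j by (auto simp: le_fun_def lookup_single when_def indicator_exp_def)
  then obtain c where "expo (indicator_exp F) = Poly_Mapping.single j 1 + c" using le_imp_add by blast
  then have "(monom (expo (indicator_exp F)) :: ('n, 'k) poly_ring)
      = monom c * monom (Poly_Mapping.single j 1)"
    by (simp add: monom_add mult.commute)
  moreover have "(monom (Poly_Mapping.single j 1) :: ('n, 'k) poly_ring) \<in> max_ideal"
    unfolding max_ideal_def by (intro ideal.span_base) auto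
  ultimately show "(monom (expo (indicator_exp F)) :: ('n, 'k) poly_ring) \<in> max_ideal"
    by (simp add: max_ideal_def ideal.span_scale)
qed

lemma regular_seq_elem_syms:
  fixes U V :: "('n::{finite,linorder} \<Rightarrow> nat) set"
  assumes "up_closed U" "up_closed V" "V \<subset> U" "determined g U" "determined g V"
    and "\<And>b. b \<in> U - V \<Longrightarrow> t \<le> card {i. g i \<le> b i}"
  shows "regular_seq (supported U :: ('n, 'k::comm_ring_1) poly_ring set) (supported V) (elem_syms t)"
proof (rule regular_seq_of_weakly_regular)
  obtain b where b: "b \<in> U" "b \<notin> V" using assms(3) by blast
  then have "(monom (expo b) :: ('n, 'k) poly_ring) \<in> supported U - supported V" by simp
  then show "supported V \<subset> (supported U :: ('n, 'k) poly_ring set)"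
    using supported_mono[of V U] assms(3) by blast
  show "\<exists>d>0. homogeneous d f" if "f \<in> set (elem_syms t)" for f :: "('n, 'k) poly_ring"
    using set_elem_syms[OF that] homogeneous_elem_sym by blast
  show "weakly_regular (supported U :: ('n, 'k) poly_ring set) (supported V) (elem_syms t)"
    using assms by (intro weakly_regular_supported) auto
qed (simp_all add: subspace_supported graded_supported assms(1,2))

text \<open>
  The monomial with exponent \<open>a\<close> is a nonzero element of the module that is annihilated by all
  variables, hence by every possible first member of a regular sequence.
\<close>

lemma regular_seq_socle:
  fixes U V :: "('n::{finite,linorder} \<Rightarrow> nat) set"
  assumes "up_closed U" "up_closed V" "a \<in> U" "a \<notin> V" "\<And>i. a(i := Suc (a i)) \<in> V"
    and "regular_seq (supported U :: ('n, 'k::comm_ring_1) poly_ring set) (supported V) fs"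
    and "set fs \<subseteq> max_ideal"
  shows "fs = []"
proof (cases fs)
  case (Cons f gs)
  let ?a = "monom (expo a) :: ('n, 'k) poly_ring"
  note sV = subspace_supported[OF assms(2)]
  obtain c where c: "f = (\<Sum>i\<in>UNIV. c i * variable i)"
    using max_ideal_coefficients[of f] assms(7) Cons by auto
  have "variable i * ?a \<in> supported V" for i
  proof -
    have "expo (indicator_exp {i}) + expo a = expo (a(i := Suc (a i)))"
      by (rule poly_mapping_eqI) (simp add: lookup_add indicator_exp_def)
    then have "variable i * ?a = monom (expo (a(i := Suc (a i))))"
      by (simp add: variable_def flip: monom_add)
    then show ?thesis using assms(5) by simp
  qed
  then have "c i * (variable i * ?a) \<in> supported V" for i
    by (rule ideal.subspace_scale[OF sV])
  then have "(\<Sum>i\<in>UNIV. c i * (variable i * ?a)) \<in> supported V"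
    by (rule ideal.subspace_sum[OF sV])
  then have "f * ?a \<in> supported V" by (simp add: c sum_distrib_right mult.assoc)
  moreover have "?a \<in> supported U" "?a \<notin> supported V" using assms(3,4) by simp_all
  ultimately show ?thesis using assms(6) Cons by auto
qed simp

theorem theorem6:
  fixes I J :: "('n::{finite,linorder}, 'k::field) poly_ring set"
  assumes "monomial_ideal I" and "monomial_ideal J" and "J \<subset> I"
    and "sdepth I J = index I J"
  shows "depth I J = index I J"
proof -
  define U where "U = exponents I"
  define V where "V = exponents J"
  define E where "E = pos_exps I J"
  define t where "t = index I J"
  have I: "I = supported U" and J: "J = supported V"
    using monomial_ideal_eq_supported assms(1,2) by (auto simp: U_def V_def)
  have upU: "up_closed U" and upV: "up_closed V"
    using up_closed_exponents assms(1,2) by (auto simp: U_def V_def)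
  have "V \<subseteq> U" unfolding U_def V_def exponents_def using assms(3) by (intro image_mono) auto
  moreover have "V \<noteq> U" using assms(3) I J by auto
  ultimately have VU: "V \<subset> U" by blast
  interpret exponent_levels E U V
  proof
    show "finite (E i)" for i unfolding E_def by (rule finite_pos_exps)
    show "k > 0" if "k \<in> E i" for k i using that unfolding E_def by (rule pos_exps_positive)
    show "b \<in> U \<longleftrightarrow> c \<in> U" if "\<And>i k. k \<in> E i \<Longrightarrow> k \<le> b i \<longleftrightarrow> k \<le> c i" for b c
      unfolding U_def by (rule exponents_levels[OF assms(1), of I J]) (use that in \<open>auto simp: E_def\<close>)
    show "b \<in> V \<longleftrightarrow> c \<in> V" if "\<And>i k. k \<in> E i \<Longrightarrow> k \<le> b i \<longleftrightarrow> k \<le> c i" for b c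
      unfolding V_def by (rule exponents_levels[OF assms(2), of I J]) (use that in \<open>auto simp: E_def\<close>)
  qed (fact upU upV)+
  have no_partition: "\<not> partitionable (Suc t) (U - V)"
  proof
    assume "partitionable (Suc t) (U - V)"
    then have "Suc t \<le> sdepth I J" unfolding I J by (intro sdepth_ge upU upV VU)
    with assms(4) show False by (simp add: t_def)
  qed
  have rank: "t + (\<Sum>i\<in>UNIV. card (E i) - 1) \<le> (\<Sum>i\<in>UNIV. rank (E i) (b i))"
    if "t > 0" "b \<in> U" for b
    using index_le_ranks[OF assms(1), of J b] that by (simp add: U_def E_def t_def)
  have sat_ge: "t \<le> card (sat b)" if "b \<in> U - V" for b
    using card_sat_ge(1)[OF rank] that by (cases "t = 0") auto
  have "regular_seq I J (elem_syms t)"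
    unfolding I J using sat_ge
    by (intro regular_seq_elem_syms[of _ _ top] upU upV VU determined_U determined_V) (simp add: sat_def)
  moreover have "set (elem_syms t) \<subseteq> (max_ideal :: ('n, 'k) poly_ring set)"
    using set_elem_syms elem_sym_in_max_ideal by blast
  ultimately have attained: "\<exists>fs. t = length fs \<and> set fs \<subseteq> max_ideal \<and> regular_seq I J fs"
    by (intro exI[of _ "elem_syms t"]) simp
  have bound: "length fs \<le> t" if fs: "set fs \<subseteq> max_ideal" "regular_seq I J fs" for fs
  proof (cases "t = 0")
    case True
    have "\<exists>a\<in>U - V. \<forall>i\<in>UNIV. a(i := Suc (a i)) \<notin> U - V"
    proof (rule ccontr)
      assume no_socle: "\<not> (\<exists>a\<in>U - V. \<forall>i\<in>UNIV. a(i := Suc (a i)) \<notin> U - V)"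
      have "partitionable 1 (U - V)"
      proof (rule partitionable_positive[OF _ determined_diff])
        show "b \<in> U - V" if "a \<in> U - V" "c \<in> U - V" "a \<le> b" "b \<le> c" for a b c
          using that up_closedD[OF upU] up_closedD[OF upV] by blast
        show "\<exists>i\<in>UNIV. a(i := Suc (a i)) \<in> U - V" if "a \<in> U - V" for a
          using no_socle that by blast
      qed simp
      then show False using no_partition True by simp
    qed
    then obtain a where a: "a \<in> U" "a \<notin> V" "\<And>i. a(i := Suc (a i)) \<notin> U - V" by blast
    have "a(i := Suc (a i)) \<in> V" for i
    proof -
      have "a(i := Suc (a i)) \<in> U" by (rule up_closedD[OF upU a(1)]) (simp add: le_fun_def)
      then show ?thesis using a(3)[of i] by blast
    qed
    then have "fs = []"
      using regular_seq_socle[OF upU upV a(1,2) _ fs(2)[unfolded I J] fs(1)] by blast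
    then show ?thesis by simp
  next
    case False
    then have "koszul_homology_nonzero variable (card (UNIV :: 'n set) - t) I J"
      unfolding I J using rank no_partition
      by (intro koszul_homology_nonzero_or_partitionable) (auto simp: I J)
    then have "card (UNIV :: 'n set) - t + length fs \<le> card (UNIV :: 'n set)"
      using fs max_ideal_coefficients subspace_supported[OF upU] subspace_supported[OF upV]
      by (intro koszul_homology_bound[of I J fs variable]) (auto simp: I J)
    moreover have "t \<le> card (UNIV :: 'n set)"
    proof -
      obtain b where "b \<in> U - V" using VU by blast
      then have "t \<le> card (sat b)" by (rule sat_ge)
      also have "\<dots> \<le> card (UNIV :: 'n set)" by (intro card_mono) auto
      finally show ?thesis .
    qed
    ultimately show ?thesis by simp
  qed
  have "depth I J = t"
    unfolding depth_def
  proof (rule Max_eqI)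
    show "finite {length fs |fs. set fs \<subseteq> max_ideal \<and> regular_seq I J fs}"
      by (rule finite_subset[of _ "{..t}"]) (use bound in auto)
  qed (use bound attained in auto)
  then show ?thesis by (simp add: t_def)
qed

end
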